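(* Let $X_{\mathbb C}$ be a complex Banach space and let $\mathcal C\subset X_{\mathbb C}$ be a $\mathbb C$-cone. Let $A\in L(X_{\mathbb C})$ be either a quasi-compact operator or a compact operator of strictly positive spectral radius, and suppose that $$A(\mathcal C^* )\subset\mathcal C^o .$$ Then $A$ has a spectral gap.
   Context: A $\mathbb C$-cone in $X_{\mathbb C}$ is a closed subset $\mathcal C$ which is $\mathbb C$-invariant ($\mathbb C\,\mathcal C=\mathcal C$), contains at least one complex line $\mathbb Cx$ ($x\neq0$), and contains no complex planes, i.e. if $x,y$ are linearly independent then $\operatorname{Span}_{\mathbb C}\{x,y\}\not\subset\mathcal C$. $\mathcal C^*=\mathcal C\setminus\{0\}$ and $\mathcal C^o$ is the interior of $\mathcal C$. An operator is quasi-compact if its essential spectral radius is strictly smaller than its spectral radius. A bounded operator has a spectral gap if it has a simple isolated eigenvalue whose modulus equals the spectral radius $r_{\rm sp}$ and the remaining part of the spectrum is contained in a disk centered at $0$ of radius strictly smaller than $r_{\rm sp}$. *)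

theory Defs
  imports "HOL-Analysis.Analysis"
begin

text \<open>Complex scalar multiplication extends the real one, and the norm is homogeneous for
  complex scalars.  Topology, completeness and integration come from class \<open>banach\<close>.\<close>

class complex_banach = banach +
  fixes scaleC :: "complex \<Rightarrow> 'a \<Rightarrow> 'a"  (infixr "*\<^sub>C" 75)
  assumes scaleC_add_right: "c *\<^sub>C (x + y) = c *\<^sub>C x + c *\<^sub>C y"
    and scaleC_add_left: "(c + d) *\<^sub>C x = c *\<^sub>C x + d *\<^sub>C x"
    and scaleC_scaleC: "c *\<^sub>C d *\<^sub>C x = (c * d) *\<^sub>C x"
    and scaleC_of_real: "complex_of_real r *\<^sub>C x = r *\<^sub>R x"
    and norm_scaleC: "norm (c *\<^sub>C x) = cmod c * norm x"

lemma scaleC_one: "1 *\<^sub>C x = (x :: 'a::complex_banach)"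
  using scaleC_of_real[of 1 x] by simp

global_interpretation complex_vector:
  vector_space "scaleC :: complex \<Rightarrow> 'a \<Rightarrow> 'a::complex_banach"
  by standard (simp_all add: scaleC_add_right scaleC_add_left scaleC_scaleC scaleC_one)

text \<open>The condition \<open>x \<noteq> y\<close> is needed because \<open>{x, y}\<close> collapses to a singleton otherwise.\<close>

definition C_cone :: "'a::complex_banach set \<Rightarrow> bool" where
  "C_cone C \<longleftrightarrow>
     closed C \<and>
     {c *\<^sub>C x | c x. x \<in> C} = C \<and>
     (\<exists>x. x \<noteq> 0 \<and> range (\<lambda>c. c *\<^sub>C x) \<subseteq> C) \<and>
     (\<forall>x y. x \<noteq> y \<and> complex_vector.independent {x, y} \<longrightarrow>
        \<not> complex_vector.span {x, y} \<subseteq> C)"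

definition bounded_clinear :: "('a::complex_banach \<Rightarrow> 'a) \<Rightarrow> bool" where
  "bounded_clinear A \<longleftrightarrow> bounded_linear A \<and> (\<forall>c x. A (c *\<^sub>C x) = c *\<^sub>C A x)"

definition compact_op :: "('a::complex_banach \<Rightarrow> 'a) \<Rightarrow> bool" where
  "compact_op A \<longleftrightarrow> bounded_clinear A \<and> (\<forall>S. bounded S \<longrightarrow> compact (closure (A ` S)))"

definition is_resolvent :: "('a::complex_banach \<Rightarrow> 'a) \<Rightarrow> complex \<Rightarrow> ('a \<Rightarrow> 'a) \<Rightarrow> bool" where
  "is_resolvent A z R \<longleftrightarrow>
     bounded_clinear R \<and> (\<forall>x. z *\<^sub>C R x - A (R x) = x) \<and> (\<forall>x. R (z *\<^sub>C x - A x) = x)"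

definition spectrum :: "('a::complex_banach \<Rightarrow> 'a) \<Rightarrow> complex set" where
  "spectrum A = {z. \<nexists>R. is_resolvent A z R}"

definition resolvent :: "('a::complex_banach \<Rightarrow> 'a) \<Rightarrow> complex \<Rightarrow> 'a \<Rightarrow> 'a" where
  "resolvent A z = (THE R. is_resolvent A z R)"

definition spectral_radius :: "('a::complex_banach \<Rightarrow> 'a) \<Rightarrow> real" where
  "spectral_radius A = (SUP z \<in> spectrum A. cmod z)"

definition fredholm :: "('a::complex_banach \<Rightarrow> 'a) \<Rightarrow> bool" where
  "fredholm T \<longleftrightarrow>
     bounded_clinear T \<and>
     (\<exists>B. finite B \<and> {x. T x = 0} \<subseteq> complex_vector.span B) \<and>
     closed (range T) \<and>
     (\<exists>B. finite B \<and> complex_vector.span (range T \<union> B) = UNIV)"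

definition essential_spectrum :: "('a::complex_banach \<Rightarrow> 'a) \<Rightarrow> complex set" where
  "essential_spectrum A = {z. \<not> fredholm (\<lambda>x. z *\<^sub>C x - A x)}"

text \<open>Inserting \<open>0\<close> only fixes the value \<open>0\<close> when the essential spectrum is empty, that is, in
  finite dimension.\<close>

definition essential_spectral_radius :: "('a::complex_banach \<Rightarrow> 'a) \<Rightarrow> real" where
  "essential_spectral_radius A = Sup (insert 0 (cmod ` essential_spectrum A))"

definition quasi_compact :: "('a::complex_banach \<Rightarrow> 'a) \<Rightarrow> bool" where
  "quasi_compact A \<longleftrightarrow>
     bounded_clinear A \<and> essential_spectral_radius A < spectral_radius A"

definition eigenvalue :: "('a::complex_banach \<Rightarrow> 'a) \<Rightarrow> complex \<Rightarrow> bool" where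
  "eigenvalue A z \<longleftrightarrow> (\<exists>x. x \<noteq> 0 \<and> A x = z *\<^sub>C x)"

text \<open>The Riesz projection \<open>(2 \<pi> i)\<^sup>-\<^sup>1 \<integral> (\<zeta> - A)\<^sup>-\<^sup>1 d\<zeta>\<close> over the circle of centre \<open>z\<close> and
  radius \<open>e\<close>, written out for the parametrisation \<open>\<zeta> = z + e exp(i t)\<close> and applied to \<open>x\<close>.\<close>

definition riesz_projection ::
    "('a::complex_banach \<Rightarrow> 'a) \<Rightarrow> complex \<Rightarrow> real \<Rightarrow> 'a \<Rightarrow> 'a" where
  "riesz_projection A z e x =
     (1 / (2 * pi)) *\<^sub>R
       integral {0..2 * pi} (\<lambda>t. (of_real e * cis t) *\<^sub>C resolvent A (z + of_real e * cis t) x)"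

text \<open>Simplicity means algebraic multiplicity one, the algebraic multiplicity of an isolated
  eigenvalue being the rank of its Riesz projection.  The projection does not depend on the
  circle as long as the closed disk meets the spectrum only in \<open>z\<close>.\<close>

definition simple_isolated_eigenvalue :: "('a::complex_banach \<Rightarrow> 'a) \<Rightarrow> complex \<Rightarrow> bool" where
  "simple_isolated_eigenvalue A z \<longleftrightarrow>
     eigenvalue A z \<and>
     (\<exists>e>0. spectrum A \<inter> cball z e = {z} \<and>
            complex_vector.dim (range (riesz_projection A z e)) = 1)"

definition spectral_gap :: "('a::complex_banach \<Rightarrow> 'a) \<Rightarrow> bool" where
  "spectral_gap A \<longleftrightarrow>
     (\<exists>z. simple_isolated_eigenvalue A z \<and> cmod z = spectral_radius A \<and>
          (\<exists>r. 0 \<le> r \<and> r < spectral_radius A \<and> spectrum A - {z} \<subseteq> cball 0 r))"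

end

theory Submission
  imports Defs
begin

text \<open>
  Let \<open>r\<close> be the spectral radius and \<open>L\<close> the set of spectral values of modulus \<open>r\<close>.  For \<open>z \<in> L\<close> the operator
  \<open>z - A\<close> is proper on bounded sets (it is Fredholm, or \<open>A\<close> is compact) and a limit of invertible
  operators, hence has a Drazin inverse.  So \<open>L\<close> is a finite set of isolated eigenvalues, and with the
  spectral projections \<open>P\<^sub>z\<close> the part of \<open>A\<^sup>n\<close> outside \<open>E = \<Sum>\<^sub>z P\<^sub>z\<close> is \<open>o(r\<^sup>n)\<close>.

  For \<open>x\<close> in the cone with \<open>E x \<noteq> 0\<close>, the iterates \<open>A\<^sup>n x / (r\<^sup>n n\<^sup>d)\<close>, with the right \<open>d\<close> and along times at which
  all \<open>(z/r)\<^sup>n\<close> are close to 1, converge to a nonzero sum of peripheral eigenvectors lying in the cone.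
  Such sums are recurrent under \<open>A/r\<close>, so those in the cone lie in \<open>A C\<^sup>*\<close>, hence in the interior.  On an affine
  complex line of such sums the cone is therefore open and closed; as the cone contains no complex
  plane, all peripheral eigenvectors are proportional.  If \<open>(z - A) v = u\<close> and \<open>A u = z u\<close> with \<open>u \<noteq> 0\<close>, then
  \<open>{c. v + c u \<in> C}\<close> contains all large \<open>c\<close> and is invariant under \<open>c \<mapsto> c - 1/z\<close>, hence is everything,
  which is again impossible; so the only peripheral eigenvalue is simple.
\<close>

section \<open>The algebra of bounded complex-linear operators\<close>

text \<open>A \<open>C_cone\<close> need not be convex, so iterates cannot be averaged to isolate a
  single peripheral eigenvector; only closedness, complex scaling and the passage into the interior
  are available. Hence the return times common to all phases, and the treatment of whole sums of
  eigenvectors until the peripheral spectrum is known to be one point. On the operator side, algebra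
  replaces function theory: the Drazin inverse supplies the projection and an explicit formula for
  the resolvent near a peripheral point, so a contour integral occurs only at the end, where the
  Riesz projection has to be computed. The bound for the non-peripheral part would usually come from
  Gelfand's formula; here roots of unity serve as a discrete Cauchy integral. A cone vector with
  \<open>E x\<close> nonzero always exists: the interior is nonempty, since it contains the image of
  a nonzero cone vector, and a proper subspace such as the kernel of \<open>E\<close> contains no
  nonempty open set.\<close>

lemma bounded_bilinear_scaleC: "bounded_bilinear (scaleC :: complex \<Rightarrow> 'a \<Rightarrow> 'a::complex_banach)"
proof
  fix a a' :: complex and b b' :: 'a and r :: real
  show "(a + a') *\<^sub>C b = a *\<^sub>C b + a' *\<^sub>C b" "a *\<^sub>C (b + b') = a *\<^sub>C b + a *\<^sub>C b'"
    by (rule scaleC_add_left scaleC_add_right)+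
  show "(r *\<^sub>R a) *\<^sub>C b = r *\<^sub>R a *\<^sub>C b" "a *\<^sub>C r *\<^sub>R b = r *\<^sub>R a *\<^sub>C b"
    by (simp_all add: scaleC_of_real[symmetric] scaleC_scaleC scaleR_conv_of_real mult.commute)
  show "\<exists>K. \<forall>a b. norm (a *\<^sub>C b :: 'a) \<le> norm a * norm b * K"
    by (rule exI[of _ 1]) (simp add: norm_scaleC)
qed

lemmas tendsto_scaleC [tendsto_intros] = bounded_bilinear.tendsto[OF bounded_bilinear_scaleC]
lemmas continuous_on_scaleC [continuous_intros] =
  bounded_bilinear.continuous_on[OF bounded_bilinear_scaleC]
lemmas bounded_linear_scaleC_right = bounded_bilinear.bounded_linear_right[OF bounded_bilinear_scaleC]
lemmas bounded_linear_scaleC_left = bounded_bilinear.bounded_linear_left[OF bounded_bilinear_scaleC]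

lemma scaleR_scaleC: "r *\<^sub>R c *\<^sub>C x = c *\<^sub>C r *\<^sub>R (x::'a::complex_banach)"
  by (simp add: scaleC_of_real[symmetric] scaleC_scaleC mult.commute)

lemmas scaleC_diff_right = complex_vector.scale_right_diff_distrib
lemmas scaleC_diff_left = complex_vector.scale_left_diff_distrib

text \<open>A type of their own turns operators into ring elements, so that spectral theory becomes
  computation with \<open>z *\<^sub>C 1 - a\<close>, powers and commuting projections.\<close>

typedef (overloaded) 'a cop = "{f :: 'a::complex_banach \<Rightarrow>\<^sub>L 'a. \<forall>c x. f (c *\<^sub>C x) = c *\<^sub>C f x}"
  morphisms blinfun_of_cop Cop
  by (rule exI[of _ 0]) simp

setup_lifting type_definition_cop

lift_definition cop_apply :: "'a::complex_banach cop \<Rightarrow> 'a \<Rightarrow> 'a" (infixr "\<cdot>" 75)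
  is blinfun_apply .

lemma cop_eqI: "(\<And>x. a \<cdot> x = b \<cdot> x) \<Longrightarrow> a = b"
  by transfer (rule blinfun_eqI)

instantiation cop :: (complex_banach) real_normed_vector
begin

lift_definition norm_cop :: "'a cop \<Rightarrow> real" is norm .
lift_definition zero_cop :: "'a cop" is 0 by simp
lift_definition plus_cop :: "'a cop \<Rightarrow> 'a cop \<Rightarrow> 'a cop" is "(+)"
  by (simp add: blinfun.add_left scaleC_add_right)
lift_definition minus_cop :: "'a cop \<Rightarrow> 'a cop \<Rightarrow> 'a cop" is "(-)"
  by (simp add: blinfun.diff_left scaleC_diff_right)
lift_definition uminus_cop :: "'a cop \<Rightarrow> 'a cop" is uminus
  by (simp add: blinfun.minus_left)
lift_definition scaleR_cop :: "real \<Rightarrow> 'a cop \<Rightarrow> 'a cop" is scaleR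
  by (simp add: blinfun.scaleR_left scaleR_scaleC)

definition dist_cop :: "'a cop \<Rightarrow> 'a cop \<Rightarrow> real" where
  "dist_cop a b = norm (a - b)"
definition sgn_cop :: "'a cop \<Rightarrow> 'a cop" where
  "sgn_cop a = inverse (norm a) *\<^sub>R a"
definition uniformity_cop :: "('a cop \<times> 'a cop) filter" where
  "uniformity_cop = (INF e\<in>{0 <..}. principal {(x, y). dist x y < e})"
definition open_cop :: "'a cop set \<Rightarrow> bool" where
  "open_cop S \<longleftrightarrow> (\<forall>x\<in>S. \<forall>\<^sub>F (x', y) in uniformity. x' = x \<longrightarrow> y \<in> S)"

instance
proof
  fix a b :: "'a cop"
  show "norm (a + b) \<le> norm a + norm b" by transfer (rule norm_triangle_ineq)
  show "(norm a = 0) = (a = 0)" by transfer simp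
qed (unfold dist_cop_def sgn_cop_def uniformity_cop_def open_cop_def,
     (rule refl | (transfer, simp add: algebra_simps))+)

end

text \<open>Complex linearity survives pointwise limits, so the subtype is closed in the complete
  space of bounded real-linear maps.\<close>

instance cop :: (complex_banach) banach
proof
  fix X :: "nat \<Rightarrow> 'a cop"
  assume X: "Cauchy X"
  have norm_diff: "norm (blinfun_of_cop a - blinfun_of_cop b) = norm (a - b)" for a b :: "'a cop"
    by transfer simp
  have "Cauchy (\<lambda>n. blinfun_of_cop (X n))"
    using X by (simp add: Cauchy_def dist_norm norm_diff)
  then obtain f where f: "(\<lambda>n. blinfun_of_cop (X n)) \<longlonglongrightarrow> f"
    by (meson Cauchy_convergent convergent_def)
  have ev: "(\<lambda>n. blinfun_of_cop (X n) x) \<longlonglongrightarrow> f x" for x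
    by (intro tendsto_intros f)
  have "f (c *\<^sub>C x) = c *\<^sub>C f x" for c x
  proof (rule LIMSEQ_unique[OF ev])
    have "blinfun_of_cop (X n) (c *\<^sub>C x) = c *\<^sub>C blinfun_of_cop (X n) x" for n
      using blinfun_of_cop[of "X n"] by simp
    then show "(\<lambda>n. blinfun_of_cop (X n) (c *\<^sub>C x)) \<longlonglongrightarrow> c *\<^sub>C f x"
      by (simp add: tendsto_scaleC ev)
  qed
  then have fc: "blinfun_of_cop (Cop f) = f"
    by (simp add: Cop_inverse)
  have "X \<longlonglongrightarrow> Cop f"
    using f norm_diff[of _ "Cop f"] unfolding LIMSEQ_def dist_norm fc by simp
  then show "convergent X" by (auto simp: convergent_def)
qed

text \<open>\<open>real_normed_algebra_1\<close> is out of reach, because \<open>1 = 0\<close> on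
  the zero space; hence the weaker sort, with the unit supplied by
  \<open>monoid_mult\<close>.\<close>

instantiation cop :: (complex_banach) "{monoid_mult, real_normed_algebra}"
begin

lift_definition one_cop :: "'a cop" is id_blinfun by simp
lift_definition times_cop :: "'a cop \<Rightarrow> 'a cop \<Rightarrow> 'a cop" is blinfun_compose by simp

instance
proof
  fix a b c :: "'a cop" and r :: real
  show "norm (a * b) \<le> norm a * norm b" by transfer (rule norm_blinfun_compose)
  show "a * b * c = a * (b * c)" by transfer (rule blinfun_eqI, simp only: blinfun_apply_blinfun_compose)
  show "1 * a = a" "a * 1 = a"
    by (transfer, rule blinfun_eqI, simp only: blinfun_apply_blinfun_compose id_blinfun.rep_eq)+
  show "(a + b) * c = a * c + b * c" "a * (b + c) = a * b + a * c"
    by (transfer, rule blinfun_eqI, simp add: blinfun.add_left blinfun.add_right)+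
  show "r *\<^sub>R a * b = r *\<^sub>R (a * b)" "a * r *\<^sub>R b = r *\<^sub>R (a * b)"
    by (transfer, rule blinfun_eqI, simp add: blinfun.scaleR_left blinfun.scaleR_right)+
qed

end

instantiation cop :: (complex_banach) complex_banach
begin

lift_definition scaleC_cop :: "complex \<Rightarrow> 'a cop \<Rightarrow> 'a cop"
  is "\<lambda>c. blinfun_compose (Blinfun (scaleC c))"
  by (simp add: bounded_linear_Blinfun_apply bounded_linear_scaleC_right scaleC_scaleC mult.commute)

instance
proof
  fix a b :: "'a cop" and c d :: complex and r :: real
  show "c *\<^sub>C (a + b) = c *\<^sub>C a + c *\<^sub>C b"
    by (transfer, rule blinfun_eqI)
      (simp add: bounded_linear_Blinfun_apply bounded_linear_scaleC_right blinfun.add_left scaleC_add_right)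
  show "(c + d) *\<^sub>C a = c *\<^sub>C a + d *\<^sub>C a"
    by (transfer, rule blinfun_eqI)
      (simp add: bounded_linear_Blinfun_apply bounded_linear_scaleC_right blinfun.add_left scaleC_add_left)
  show "c *\<^sub>C d *\<^sub>C a = (c * d) *\<^sub>C a"
    by (transfer, rule blinfun_eqI)
      (simp add: bounded_linear_Blinfun_apply bounded_linear_scaleC_right scaleC_scaleC)
  show "complex_of_real r *\<^sub>C a = r *\<^sub>R a"
    by (transfer, rule blinfun_eqI)
      (simp add: bounded_linear_Blinfun_apply bounded_linear_scaleC_right blinfun.scaleR_left
        scaleC_of_real)
  show "norm (c *\<^sub>C a) = cmod c * norm a"
  proof (rule antisym)
    have le: "norm (c *\<^sub>C a) \<le> cmod c * norm a" for c and a :: "'a cop"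
    proof (transfer, rule norm_blinfun_bound)
      show "norm (blinfun_compose (Blinfun (scaleC c)) a x) \<le> cmod c * norm a * norm x"
        for c and a :: "'a \<Rightarrow>\<^sub>L 'a" and x
        by (simp add: bounded_linear_Blinfun_apply bounded_linear_scaleC_right norm_scaleC
            mult.assoc mult_left_mono norm_blinfun)
    qed simp
    show "norm (c *\<^sub>C a) \<le> cmod c * norm a" by (rule le)
    show "cmod c * norm a \<le> norm (c *\<^sub>C a)"
    proof (cases "c = 0")
      case False
      have "inverse c *\<^sub>C c *\<^sub>C a = a"
        using False
        by (transfer, intro blinfun_eqI)
          (simp add: bounded_linear_Blinfun_apply bounded_linear_scaleC_right scaleC_scaleC scaleC_one)
      then have "norm a \<le> cmod (inverse c) * norm (c *\<^sub>C a)"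
        using le[of "inverse c" "c *\<^sub>C a"] by simp
      then show ?thesis
        using False by (simp add: norm_inverse norm_divide field_simps)
    qed simp
  qed
qed

end

lemma cop_apply_simps [simp]:
  "(a + b) \<cdot> x = a \<cdot> x + b \<cdot> x" "(a - b) \<cdot> x = a \<cdot> x - b \<cdot> x"
  "(- a) \<cdot> x = - (a \<cdot> x)" "0 \<cdot> x = 0" "1 \<cdot> x = x" "(a * b) \<cdot> x = a \<cdot> b \<cdot> x"
  "(c *\<^sub>C a) \<cdot> x = c *\<^sub>C a \<cdot> x" "(r *\<^sub>R a) \<cdot> x = r *\<^sub>R a \<cdot> x"
  "a \<cdot> (x + y) = a \<cdot> x + a \<cdot> y" "a \<cdot> (x - y) = a \<cdot> x - a \<cdot> y"
  "a \<cdot> (- x) = - (a \<cdot> x)" "a \<cdot> 0 = 0"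
  "a \<cdot> c *\<^sub>C x = c *\<^sub>C a \<cdot> x" "a \<cdot> r *\<^sub>R x = r *\<^sub>R a \<cdot> x"
  by (transfer, simp add: blinfun.bilinear_simps bounded_linear_Blinfun_apply
      bounded_linear_scaleC_right)+

lemma norm_cop_apply: "norm (a \<cdot> x) \<le> norm a * norm x"
  by transfer (rule norm_blinfun)

lemma bounded_bilinear_cop_apply: "bounded_bilinear cop_apply"
  by standard (simp_all, metis norm_cop_apply mult_1_right)

lemmas tendsto_cop_apply [tendsto_intros] = bounded_bilinear.tendsto[OF bounded_bilinear_cop_apply]
lemmas continuous_on_cop_apply [continuous_intros] =
  bounded_bilinear.continuous_on[OF bounded_bilinear_cop_apply]
lemmas bounded_linear_cop_apply = bounded_bilinear.bounded_linear_right[OF bounded_bilinear_cop_apply]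
lemmas cop_apply_sum_left = bounded_bilinear.sum_left[OF bounded_bilinear_cop_apply]
lemmas cop_apply_sum_right = bounded_bilinear.sum_right[OF bounded_bilinear_cop_apply]

lemma cop_times_scaleC [simp]:
  fixes a b :: "'a::complex_banach cop"
  shows "c *\<^sub>C a * b = c *\<^sub>C (a * b)" "a * c *\<^sub>C b = c *\<^sub>C (a * b)"
  by (rule cop_eqI, simp)+

lemma bounded_clinear_cop_apply: "bounded_clinear (cop_apply a)"
  unfolding bounded_clinear_def by (simp add: bounded_linear_cop_apply)

definition cop_of :: "('a::complex_banach \<Rightarrow> 'a) \<Rightarrow> 'a cop" where
  "cop_of f = Cop (Blinfun f)"

lemma cop_of_apply: "bounded_clinear f \<Longrightarrow> cop_of f \<cdot> x = f x"
  unfolding bounded_clinear_def cop_of_def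
  by (simp add: cop_apply_def Cop_inverse bounded_linear_Blinfun_apply)

lemma cop_apply_cop_of: "bounded_clinear f \<Longrightarrow> cop_apply (cop_of f) = f"
  by (rule ext) (rule cop_of_apply)

section \<open>Inverses, resolvents and the Neumann series\<close>

definition is_inverse :: "'b::monoid_mult \<Rightarrow> 'b \<Rightarrow> bool" where
  "is_inverse a b \<longleftrightarrow> a * b = 1 \<and> b * a = 1"

lemma is_inverse_commute:
  fixes a b c :: "'b::monoid_mult"
  assumes "is_inverse a b" "c * a = a * c"
  shows "c * b = b * c"
proof -
  have "c * b = b * (a * c) * b" using assms by (simp add: is_inverse_def mult.assoc[symmetric])
  also have "\<dots> = b * c * (a * b)" unfolding assms(2)[symmetric] by (simp only: mult.assoc)
  finally show ?thesis using assms by (simp add: is_inverse_def)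
qed

lemma is_inverse_unique: "is_inverse a b \<Longrightarrow> is_inverse a c \<Longrightarrow> b = c"
  unfolding is_inverse_def by (metis mult.assoc[of b a c] mult_1_left mult_1_right)

lemma is_inverse_mult:
  assumes "is_inverse a b" "is_inverse c d"
  shows "is_inverse (a * c) (d * b)"
proof -
  have "a * c * (d * b) = a * (c * d) * b" "d * b * (a * c) = d * (b * a) * c"
    by (simp_all only: mult.assoc)
  then show ?thesis using assms by (simp add: is_inverse_def)
qed

lemma is_inverse_scaleC:
  fixes a :: "'a::complex_banach cop"
  assumes "is_inverse a b" "c \<noteq> 0"
  shows "is_inverse (c *\<^sub>C a) (inverse c *\<^sub>C b)"
  using assms by (simp add: is_inverse_def scaleC_scaleC scaleC_one)

lemma is_resolvent_cop:
  "is_resolvent (cop_apply a) z R \<longleftrightarrow> (\<exists>b. R = cop_apply b \<and> is_inverse (z *\<^sub>C 1 - a) b)"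
proof
  assume R: "is_resolvent (cop_apply a) z R"
  then have bR: "bounded_clinear R" by (simp add: is_resolvent_def)
  have "is_inverse (z *\<^sub>C 1 - a) (cop_of R)"
    unfolding is_inverse_def
  proof (intro conjI cop_eqI)
    fix x
    show "((z *\<^sub>C 1 - a) * cop_of R) \<cdot> x = 1 \<cdot> x"
      using R by (simp add: is_resolvent_def cop_of_apply bR)
    have "(cop_of R * (z *\<^sub>C 1 - a)) \<cdot> x = cop_of R \<cdot> (z *\<^sub>C x - a \<cdot> x)"
      by (simp only: cop_apply_simps)
    also have "\<dots> = 1 \<cdot> x"
      unfolding cop_of_apply[OF bR] using R by (simp add: is_resolvent_def)
    finally show "(cop_of R * (z *\<^sub>C 1 - a)) \<cdot> x = 1 \<cdot> x" .
  qed
  with bR show "\<exists>b. R = cop_apply b \<and> is_inverse (z *\<^sub>C 1 - a) b"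
    by (metis cop_apply_cop_of)
next
  assume "\<exists>b. R = cop_apply b \<and> is_inverse (z *\<^sub>C 1 - a) b"
  then obtain b where b: "R = cop_apply b" "(z *\<^sub>C 1 - a) * b = 1" "b * (z *\<^sub>C 1 - a) = 1"
    by (auto simp: is_inverse_def)
  show "is_resolvent (cop_apply a) z R"
    unfolding is_resolvent_def b(1)
    using arg_cong[OF b(2), of "\<lambda>c. c \<cdot> x" for x] arg_cong[OF b(3), of "\<lambda>c. c \<cdot> x" for x]
    by (simp add: bounded_clinear_cop_apply)
qed

lemma not_in_spectrum_cop:
  "z \<notin> spectrum (cop_apply a) \<longleftrightarrow> (\<exists>b. is_inverse (z *\<^sub>C 1 - a) b)"
  unfolding spectrum_def by (auto simp: is_resolvent_cop)

lemma resolvent_cop: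
  assumes "is_inverse (z *\<^sub>C 1 - a) b"
  shows "resolvent (cop_apply a) z = cop_apply b"
  unfolding resolvent_def using assms
  by (intro the_equality) (auto simp: is_resolvent_cop dest: is_inverse_unique)

text \<open>The exponent starts at one: the norm of \<open>1\<close> may exceed 1 in this
  class.\<close>

lemma norm_power_Suc_le:
  fixes a :: "'b::{real_normed_algebra, monoid_mult}"
  shows "norm (a ^ Suc n) \<le> norm a ^ Suc n"
proof (induction n)
  case (Suc n)
  have "norm (a ^ Suc (Suc n)) \<le> norm a * norm (a ^ Suc n)"
    by (simp only: power_Suc[of a "Suc n"] norm_mult_ineq)
  also have "\<dots> \<le> norm a * norm a ^ Suc n"
    by (rule mult_left_mono[OF Suc]) simp
  finally show ?case by simp
qed simp

lemma one_minus_mult_geometric: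
  fixes x :: "'b::{ring, monoid_mult}"
  shows "(1 - x) * (\<Sum>i<n. x ^ i) = 1 - x ^ n" "(\<Sum>i<n. x ^ i) * (1 - x) = 1 - x ^ n"
proof (induction n)
  case (Suc n)
  { case 1 show ?case
      unfolding sum.lessThan_Suc distrib_left Suc by (simp add: left_diff_distrib) }
  { case 2 show ?case
      unfolding sum.lessThan_Suc distrib_right Suc by (simp add: right_diff_distrib power_commutes) }
qed simp_all

lemma neumann_series:
  fixes a :: "'b::{real_normed_algebra, monoid_mult, banach}"
  assumes "norm a < 1"
  shows "\<exists>b. is_inverse (1 - a) b"
proof -
  \<comment> \<open>Shifted, because the geometric bound is available only from exponent one
    on.\<close>
  have "summable (\<lambda>n. a ^ Suc n)"
  proof (rule summable_comparison_test)
    show "\<exists>N. \<forall>n\<ge>N. norm (a ^ Suc n) \<le> norm a ^ Suc n"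
      by (intro exI allI impI norm_power_Suc_le)
    show "summable (\<lambda>n. norm a ^ Suc n)"
      using assms by (subst summable_Suc_iff) simp
  qed
  then have "summable (\<lambda>n. a ^ n)"
    by (simp only: summable_Suc_iff)
  then have lim: "(\<lambda>n. \<Sum>i<n. a ^ i) \<longlonglongrightarrow> (\<Sum>n. a ^ n)" and zero: "(\<lambda>n. a ^ n) \<longlonglongrightarrow> 0"
    by (rule summable_LIMSEQ, rule summable_LIMSEQ_zero)
  have one: "(\<lambda>n. 1 - a ^ n) \<longlonglongrightarrow> 1"
    using tendsto_diff[OF tendsto_const zero, of 1] by simp
  have "(\<lambda>n. (1 - a) * (\<Sum>i<n. a ^ i)) \<longlonglongrightarrow> (1 - a) * (\<Sum>n. a ^ n)"
    "(\<lambda>n. (\<Sum>i<n. a ^ i) * (1 - a)) \<longlonglongrightarrow> (\<Sum>n. a ^ n) * (1 - a)"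
    by (intro tendsto_mult tendsto_const lim)+
  then have "(1 - a) * (\<Sum>n. a ^ n) = 1" "(\<Sum>n. a ^ n) * (1 - a) = 1"
    unfolding one_minus_mult_geometric using one by (blast intro: LIMSEQ_unique)+
  then show ?thesis by (auto simp: is_inverse_def)
qed

section \<open>Spectrum and powers\<close>

lemma scaleC_power:
  fixes a :: "'a::complex_banach cop"
  shows "(c *\<^sub>C a) ^ n = c ^ n *\<^sub>C a ^ n"
  by (induction n) (simp_all add: scaleC_scaleC scaleC_one)

text \<open>Division with remainder k = n q + r bounds the norm of \<open>a ^ k\<close> by
  \<open>norm (a ^ n) ^ q\<close> times the largest of the first few norms, and q tends to infinity
  with k.\<close>

lemma power_tendsto_zero:
  fixes a :: "'b::{real_normed_algebra, monoid_mult}"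
  assumes "n \<ge> 1" "norm (a ^ n) < 1"
  shows "(\<lambda>k. a ^ k) \<longlonglongrightarrow> 0"
proof -
  define M where "M = Max ((\<lambda>r. norm (a ^ r)) ` {..n})"
  have M: "norm (a ^ r) \<le> M" if "r \<le> n" for r
    unfolding M_def by (rule Max_ge) (use that in auto)
  have bound: "norm (a ^ (n * q + r)) \<le> norm (a ^ n) ^ q * M" if "r \<le> n" for q r
  proof (induction q)
    case (Suc q)
    have "norm (a ^ (n * Suc q + r)) \<le> norm (a ^ n) * norm (a ^ (n * q + r))"
      using norm_mult_ineq[of "a ^ n" "a ^ (n * q + r)"] by (simp add: power_add mult.assoc)
    also have "\<dots> \<le> norm (a ^ n) * (norm (a ^ n) ^ q * M)"
      by (rule mult_left_mono[OF Suc]) simp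
    finally show ?case by (simp add: mult.assoc)
  qed (simp add: M that)
  have "norm (a ^ k) \<le> norm (a ^ n) ^ (k div n) * M" for k
    using bound[of "k mod n" "k div n"] assms(1) by (simp add: less_imp_le)
  moreover have "(\<lambda>k. norm (a ^ n) ^ (k div n) * M) \<longlonglongrightarrow> 0"
  proof (rule tendsto_mult_left_zero)
    have "filterlim (\<lambda>k. k div n) at_top at_top"
      unfolding filterlim_at_top eventually_sequentially
    proof (intro allI exI impI)
      fix Z k assume "Z * n \<le> k"
      then show "Z \<le> k div n" using assms(1) by (simp add: less_eq_div_iff_mult_less_eq)
    qed
    with LIMSEQ_power_zero[of "norm (a ^ n)"] assms(2)
    show "(\<lambda>k. norm (a ^ n) ^ (k div n)) \<longlonglongrightarrow> 0"
      by (auto intro: filterlim_compose)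
  qed
  ultimately show ?thesis
    by (intro Lim_null_comparison[of "\<lambda>k. a ^ k"]) auto
qed

lemma sum_powers_root_of_unity:
  assumes "j < n"
  shows "(\<Sum>k<n. (cis (2 * pi / n) ^ k) ^ j) = (if j = 0 then of_nat n else 0)"
proof (cases "j = 0")
  case False
  let ?w = "cis (2 * pi * j / n)"
  have "?w \<noteq> 1"
  proof
    assume "?w = 1"
    then have "cos (2 * pi * j / n) = 1" by (simp add: complex_eq_iff)
    then obtain m :: int where "2 * pi * j / n = of_int m * 2 * pi"
      by (auto simp: cos_one_2pi_int)
    then have "real j = of_int m * real n" using assms by (simp add: field_simps)
    then have "int j = m * int n" by (metis of_int_eq_iff of_int_mult of_int_of_nat_eq)
    then show False using assms False
      by (metis dvd_triv_right int_dvd_int_iff nat_dvd_not_less neq0_conv)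
  qed
  moreover have "?w ^ n = cis (2 * pi * real j)"
    using assms by (simp add: Complex.DeMoivre)
  then have "?w ^ n = 1" by (simp add: cis_multiple_2pi)
  ultimately have "(\<Sum>k<n. ?w ^ k) = 0"
    by (simp add: geometric_sum)
  moreover have "(cis (2 * pi / n) ^ k) ^ j = ?w ^ k" for k
    by (simp add: Complex.DeMoivre algebra_simps)
  ultimately show ?thesis using False by simp
qed simp

text \<open>This is the partial fraction identity 1/(1 - y^n) = (1/n) sum 1/(1 - w^k y) over the
  n-th roots of unity: \<open>(1 - y ^ n) * u k\<close> is a finite geometric sum in w^k y, and
  summation over k cancels every power except the zeroth.\<close>

lemma resolvent_mean:
  fixes y :: "'a::complex_banach cop"
  assumes "n \<ge> 1" and u: "\<And>k. k < n \<Longrightarrow> is_inverse (1 - (cis (2 * pi / n) ^ k) *\<^sub>C y) (u k)"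
  shows "(1 - y ^ n) * ((1 / n) *\<^sub>R (\<Sum>k<n. u k)) = 1"
proof -
  let ?w = "cis (2 * pi / n)"
  have "?w ^ n = 1"
    using assms(1) by (simp add: Complex.DeMoivre)
  then have wn: "(?w ^ k) ^ n = 1" for k
    by (metis mult.commute power_mult power_one)
  have one: "(1 - y ^ n) * u k = (\<Sum>j<n. (?w ^ k) ^ j *\<^sub>C y ^ j)" if "k < n" for k
  proof -
    have "1 - y ^ n = (\<Sum>j<n. (?w ^ k *\<^sub>C y) ^ j) * (1 - ?w ^ k *\<^sub>C y)"
      unfolding one_minus_mult_geometric by (simp only: scaleC_power wn scaleC_one)
    then have "(1 - y ^ n) * u k = (\<Sum>j<n. (?w ^ k *\<^sub>C y) ^ j) * ((1 - ?w ^ k *\<^sub>C y) * u k)"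
      by (simp only: mult.assoc)
    then show ?thesis using u[OF that] by (simp add: is_inverse_def scaleC_power)
  qed
  have "(1 - y ^ n) * (\<Sum>k<n. u k) = (\<Sum>k<n. \<Sum>j<n. (?w ^ k) ^ j *\<^sub>C y ^ j)"
    by (simp add: sum_distrib_left one)
  also have "\<dots> = (\<Sum>j<n. (\<Sum>k<n. (?w ^ k) ^ j) *\<^sub>C y ^ j)"
    by (subst sum.swap) (simp add: complex_vector.scale_sum_left)
  also have "\<dots> = (\<Sum>j<n. if j = 0 then of_nat n *\<^sub>C 1 else 0)"
    by (intro sum.cong) (simp_all add: sum_powers_root_of_unity)
  also have "\<dots> = real n *\<^sub>R 1"
    using assms(1) by (simp add: scaleC_of_real[symmetric])
  finally show ?thesis using assms(1) by simp
qed

text \<open>The resolvent identity \<open>U w - U v = (w - v) *\<^sub>C (U w * b * U v)\<close>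
  gives continuity once \<open>U w\<close> is bounded near v. That bound comes from the identity
  itself, by absorbing half of \<open>norm (U w)\<close> when |w - v| M < 1/2.\<close>

lemma continuous_on_inverse_family:
  fixes b :: "'a::complex_banach cop"
  assumes "\<And>w. w \<in> K \<Longrightarrow> is_inverse (1 - w *\<^sub>C b) (U w)"
  shows "continuous_on K U"
  unfolding continuous_on_def
proof
  fix v assume v: "v \<in> K"
  define M where "M = norm b * norm (U v)"
  have diff: "U w - U v = (w - v) *\<^sub>C (U w * b * U v)" if "w \<in> K" for w
  proof -
    have "U w - U v = U w * ((1 - v *\<^sub>C b) * U v) - (U w * (1 - w *\<^sub>C b)) * U v"
      using assms[OF v] assms[OF that] by (simp add: is_inverse_def)
    then show ?thesis by (simp add: algebra_simps scaleC_diff_left)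
  qed
  have le: "norm (U w - U v) \<le> cmod (w - v) * norm (U w) * M" if "w \<in> K" for w
  proof -
    have "norm (U w * b * U v) \<le> norm (U w) * norm b * norm (U v)"
      by (meson mult_right_mono norm_ge_zero norm_mult_ineq order_trans)
    then show ?thesis
      by (simp add: diff[OF that] norm_scaleC M_def mult.assoc mult_left_mono)
  qed
  have M0: "0 \<le> M" by (simp add: M_def)
  show "(U \<longlongrightarrow> U v) (at v within K)"
  proof (rule LIM_zero_cancel, rule Lim_null_comparison)
    have "((\<lambda>w. cmod (w - v) * M) \<longlongrightarrow> 0) (at v within K)"
      by (auto intro!: tendsto_eq_intros)
    then have "\<forall>\<^sub>F w in at v within K. cmod (w - v) * M < 1 / 2"
      by (rule order_tendstoD) simp
    then show "\<forall>\<^sub>F w in at v within K. norm (U w - U v) \<le> cmod (w - v) * (2 * norm (U v)) * M"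
      unfolding eventually_at_filter
    proof (rule eventually_mono, intro impI)
      fix w assume w: "w \<noteq> v \<longrightarrow> w \<in> K \<longrightarrow> cmod (w - v) * M < 1 / 2" "w \<noteq> v" "w \<in> K"
      have "norm (U w) \<le> norm (U v) + norm (U w - U v)"
        by (metis add.commute diff_add_cancel norm_triangle_ineq)
      also have "norm (U w - U v) \<le> norm (U w) * (cmod (w - v) * M)"
        using le[OF w(3)] by (simp add: mult.assoc mult.left_commute)
      also have "\<dots> \<le> norm (U w) * (1 / 2)"
        using w by (intro mult_left_mono) auto
      finally have "norm (U w) \<le> 2 * norm (U v)" by simp
      then have "cmod (w - v) * norm (U w) * M \<le> cmod (w - v) * (2 * norm (U v)) * M"
        by (intro mult_right_mono mult_left_mono M0) auto
      with le[OF w(3)] show "norm (U w - U v) \<le> cmod (w - v) * (2 * norm (U v)) * M"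
        by linarith
    qed
    show "((\<lambda>w. cmod (w - v) * (2 * norm (U v)) * M) \<longlongrightarrow> 0) (at v within K)"
      by (auto intro!: tendsto_eq_intros)
  qed
qed

text \<open>Rickart's argument: by \<open>resolvent_mean\<close> the inverse of \<open>1 - (w b)\<^sup>n\<close> is an average of inverses
  \<open>U (\<omega>\<^sup>k w)\<close>, so it varies with \<open>w\<close> uniformly in \<open>n\<close>.  Hence smallness of the powers of \<open>w b\<close>
  propagates from \<open>w = 0\<close> to the whole disk in finitely many steps of fixed length.\<close>

lemma power_tendsto_zero_of_invertible:
  fixes b :: "'a::complex_banach cop"
  assumes s: "0 \<le> s" and inv: "\<And>w. cmod w \<le> s \<Longrightarrow> \<exists>u. is_inverse (1 - w *\<^sub>C b) u"
  shows "(\<lambda>n. (s *\<^sub>R b) ^ n) \<longlonglongrightarrow> 0"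
proof -
  define U where "U w = (SOME u. is_inverse (1 - w *\<^sub>C b) u)" for w
  have U: "is_inverse (1 - w *\<^sub>C b) (U w)" if "cmod w \<le> s" for w
    unfolding U_def using inv[OF that] by (rule someI_ex)
  have "uniformly_continuous_on (cball 0 s) U"
    by (intro compact_uniformly_continuous continuous_on_inverse_family[of _ b]) (auto intro: U)
  \<comment> \<open>The step length \<open>d\<close> does not depend on n, since a root of unity
    multiplies both arguments by the same number of modulus one. The tolerance 1/6 enters below as
    1/6 + 1/6 = 1/3.\<close>
  then obtain d where d: "d > 0"
    "\<And>w w'. w \<in> cball 0 s \<Longrightarrow> w' \<in> cball 0 s \<Longrightarrow> dist w' w < d \<Longrightarrow> dist (U w') (U w) < 1 / 6"
    unfolding uniformly_continuous_on_def by (metis zero_less_divide_1_iff zero_less_numeral)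
  define f where "f n t = (1 / n) *\<^sub>R (\<Sum>k<n. U (cis (2 * pi / n) ^ k * complex_of_real t))" for n :: nat and t
  have f: "(1 - (t *\<^sub>R b) ^ n) * f n t = 1" if "n \<ge> 1" "0 \<le> t" "t \<le> s" for n t
    unfolding f_def
  proof (rule resolvent_mean[OF that(1)])
    fix k
    have "cmod (cis (2 * pi / n) ^ k * complex_of_real t) \<le> s"
      using that by (simp add: norm_mult norm_power)
    from U[OF this]
    show "is_inverse (1 - cis (2 * pi / n) ^ k *\<^sub>C t *\<^sub>R b) (U (cis (2 * pi / n) ^ k * complex_of_real t))"
      by (simp add: scaleC_of_real[symmetric] scaleC_scaleC)
  qed
  have f_diff: "norm (f n t' - f n t) \<le> 1 / 6"
    if "n \<ge> 1" "0 \<le> t" "t \<le> s" "0 \<le> t'" "t' \<le> s" "\<bar>t' - t\<bar> < d" for n t t'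
  proof -
    have "norm (\<Sum>k<n. U (cis (2 * pi / n) ^ k * complex_of_real t') - U (cis (2 * pi / n) ^ k * complex_of_real t))
        \<le> (\<Sum>k<n. 1 / 6)"
    proof (rule sum_norm_le)
      fix k
      let ?w = "cis (2 * pi / n) ^ k"
      have "dist (?w * complex_of_real t') (?w * complex_of_real t) = \<bar>t' - t\<bar>"
        by (simp add: dist_norm right_diff_distrib[symmetric] norm_mult norm_power
            of_real_diff[symmetric] del: of_real_diff)
      then have "dist (U (?w * complex_of_real t')) (U (?w * complex_of_real t)) < 1 / 6"
        using that by (intro d(2)) (auto simp: norm_mult norm_power)
      then show "norm (U (?w * complex_of_real t') - U (?w * complex_of_real t)) \<le> 1 / 6"
        by (simp add: dist_norm)
    qed
    then have "(1 / n) * norm (\<Sum>k<n. U (cis (2 * pi / n) ^ k * complex_of_real t')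
        - U (cis (2 * pi / n) ^ k * complex_of_real t)) \<le> (1 / n) * (n / 6)"
      by (intro mult_left_mono) auto
    moreover have "f n t' - f n t = (1 / n) *\<^sub>R (\<Sum>k<n. U (cis (2 * pi / n) ^ k * complex_of_real t')
        - U (cis (2 * pi / n) ^ k * complex_of_real t))"
      by (simp add: f_def sum_subtractf scaleR_right_diff_distrib)
    ultimately show ?thesis using that(1) by simp
  qed
  have step: "(\<lambda>n. (t' *\<^sub>R b) ^ n) \<longlonglongrightarrow> 0"
    if "(\<lambda>n. (t *\<^sub>R b) ^ n) \<longlonglongrightarrow> 0" "0 \<le> t" "t \<le> s" "0 \<le> t'" "t' \<le> s" "\<bar>t' - t\<bar> < d" for t t'
  proof -
    have "(\<lambda>n. norm ((t *\<^sub>R b) ^ n)) \<longlonglongrightarrow> 0"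
      using that(1) by (simp add: tendsto_norm_zero)
    then have "\<forall>\<^sub>F n in sequentially. norm ((t *\<^sub>R b) ^ n) < 1 / 10"
      by (rule order_tendstoD) simp
    then obtain N where N: "\<And>n. n \<ge> N \<Longrightarrow> norm ((t *\<^sub>R b) ^ n) < 1 / 10"
      by (auto simp: eventually_sequentially)
    define n where "n = Suc N"
    \<comment> \<open>\<open>g\<close> is y (1 - y)^(-1); subtracting 1 keeps the uncontrolled norm
      of \<open>1\<close> out. With y below 1/10, g is at most 1/9 and so below 1/6, g' is at most
      1/3, and y' = g' - y' g' is at most 1/2.\<close>
    define y y' g g' where "y = (t *\<^sub>R b) ^ n" "y' = (t' *\<^sub>R b) ^ n" "g = f n t - 1" "g' = f n t' - 1"
    note defs = this
    have y: "norm y < 1 / 10" using N[of n] by (simp add: defs n_def)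
    have "(1 - y) * (g + 1) = 1" "(1 - y') * (g' + 1) = 1"
      unfolding defs using f that by (simp_all add: n_def del: power_Suc)
    then have g: "g = y * g + y" and g': "y' = g' - y' * g'"
      by (simp_all add: algebra_simps)
    have "norm g \<le> norm y * norm g + norm y"
      by (subst g) (meson add_right_mono norm_mult_ineq norm_triangle_ineq order_trans)
    also have "norm y * norm g \<le> 1 / 10 * norm g"
      using y by (intro mult_right_mono) auto
    finally have "norm g \<le> 1 / 6" using y by simp
    moreover have "norm (g' - g) \<le> 1 / 6"
      using f_diff[of n t t'] that by (simp add: defs n_def)
    ultimately have "norm g' \<le> 1 / 3"
      using norm_triangle_ineq[of "g' - g" g] by simp
    have "norm y' \<le> norm g' + norm y' * norm g'"
      by (subst g') (meson add_left_mono norm_mult_ineq norm_triangle_ineq4 order_trans)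
    also have "norm y' * norm g' \<le> norm y' * (1 / 3)"
      using \<open>norm g' \<le> 1 / 3\<close> by (intro mult_left_mono) auto
    finally have "norm y' < 1" using \<open>norm g' \<le> 1 / 3\<close> by simp
    then show ?thesis
      by (intro power_tendsto_zero[of n]) (simp_all add: defs n_def del: power_Suc)
  qed
  \<comment> \<open>Steps of half the admissible length, cut off at \<open>s\<close>, reach
    \<open>s\<close> after finitely many.\<close>
  have "(\<lambda>n. (min s (real k * (d / 2)) *\<^sub>R b) ^ n) \<longlonglongrightarrow> 0" for k
  proof (induction k)
    case 0
    show ?case using s by (intro power_tendsto_zero[of 1]) simp_all
  next
    case (Suc k)
    have "\<bar>min s (real (Suc k) * (d / 2)) - min s (real k * (d / 2))\<bar> < d"
      using d(1) by (auto simp: min_def algebra_simps)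
    with Suc show ?case
      using s d(1) by (intro step[OF Suc]) auto
  qed
  moreover obtain k where "s / (d / 2) \<le> real k" using real_arch_simple by blast
  then have "min s (real k * (d / 2)) = s" using d(1) by (simp add: field_simps)
  ultimately show ?thesis by metis
qed

text \<open>The coordinate w = 1/z: \<open>w = 0\<close> stands for z at infinity, where nothing has
  to be assumed.\<close>

lemma invertible_one_minus:
  fixes a :: "'a::complex_banach cop"
  assumes "w = 0 \<or> (\<exists>u. is_inverse (inverse w *\<^sub>C 1 - a) u)"
  shows "\<exists>u. is_inverse (1 - w *\<^sub>C a) u"
proof (cases "w = 0")
  case True
  then show ?thesis by (auto simp: is_inverse_def)
next
  case False
  with assms obtain u where "is_inverse (inverse w *\<^sub>C 1 - a) u" by blast
  from is_inverse_scaleC[OF this False] False show ?thesis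
    by (auto simp: scaleC_diff_right scaleC_scaleC scaleC_one)
qed

lemma invertible_of_small_perturbation:
  fixes a :: "'a::complex_banach cop"
  assumes "is_inverse a u" "cmod h * norm u < 1"
  shows "\<exists>v. is_inverse (a + h *\<^sub>C 1) v"
proof -
  have "norm (- (h *\<^sub>C u)) < 1" using assms(2) by (simp add: norm_scaleC)
  then obtain v where "is_inverse (1 - - (h *\<^sub>C u)) v" using neumann_series by blast
  from is_inverse_mult[OF assms(1) this] have "is_inverse (a * (1 - - (h *\<^sub>C u))) (v * u)" .
  moreover have "a * (1 - - (h *\<^sub>C u)) = a + h *\<^sub>C 1"
    using assms(1) by (simp add: is_inverse_def algebra_simps)
  ultimately show ?thesis by metis
qed

section \<open>Compactness and nonemptiness of the spectrum, spectral radius\<close>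

lemma spectrum_norm_le:
  assumes "z \<in> spectrum (cop_apply a)"
  shows "cmod z \<le> norm a"
proof (rule ccontr)
  assume "\<not> cmod z \<le> norm a"
  then have z: "norm a < cmod z" by simp
  then have "z \<noteq> 0" by (metis norm_ge_zero norm_zero not_less)
  with z have "norm (inverse z *\<^sub>C a) < 1"
    by (simp add: norm_scaleC norm_inverse field_simps norm_divide)
  then obtain u where "is_inverse (1 - inverse z *\<^sub>C a) u" using neumann_series by blast
  from is_inverse_scaleC[OF this \<open>z \<noteq> 0\<close>] \<open>z \<noteq> 0\<close> have "is_inverse (z *\<^sub>C 1 - a) (inverse z *\<^sub>C u)"
    by (simp add: scaleC_diff_right scaleC_scaleC scaleC_one)
  with assms show False using not_in_spectrum_cop by blast
qed

lemma closed_spectrum: "closed (spectrum (cop_apply a))"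
proof -
  have "open (- spectrum (cop_apply a))"
    unfolding open_dist
  proof
    fix z assume "z \<in> - spectrum (cop_apply a)"
    then obtain u where u: "is_inverse (z *\<^sub>C 1 - a) u" by (auto simp: not_in_spectrum_cop)
    have "y \<notin> spectrum (cop_apply a)" if "dist y z < inverse (norm u + 1)" for y
    proof -
      have "cmod (y - z) * (norm u + 1) < 1"
        using that by (simp add: dist_norm field_simps add_pos_nonneg)
      moreover have "cmod (y - z) * norm u \<le> cmod (y - z) * (norm u + 1)"
        by (intro mult_left_mono) auto
      ultimately have "\<exists>v. is_inverse (z *\<^sub>C 1 - a + (y - z) *\<^sub>C 1) v"
        by (intro invertible_of_small_perturbation[OF u]) linarith
      then show ?thesis by (simp add: not_in_spectrum_cop scaleC_diff_left)
    qed
    then show "\<exists>e>0. \<forall>y. dist y z < e \<longrightarrow> y \<in> - spectrum (cop_apply a)"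
      by (intro exI[of _ "inverse (norm u + 1)"]) (auto simp: add_nonneg_pos)
  qed
  then show ?thesis by (simp add: closed_def)
qed

lemma compact_spectrum: "compact (spectrum (cop_apply a))"
  unfolding compact_eq_bounded_closed
  by (auto intro: closed_spectrum boundedI spectrum_norm_le)

text \<open>Decay of powers replaces Liouville's theorem: with empty spectrum every multiple of
  \<open>a\<close> has powers tending to zero, in particular the multiple by the norm of the inverse
  \<open>u\<close> of \<open>- a\<close>. But \<open>u ^ n * a ^ n\<close> is plus or minus the
  identity, so the powers of that multiple keep norm at least 1.\<close>

lemma spectrum_nonempty:
  fixes a :: "'a::complex_banach cop" and x :: 'a
  assumes "x \<noteq> 0"
  shows "spectrum (cop_apply a) \<noteq> {}"
proof
  assume empty: "spectrum (cop_apply a) = {}"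
  then have inv: "\<exists>u. is_inverse (z *\<^sub>C 1 - a) u" for z by (metis empty_iff not_in_spectrum_cop)
  then obtain u where "is_inverse (0 *\<^sub>C 1 - a) u" by blast
  then have "u * - a = 1" by (simp add: is_inverse_def)
  then have u: "u * a = - 1" by (metis minus_minus mult_minus_right)
  have pow: "u ^ n * a ^ n = (- 1) ^ n" for n
  proof (induction n)
    case (Suc n)
    have "u ^ Suc n * a ^ Suc n = u ^ n * (u * a) * a ^ n"
      by (simp only: power_Suc2[of u] power_Suc[of a] mult.assoc)
    with Suc u show ?case by simp
  qed simp
  have "(\<lambda>n. (norm u *\<^sub>R a) ^ n) \<longlonglongrightarrow> 0"
    by (intro power_tendsto_zero_of_invertible invertible_one_minus) (auto intro: inv)
  then have "(\<lambda>n. norm ((norm u *\<^sub>R a) ^ n)) \<longlonglongrightarrow> 0" by (simp add: tendsto_norm_zero)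
  then have "\<forall>\<^sub>F n in sequentially. norm ((norm u *\<^sub>R a) ^ n) < 1"
    by (rule order_tendstoD) simp
  then obtain N where N: "norm ((norm u *\<^sub>R a) ^ Suc N) < 1"
    unfolding eventually_sequentially by (meson le_SucI order_refl)
  have sgn: "norm (((- 1) ^ n :: 'a cop) \<cdot> x) = norm x" for n
    by (induction n) auto
  have "norm x = norm (u ^ Suc N \<cdot> a ^ Suc N \<cdot> x)"
    unfolding cop_apply_simps(6)[symmetric] pow sgn ..
  also have "\<dots> \<le> norm (u ^ Suc N) * (norm (a ^ Suc N) * norm x)"
    by (meson mult_left_mono norm_cop_apply norm_ge_zero order_trans)
  also have "\<dots> \<le> norm u ^ Suc N * (norm (a ^ Suc N) * norm x)"
    by (intro mult_right_mono norm_power_Suc_le) simp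
  also have "\<dots> = norm ((norm u *\<^sub>R a) ^ Suc N) * norm x"
    by (simp only: scaleC_of_real[symmetric] scaleC_power norm_scaleC norm_power norm_of_real
        abs_norm_cancel mult.assoc)
  also have "\<dots> < 1 * norm x"
    using N assms by (intro mult_strict_right_mono) auto
  finally show False by simp
qed

lemma spectral_radius_ge: "z \<in> spectrum (cop_apply a) \<Longrightarrow> cmod z \<le> spectral_radius (cop_apply a)"
  unfolding spectral_radius_def
  by (rule cSUP_upper) (auto intro!: bdd_aboveI2 spectrum_norm_le)

lemma spectral_radius_attained:
  assumes "spectrum (cop_apply a) \<noteq> {}"
  shows "\<exists>z\<in>spectrum (cop_apply a). cmod z = spectral_radius (cop_apply a)"
proof -
  have "compact (cmod ` spectrum (cop_apply a))"
    by (intro compact_continuous_image continuous_intros compact_spectrum)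
  then have "Sup (cmod ` spectrum (cop_apply a)) \<in> cmod ` spectrum (cop_apply a)"
    using assms by (intro closed_contains_Sup)
      (auto intro: compact_imp_closed bounded_imp_bdd_above compact_imp_bounded)
  then show ?thesis by (auto simp: spectral_radius_def)
qed

lemma scaled_power_tendsto_zero:
  fixes a :: "'a::complex_banach cop"
  assumes "0 < r" "\<And>z. r \<le> cmod z \<Longrightarrow> \<exists>u. is_inverse (z *\<^sub>C 1 - a) u"
  shows "(\<lambda>n. inverse r ^ n *\<^sub>R a ^ n) \<longlonglongrightarrow> 0"
proof -
  have "(\<lambda>n. (inverse r *\<^sub>R a) ^ n) \<longlonglongrightarrow> 0"
  proof (intro power_tendsto_zero_of_invertible invertible_one_minus)
    fix w assume "cmod w \<le> inverse r"
    then have "w \<noteq> 0 \<Longrightarrow> r \<le> cmod (inverse w)"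
      using assms(1) by (simp add: norm_inverse field_simps norm_divide)
    then show "w = 0 \<or> (\<exists>u. is_inverse (inverse w *\<^sub>C 1 - a) u)"
      using assms(2) by blast
  qed (use assms in simp)
  then show ?thesis
    by (simp only: scaleC_of_real[symmetric] scaleC_power of_real_power)
qed

section \<open>Operators that are proper on bounded sets\<close>

text \<open>For bounded operators this amounts to closed range together with finite-dimensional
  kernel. The sequential form is the common consequence of the two alternative hypotheses, and the
  form in which limits are extracted later.\<close>

definition proper_on_bounded :: "'a::complex_banach cop \<Rightarrow> bool" where
  "proper_on_bounded t \<longleftrightarrow> (\<forall>x y. bounded (range x) \<and> (\<lambda>n. t \<cdot> x n) \<longlonglongrightarrow> y \<longrightarrow>
     (\<exists>s z. strict_mono (s :: nat \<Rightarrow> nat) \<and> (\<lambda>n. x (s n)) \<longlonglongrightarrow> z))"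

lemma proper_on_boundedD:
  assumes "proper_on_bounded t" "bounded (range x)" "(\<lambda>n. t \<cdot> x n) \<longlonglongrightarrow> y"
  obtains s z where "strict_mono (s :: nat \<Rightarrow> nat)" "(\<lambda>n. x (s n)) \<longlonglongrightarrow> z" "t \<cdot> z = y"
proof -
  from assms obtain s :: "nat \<Rightarrow> nat" and z where s: "strict_mono s" "(\<lambda>n. x (s n)) \<longlonglongrightarrow> z"
    unfolding proper_on_bounded_def by blast
  have "(\<lambda>n. t \<cdot> x (s n)) \<longlonglongrightarrow> y"
    using LIMSEQ_subseq_LIMSEQ[OF assms(3) s(1)] by (simp add: o_def)
  moreover have "(\<lambda>n. t \<cdot> x (s n)) \<longlonglongrightarrow> t \<cdot> z" by (intro tendsto_intros s)
  ultimately have "t \<cdot> z = y" by (blast intro: LIMSEQ_unique)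
  with s that show ?thesis by blast
qed

text \<open>Solve for x: it is z^(-1) times the sum of (z - a) x, which converges by assumption, and
  a x, which converges along a subsequence.\<close>

lemma compact_op_imp_proper_on_bounded:
  assumes "compact_op (cop_apply a)" "z \<noteq> 0"
  shows "proper_on_bounded (z *\<^sub>C 1 - a)"
  unfolding proper_on_bounded_def
proof (intro allI impI, elim conjE)
  fix x y assume x: "bounded (range x)" and y: "(\<lambda>n. (z *\<^sub>C 1 - a) \<cdot> x n) \<longlonglongrightarrow> y"
  have "compact (closure (cop_apply a ` range x))"
    using assms(1) x by (simp add: compact_op_def)
  then have "seq_compact (closure (cop_apply a ` range x))"
    by (rule compact_imp_seq_compact)
  moreover have "a \<cdot> x n \<in> closure (cop_apply a ` range x)" for n
    by (meson closure_subset imageI rangeI subsetD)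
  ultimately obtain v s where s: "strict_mono (s :: nat \<Rightarrow> nat)" "((\<lambda>n. a \<cdot> x n) \<circ> s) \<longlonglongrightarrow> v"
    using seq_compactE[of _ "\<lambda>n. a \<cdot> x n"] by metis
  have "(\<lambda>n. (z *\<^sub>C 1 - a) \<cdot> x (s n)) \<longlonglongrightarrow> y"
    using LIMSEQ_subseq_LIMSEQ[OF y s(1)] by (simp add: o_def)
  then have "(\<lambda>n. inverse z *\<^sub>C ((z *\<^sub>C 1 - a) \<cdot> x (s n) + a \<cdot> x (s n))) \<longlonglongrightarrow> inverse z *\<^sub>C (y + v)"
    using s(2) by (intro tendsto_intros) (simp_all add: o_def)
  moreover have "inverse z *\<^sub>C ((z *\<^sub>C 1 - a) \<cdot> x (s n) + a \<cdot> x (s n)) = x (s n)" for n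
    using assms(2) by (simp add: scaleC_scaleC scaleC_one)
  ultimately show "\<exists>s z. strict_mono s \<and> (\<lambda>n. x (s n)) \<longlonglongrightarrow> z"
    using s(1) by auto
qed

section \<open>The Fredholm case: finite-dimensional kernels and the open mapping theorem\<close>

lemma closed_of_bounded_subsequences:
  fixes S :: "'b::metric_space set"
  assumes "\<And>x. range x \<subseteq> S \<Longrightarrow> bounded (range x) \<Longrightarrow>
      \<exists>s z. strict_mono (s :: nat \<Rightarrow> nat) \<and> (\<lambda>n. x (s n)) \<longlonglongrightarrow> z \<and> z \<in> S"
  shows "closed S"
  unfolding closed_sequential_limits
proof (intro allI impI, elim conjE)
  fix x l assume x: "\<forall>n. x n \<in> S" "x \<longlonglongrightarrow> l"
  then have "bounded (range x)" by (blast intro: convergent_imp_bounded)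
  with assms[of x] x(1) obtain s z where s: "strict_mono (s :: nat \<Rightarrow> nat)" "(\<lambda>n. x (s n)) \<longlonglongrightarrow> z" "z \<in> S"
    by blast
  moreover have "(\<lambda>n. x (s n)) \<longlonglongrightarrow> l"
    using LIMSEQ_subseq_LIMSEQ[OF x(2) s(1)] by (simp add: o_def)
  ultimately show "l \<in> S" by (metis LIMSEQ_unique)
qed

text \<open>Induction on the spanning set. By the induction hypothesis the old span is closed, so a
  vector \<open>b\<close> outside it has positive distance d from it; this bounds the coefficients
  of \<open>b\<close>, and Bolzano-Weierstrass in the complex plane applies to them. Keeping the
  limit in the span is what makes the hypothesis yield closedness.\<close>

lemma bounded_sequence_in_finite_span:
  fixes x :: "nat \<Rightarrow> 'a::complex_banach"
  assumes "finite B" "range x \<subseteq> complex_vector.span B" "bounded (range x)"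
  shows "\<exists>s z. strict_mono (s :: nat \<Rightarrow> nat) \<and> (\<lambda>n. x (s n)) \<longlonglongrightarrow> z \<and> z \<in> complex_vector.span B"
  using assms
proof (induction B arbitrary: x rule: finite_induct)
  case empty
  then have "x = (\<lambda>n. 0)" by (auto simp: fun_eq_iff)
  then show ?case using strict_mono_id by (auto simp: id_def intro!: exI[of _ "\<lambda>n. n"])
next
  case (insert b B)
  show ?case
  proof (cases "b \<in> complex_vector.span B")
    case True
    with insert show ?thesis by (simp add: complex_vector.span_redundant)
  next
    case False
    have "closed (complex_vector.span B)"
      by (rule closed_of_bounded_subsequences) (rule insert.IH)
    with False obtain d where d: "d > 0" "ball b d \<subseteq> - complex_vector.span B"
      by (metis ComplI open_Compl open_contains_ball)
    have dist: "d \<le> norm (b + v)" if "v \<in> complex_vector.span B" for v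
    proof -
      have "- v \<notin> ball b d"
        using d(2) that complex_vector.span_neg[OF that] by blast
      then show ?thesis by (simp add: dist_norm)
    qed
    have "x n \<in> complex_vector.span (insert b B)" for n
      using insert.prems(1) by blast
    then have "\<forall>n. \<exists>k. x n - k *\<^sub>C b \<in> complex_vector.span B"
      by (simp add: complex_vector.span_breakdown_eq)
    then obtain k where k: "\<And>n. x n - k n *\<^sub>C b \<in> complex_vector.span B" by metis
    have kd: "cmod (k n) * d \<le> norm (x n)" for n
    proof (cases "k n = 0")
      case False
      have "inverse (k n) *\<^sub>C (x n - k n *\<^sub>C b) \<in> complex_vector.span B"
        by (rule complex_vector.span_scale[OF k])
      from dist[OF this] have "d \<le> norm (inverse (k n) *\<^sub>C x n)"
        using False by (simp add: scaleC_diff_right scaleC_scaleC scaleC_one)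
      then show ?thesis using False by (simp add: norm_scaleC norm_inverse norm_divide field_simps)
    qed simp
    obtain N where N: "\<And>n. norm (x n) \<le> N" using insert.prems(2) by (auto simp: bounded_iff)
    have kN: "cmod (k n) \<le> N / d" for n
      using kd[of n] N[of n] d(1) by (simp add: field_simps)
    then have "bounded (range k)" by (auto intro: boundedI)
    then obtain c s where s: "strict_mono (s :: nat \<Rightarrow> nat)" "(k \<circ> s) \<longlonglongrightarrow> c"
      using bounded_imp_convergent_subsequence by metis
    define y where "y n = x (s n) - k (s n) *\<^sub>C b" for n
    have "norm (y n) \<le> N + N / d * norm b" for n
      using norm_triangle_ineq4[of "x (s n)" "k (s n) *\<^sub>C b"] N[of "s n"]
        mult_right_mono[OF kN[of "s n"] norm_ge_zero[of b]]
      unfolding y_def norm_scaleC by linarith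
    then have "bounded (range y)" by (auto intro: boundedI)
    moreover have "range y \<subseteq> complex_vector.span B" using k by (auto simp: y_def)
    ultimately obtain s' z where s': "strict_mono (s' :: nat \<Rightarrow> nat)" "(\<lambda>n. y (s' n)) \<longlonglongrightarrow> z"
      "z \<in> complex_vector.span B"
      using insert.IH[of y] by blast
    have "(\<lambda>n. y (s' n) + k (s (s' n)) *\<^sub>C b) \<longlonglongrightarrow> z + c *\<^sub>C b"
      using LIMSEQ_subseq_LIMSEQ[OF s(2) s'(1)] by (intro tendsto_intros s') (simp add: o_def)
    moreover have "z + c *\<^sub>C b \<in> complex_vector.span (insert b B)"
      using s'(3) by (auto simp: complex_vector.span_breakdown_eq intro!: exI[of _ c])
    ultimately show ?thesis
      using strict_mono_o[OF s(1) s'(1)]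
      by (intro exI[of _ "\<lambda>n. s (s' n)"] exI[of _ "z + c *\<^sub>C b"]) (simp add: y_def o_def)
  qed
qed

text \<open>The Baire half of the open mapping theorem, with the closed range as the complete space:
  some closure \<open>G n\<close> of the image of a ball has an interior point relative to the
  range, and differences of approximants move that point to the origin.\<close>

lemma almost_open_onto_closed_range:
  fixes t :: "'a::complex_banach cop"
  assumes closed: "closed (range (cop_apply t))"
  obtains K where "0 \<le> K"
    "\<And>y. y \<in> range (cop_apply t) \<Longrightarrow> \<exists>x. norm x \<le> K * norm y \<and> norm (y - t \<cdot> x) \<le> norm y / 2"
proof -
  define Y where "Y = range (cop_apply t)"
  define G where "G n = closure (cop_apply t ` cball 0 (real n))" for n
  have Y_diff: "y - y' \<in> Y" "y + y' \<in> Y" "c *\<^sub>R y \<in> Y" if "y \<in> Y" "y' \<in> Y" for y y' c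
    using that unfolding Y_def
    by (auto simp: cop_apply_simps(9,10,14)[symmetric] simp del: cop_apply_simps)
  have GY: "G n \<subseteq> Y" for n
    unfolding G_def by (rule closure_minimal) (use closed in \<open>auto simp: Y_def\<close>)
  have "Y \<subseteq> \<Union>(range G)"
  proof
    fix y assume "y \<in> Y"
    then obtain x where "y = t \<cdot> x" by (auto simp: Y_def)
    moreover obtain n where "norm x \<le> real n" using real_arch_simple by blast
    ultimately have "y \<in> G n" unfolding G_def by (intro subsetD[OF closure_subset]) auto
    then show "y \<in> \<Union>(range G)" by blast
  qed
  with GY have UG: "\<Union>(range G) = Y" by blast
  have "\<exists>n. top_of_set Y interior_of G n \<noteq> {}"
  proof (rule ccontr)
    assume "\<not> ?thesis"
    moreover have "closedin (top_of_set Y) (G n)" for n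
      using GY by (intro closed_subset) (auto simp: G_def)
    moreover have "completely_metrizable_space (top_of_set Y)"
      using closed completely_metrizable_space_closedin[OF completely_metrizable_space_euclidean]
      by (auto simp: Y_def)
    ultimately have "top_of_set Y interior_of \<Union>(range G) = {}"
      by (intro Baire_category_alt) auto
    moreover have "top_of_set Y interior_of Y = Y"
      using interior_of_topspace[of "top_of_set Y"] by simp
    ultimately have "Y = {}" by (simp add: UG)
    then show False by (auto simp: Y_def)
  qed
  then obtain n y0 where "y0 \<in> top_of_set Y interior_of G n" by blast
  moreover have "openin (top_of_set Y) (top_of_set Y interior_of G n)" by (rule openin_interior_of)
  ultimately obtain e where e: "e > 0" "ball y0 e \<inter> Y \<subseteq> top_of_set Y interior_of G n" and y0: "y0 \<in> Y"
    by (meson openin_contains_ball subsetD)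
  then have ball: "ball y0 e \<inter> Y \<subseteq> G n" using interior_of_subset[of "top_of_set Y" "G n"] by blast
  have approx: "\<exists>x. norm x \<le> 2 * real n \<and> norm (y - t \<cdot> x) < d"
    if y: "y \<in> Y" "norm y < e" and d: "d > 0" for y d
  proof -
    have "y0 \<in> G n" "y0 + y \<in> G n"
      using ball y y0 e(1) Y_diff by (auto simp: dist_norm intro!: subsetD[OF ball])
    moreover have "\<exists>x. norm x \<le> n \<and> dist (t \<cdot> x) v < d / 2" if "v \<in> G n" for v
    proof -
      from that obtain w where "w \<in> cop_apply t ` cball 0 (real n)" "dist w v < d / 2"
        unfolding G_def closure_approachable using half_gt_zero[OF d] by blast
      then show ?thesis by auto
    qed
    ultimately obtain x1 x2 where x: "norm x1 \<le> n" "dist (t \<cdot> x1) y0 < d / 2"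
      "norm x2 \<le> n" "dist (t \<cdot> x2) (y0 + y) < d / 2"
      by metis
    have "norm (x2 - x1) \<le> 2 * real n"
      using norm_triangle_ineq4[of x2 x1] x by linarith
    moreover have "norm ((t \<cdot> x1 - y0) - (t \<cdot> x2 - (y0 + y))) < d"
      using norm_triangle_ineq4[of "t \<cdot> x1 - y0" "t \<cdot> x2 - (y0 + y)"] x(2,4)
      by (simp add: dist_norm)
    ultimately show ?thesis by (intro exI[of _ "x2 - x1"]) (simp add: algebra_simps)
  qed
  show ?thesis
  proof (rule that[of "4 * real n / e"])
    fix y assume y: "y \<in> range (cop_apply t)"
    show "\<exists>x. norm x \<le> 4 * real n / e * norm y \<and> norm (y - t \<cdot> x) \<le> norm y / 2"
    proof (cases "y = 0")
      case False
      \<comment> \<open>Rescaling to norm e/2 lands inside the ball; the tolerance e/4 is half of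
        that norm, and undoing the scaling turns the bound 2 n into 4 n / e times
        \<open>norm y\<close>.\<close>
      define c where "c = e / (2 * norm y)"
      have c: "c > 0" "c * norm y = e / 2" using False e(1) by (simp_all add: c_def)
      then have "norm (c *\<^sub>R y) < e" using e(1) by simp
      moreover have "c *\<^sub>R y \<in> Y" using y Y_diff(3) unfolding Y_def by blast
      ultimately obtain x where x: "norm x \<le> 2 * real n" "norm (c *\<^sub>R y - t \<cdot> x) < e / 4"
        using approx[of "c *\<^sub>R y" "e / 4"] e(1) by auto
      have "c *\<^sub>R (y - t \<cdot> inverse c *\<^sub>R x) = c *\<^sub>R y - t \<cdot> x"
        using c(1) by (simp add: scaleR_right_diff_distrib)
      then have "c * norm (y - t \<cdot> inverse c *\<^sub>R x) = norm (c *\<^sub>R y - t \<cdot> x)"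
        using c(1) by (metis abs_of_pos norm_scaleR)
      then have "c * norm (y - t \<cdot> inverse c *\<^sub>R x) \<le> c * (norm y / 2)"
        using x(2) c(2) by simp
      then have "norm (y - t \<cdot> inverse c *\<^sub>R x) \<le> norm y / 2" using c(1) by simp
      moreover have "norm (inverse c *\<^sub>R x) \<le> 4 * real n / e * norm y"
      proof -
        have "norm (inverse c *\<^sub>R x) \<le> inverse c * (2 * real n)"
          using c(1) x(1) by (simp add: mult_left_mono)
        then show ?thesis using False e(1) by (simp add: c_def field_simps)
      qed
      ultimately show ?thesis by blast
    qed (auto intro: exI[of _ 0])
  qed (use e(1) in simp)
qed

text \<open>The second half of the open mapping argument: each residual \<open>r n\<close> is solved
  approximately, which at least halves it, and the corrections are summed. The geometric series
  accounts for the factor 2 in the bound \<open>2 * K\<close>.\<close>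

lemma bounded_preimages_of_closed_range:
  fixes t :: "'a::complex_banach cop"
  assumes "closed (range (cop_apply t))"
  obtains M where "\<And>y. y \<in> range (cop_apply t) \<Longrightarrow> \<exists>x. t \<cdot> x = y \<and> norm x \<le> M * norm y"
proof -
  obtain K g where K: "0 \<le> K"
    and g: "\<And>y. y \<in> range (cop_apply t) \<Longrightarrow> norm (g y) \<le> K * norm y \<and> norm (y - t \<cdot> g y) \<le> norm y / 2"
    using almost_open_onto_closed_range[OF assms] by metis
  have "\<exists>x. t \<cdot> x = y \<and> norm x \<le> 2 * K * norm y" if y: "y \<in> range (cop_apply t)" for y
  proof -
    define r where "r n = ((\<lambda>y. y - t \<cdot> g y) ^^ n) y" for n
    have r_Suc: "r (Suc n) = r n - t \<cdot> g (r n)" for n by (simp add: r_def)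
    have r_range: "r n \<in> range (cop_apply t)" for n
    proof (induction n)
      case (Suc n)
      then obtain x where "r n = t \<cdot> x" by blast
      then have "r (Suc n) = t \<cdot> (x - g (r n))" by (simp add: r_Suc)
      then show ?case by blast
    qed (use y in \<open>simp add: r_def\<close>)
    have r_norm: "norm (r n) \<le> (1 / 2) ^ n * norm y" for n
    proof (induction n)
      case (Suc n)
      then show ?case using g[OF r_range[of n]] by (simp add: r_Suc)
    qed (simp add: r_def)
    have g_norm: "norm (g (r n)) \<le> K * norm y * (1 / 2) ^ n" for n
      using g[OF r_range[of n]] mult_left_mono[OF r_norm[of n] K] by (simp add: mult_ac)
    have geo: "(\<lambda>n. K * norm y * (1 / 2) ^ n) sums (K * norm y * 2)"
      using sums_mult[OF geometric_sums[of "1 / 2 :: real"], of "K * norm y"] by simp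
    have summ: "summable (\<lambda>n. norm (g (r n)))"
      by (rule summable_comparison_test[OF _ sums_summable[OF geo]]) (auto intro: g_norm)
    then have sum: "(\<lambda>n. g (r n)) sums (\<Sum>n. g (r n))"
      by (simp add: summable_norm_cancel summable_sums)
    have partial: "t \<cdot> (\<Sum>k<n. g (r k)) = y - r n" for n
    proof (induction n)
      case (Suc n)
      then show ?case by (simp add: r_Suc)
    qed (simp add: r_def)
    have "r \<longlonglongrightarrow> 0"
    proof (rule Lim_null_comparison)
      show "\<forall>\<^sub>F n in sequentially. norm (r n) \<le> (1 / 2) ^ n * norm y" by (simp add: r_norm)
      show "(\<lambda>n. (1 / 2) ^ n * norm y) \<longlonglongrightarrow> 0"
        by (intro tendsto_mult_left_zero LIMSEQ_power_zero) simp
    qed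
    then have "(\<lambda>n. y - r n) \<longlonglongrightarrow> y" using tendsto_diff[OF tendsto_const, of r 0 _ y] by simp
    moreover have "(\<lambda>n. t \<cdot> (\<Sum>k<n. g (r k))) \<longlonglongrightarrow> t \<cdot> (\<Sum>n. g (r n))"
      using sum by (intro tendsto_intros) (simp add: sums_def)
    ultimately have "t \<cdot> (\<Sum>n. g (r n)) = y"
      unfolding partial by (blast intro: LIMSEQ_unique)
    moreover have "norm (\<Sum>n. g (r n)) \<le> 2 * K * norm y"
    proof -
      have "norm (\<Sum>n. g (r n)) \<le> (\<Sum>n. norm (g (r n)))" by (rule summable_norm[OF summ])
      also have "\<dots> \<le> (\<Sum>n. K * norm y * (1 / 2) ^ n)"
        by (rule suminf_le[OF g_norm summ sums_summable[OF geo]])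
      also have "\<dots> = 2 * K * norm y" using sums_unique[OF geo] by simp
      finally show ?thesis .
    qed
    ultimately show ?thesis by blast
  qed
  then show ?thesis using that by blast
qed

text \<open>Preimages \<open>u n\<close> of \<open>t \<cdot> x n - y\<close> with controlled norm
  tend to zero. After subtracting them and a fixed solution x', the sequence lies in the
  finite-dimensional kernel, where bounded sequences have convergent subsequences.\<close>

lemma fredholm_imp_proper_on_bounded:
  assumes "fredholm (cop_apply t)"
  shows "proper_on_bounded t"
  unfolding proper_on_bounded_def
proof (intro allI impI, elim conjE)
  fix x y assume x: "bounded (range x)" and y: "(\<lambda>n. t \<cdot> x n) \<longlonglongrightarrow> y"
  have closed: "closed (range (cop_apply t))" using assms by (simp add: fredholm_def)
  then have "y \<in> range (cop_apply t)"
    by (rule closed_sequentially[OF _ _ y]) simp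
  then obtain x' where x': "y = t \<cdot> x'" by blast
  obtain M where M: "\<And>y. y \<in> range (cop_apply t) \<Longrightarrow> \<exists>x. t \<cdot> x = y \<and> norm x \<le> M * norm y"
    using bounded_preimages_of_closed_range[OF closed] by blast
  have "t \<cdot> x n - y \<in> range (cop_apply t)" for n
    unfolding x' by (metis cop_apply_simps(10) rangeI)
  then have "\<forall>n. \<exists>u. t \<cdot> u = t \<cdot> x n - y \<and> norm u \<le> M * norm (t \<cdot> x n - y)" using M by blast
  then obtain u where u: "\<And>n. t \<cdot> u n = t \<cdot> x n - y" "\<And>n. norm (u n) \<le> M * norm (t \<cdot> x n - y)"
    by metis
  have u0: "u \<longlonglongrightarrow> 0"
  proof (rule Lim_null_comparison)
    show "\<forall>\<^sub>F n in sequentially. norm (u n) \<le> M * norm (t \<cdot> x n - y)" by (simp add: u(2))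
    show "(\<lambda>n. M * norm (t \<cdot> x n - y)) \<longlonglongrightarrow> 0"
      using y by (intro tendsto_mult_right_zero tendsto_norm_zero) (simp add: LIM_zero)
  qed
  define k where "k n = x n - u n - x'" for n
  obtain B where B: "finite B" "{x. t \<cdot> x = 0} \<subseteq> complex_vector.span B"
    using assms by (auto simp: fredholm_def)
  have "range k \<subseteq> complex_vector.span B" using B(2) by (auto simp: k_def u(1) x')
  moreover have "bounded (range k)"
  proof -
    have "bounded (range u)" using u0 by (rule convergent_imp_bounded)
    with x obtain M1 M2 where "\<And>n. norm (x n) \<le> M1" "\<And>n. norm (u n) \<le> M2"
      by (auto simp: bounded_iff)
    then have "norm (k n) \<le> M1 + M2 + norm x'" for n
      unfolding k_def by (meson add_mono norm_triangle_ineq4 order_refl order_trans)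
    then show ?thesis by (auto intro: boundedI)
  qed
  ultimately obtain s z where s: "strict_mono (s :: nat \<Rightarrow> nat)" "(\<lambda>n. k (s n)) \<longlonglongrightarrow> z"
    using bounded_sequence_in_finite_span[OF B(1)] by blast
  have "(\<lambda>n. k (s n) + u (s n) + x') \<longlonglongrightarrow> z + 0 + x'"
    using LIMSEQ_subseq_LIMSEQ[OF u0 s(1)] by (intro tendsto_intros s) (simp add: o_def)
  then show "\<exists>s z. strict_mono s \<and> (\<lambda>n. x (s n)) \<longlonglongrightarrow> z"
    using s(1) by (auto simp: k_def)
qed

section \<open>Drazin inverses\<close>

text \<open>Take preimages of almost minimal norm. Were the minima \<open>d n\<close> unbounded, the
  normalised preimages would have images tending to zero, so a subsequence would converge to a
  kernel vector z lying in every \<open>Z m\<close>; subtracting a suitable multiple of z keeps the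
  image and the membership but drops the norm below the minimum.\<close>

lemma bounded_preimages_in_decreasing_subspaces:
  fixes Z :: "nat \<Rightarrow> 'a::complex_banach set"
  assumes proper: "proper_on_bounded t"
    and Z: "\<And>n. closed (Z n)" "\<And>n. subspace (Z n)" "\<And>m n. m \<le> n \<Longrightarrow> Z n \<subseteq> Z m"
    and x: "\<And>n. x n \<in> Z n" "\<And>n. norm (t \<cdot> x n) \<le> B"
  shows "\<exists>x' M. \<forall>n. x' n \<in> Z n \<and> t \<cdot> x' n = t \<cdot> x n \<and> norm (x' n) \<le> M"
proof -
  define P where "P n = {v \<in> Z n. t \<cdot> v = t \<cdot> x n}" for n
  define d where "d n = Inf (norm ` P n)" for n
  have bdd: "bdd_below (norm ` P n)" for n by (rule bdd_belowI2[of _ 0]) simp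
  have ne: "norm ` P n \<noteq> {}" for n using x(1) by (auto simp: P_def)
  have d_le: "d n \<le> norm v" if "v \<in> P n" for v n
    unfolding d_def by (rule cInf_lower) (use that bdd in auto)
  have "\<exists>v. v \<in> P n \<and> norm v \<le> d n + 1" for n
  proof -
    have "\<exists>r\<in>norm ` P n. r < d n + 1"
      using cInf_less_iff[OF ne bdd, of n "d n + 1"] by (simp add: d_def)
    then show ?thesis by (auto intro: less_imp_le)
  qed
  then obtain v where v: "\<And>n. v n \<in> P n" "\<And>n. norm (v n) \<le> d n + 1" by metis
  show ?thesis
  proof (cases "\<exists>K. \<forall>n\<ge>K. d n < real K")
    case True
    then obtain K where K: "\<And>n. n \<ge> K \<Longrightarrow> d n < real K" by blast
    define M where "M = Max (insert (real K) (d ` {..K}))"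
    have "d n \<le> M" for n
    proof (cases "n \<le> K")
      case False
      then have "d n \<le> real K" using K[of n] by simp
      also have "real K \<le> M" unfolding M_def by (rule Max_ge) auto
      finally show ?thesis .
    next
      case True
      then show ?thesis unfolding M_def by (intro Max_ge) auto
    qed
    then have "norm (v n) \<le> M + 1" for n using v(2)[of n] by (meson add_right_mono order_trans)
    with v(1) show ?thesis by (auto simp: P_def)
  next
    case False
    then have "\<forall>K. \<exists>n\<ge>K. real K \<le> d n" by (auto simp: not_less)
    \<comment> \<open>\<open>g K\<close> is at least K, so that the normalised vectors eventually
      lie in each \<open>Z m\<close>.\<close>
    then obtain g where g: "\<And>K. g K \<ge> K" "\<And>K. real K \<le> d (g K)" by metis
    define e where "e K = d (g (Suc K))" for K
    have e: "real (Suc K) \<le> e K" "e K > 0" for K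
      using g(2)[of "Suc K"] by (auto simp: e_def)
    define u where "u K = inverse (e K) *\<^sub>R v (g (Suc K))" for K
    have uZ: "u K \<in> Z (g (Suc K))" for K
      using v(1) Z(2) by (auto simp: u_def P_def subspace_scale)
    have "norm (u K) \<le> 2" for K
    proof -
      have "norm (v (g (Suc K))) \<le> e K + 1" using v(2) by (simp add: e_def)
      also have "\<dots> \<le> 2 * e K" using e(1)[of K] by simp
      finally show ?thesis using e(2)[of K] by (simp add: u_def field_simps)
    qed
    then have bu: "bounded (range u)" by (auto intro: boundedI)
    have "(\<lambda>K. t \<cdot> u K) \<longlonglongrightarrow> 0"
    proof (rule Lim_null_comparison)
      have "norm (t \<cdot> u K) \<le> B * inverse (real (Suc K))" for K
      proof -
        have "norm (t \<cdot> u K) = inverse (e K) * norm (t \<cdot> x (g (Suc K)))"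
          using v(1)[of "g (Suc K)"] e(2)[of K] by (simp add: u_def P_def)
        also have "\<dots> \<le> inverse (real (Suc K)) * B"
          using e[of K] by (intro mult_mono x(2) le_imp_inverse_le) auto
        finally show ?thesis by (simp add: mult.commute)
      qed
      then show "\<forall>\<^sub>F K in sequentially. norm (t \<cdot> u K) \<le> B * inverse (real (Suc K))" by simp
      show "(\<lambda>K. B * inverse (real (Suc K))) \<longlonglongrightarrow> 0"
        by (rule tendsto_mult_right_zero[OF LIMSEQ_inverse_real_of_nat])
    qed
    then obtain s z where s: "strict_mono (s :: nat \<Rightarrow> nat)" "(\<lambda>n. u (s n)) \<longlonglongrightarrow> z" "t \<cdot> z = 0"
      using proper_on_boundedD[OF proper bu] by metis
    have zZ: "z \<in> Z m" for m
    proof (rule Lim_in_closed_set[OF Z(1) _ _ s(2)])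
      show "\<forall>\<^sub>F n in sequentially. u (s n) \<in> Z m"
        unfolding eventually_sequentially
      proof (intro exI allI impI)
        fix n assume "m \<le> n"
        also have "n \<le> s n" using s(1) by (rule seq_suble)
        also have "s n \<le> g (Suc (s n))" using g(1)[of "Suc (s n)"] by simp
        finally show "u (s n) \<in> Z m" using Z(3) uZ by blast
      qed
    qed simp
    have "\<forall>\<^sub>F n in sequentially. dist (u (s n)) z < 1"
      using s(2) by (rule tendstoD) simp
    then obtain n where n: "norm (u (s n) - z) < 1"
      by (auto simp: eventually_sequentially dist_norm)
    let ?K = "s n"
    have eq: "e ?K *\<^sub>R (u ?K - z) = v (g (Suc ?K)) - e ?K *\<^sub>R z"
      using e(2)[of ?K] by (simp add: u_def scaleR_right_diff_distrib)
    have "e ?K *\<^sub>R (u ?K - z) \<in> P (g (Suc ?K))"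
      unfolding eq using v(1)[of "g (Suc ?K)"] zZ Z(2) s(3)
      by (auto simp: P_def intro!: subspace_diff subspace_scale)
    then have "e ?K \<le> norm (e ?K *\<^sub>R (u ?K - z))" unfolding e_def by (rule d_le)
    also have "\<dots> < e ?K" using n e(2)[of ?K] by simp
    finally show ?thesis by simp
  qed
qed

text \<open>A constant sequence of spaces in the preceding lemma: if no constant worked, there would
  be vectors with images of norm one whose preimages in \<open>Y\<close> are all arbitrarily
  long.\<close>

lemma bounded_preimages_in_subspace:
  assumes proper: "proper_on_bounded t" and Y: "closed Y" "subspace Y"
  obtains M where "0 \<le> M" "\<And>y. y \<in> cop_apply t ` Y \<Longrightarrow> \<exists>x\<in>Y. t \<cdot> x = y \<and> norm x \<le> M * norm y"
proof -
  have "\<exists>n::nat. \<forall>y\<in>cop_apply t ` Y. \<exists>x\<in>Y. t \<cdot> x = y \<and> norm x \<le> real n * norm y"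
  proof (rule ccontr)
    assume "\<not> ?thesis"
    then have "\<forall>n::nat. \<exists>x\<in>Y. \<forall>x'\<in>Y. t \<cdot> x' = t \<cdot> x \<longrightarrow> real n * norm (t \<cdot> x) < norm x'"
      by (auto simp: not_le)
    then obtain x where x: "\<And>n::nat. x n \<in> Y"
      "\<And>n x'. x' \<in> Y \<Longrightarrow> t \<cdot> x' = t \<cdot> x n \<Longrightarrow> real n * norm (t \<cdot> x n) < norm x'"
      by metis
    have nz: "t \<cdot> x n \<noteq> 0" for n
      using x(2)[of 0 n] Y(2) by (auto simp: subspace_0)
    define y where "y n = inverse (norm (t \<cdot> x n)) *\<^sub>R x n" for n
    have "norm (t \<cdot> y n) \<le> 1" for n using nz[of n] by (simp add: y_def)
    moreover have "y n \<in> Y" for n using x(1) Y(2) by (simp add: y_def subspace_scale)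
    ultimately have "\<exists>x' M. \<forall>n. x' n \<in> Y \<and> t \<cdot> x' n = t \<cdot> y n \<and> norm (x' n) \<le> M"
      by (intro bounded_preimages_in_decreasing_subspaces[OF proper, of "\<lambda>n. Y"]) (use Y in auto)
    then obtain x' M where x': "\<And>n. x' n \<in> Y" "\<And>n. t \<cdot> x' n = t \<cdot> y n" "\<And>n. norm (x' n) \<le> M"
      by metis
    obtain n :: nat where n: "M \<le> real n" using real_arch_simple by blast
    have "real n * norm (t \<cdot> x n) < norm (norm (t \<cdot> x n) *\<^sub>R x' n)"
      by (rule x(2)) (use x' Y(2) nz[of n] in \<open>auto simp: y_def subspace_scale\<close>)
    then have "real n < norm (x' n)" using nz[of n] by (simp add: mult.commute)
    with x'(3)[of n] n show False by simp
  qed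
  then obtain n :: nat
    where "\<And>y. y \<in> cop_apply t ` Y \<Longrightarrow> \<exists>x\<in>Y. t \<cdot> x = y \<and> norm x \<le> real n * norm y" by blast
  then show ?thesis by (intro that[of "real n"]) auto
qed

lemma closed_image_of_subspace:
  assumes proper: "proper_on_bounded t" and Y: "closed Y" "subspace Y"
  shows "closed (cop_apply t ` Y)"
  unfolding closed_sequential_limits
proof (intro allI impI, elim conjE)
  fix y l assume y: "\<forall>n. y n \<in> cop_apply t ` Y" "y \<longlonglongrightarrow> l"
  obtain M where M: "0 \<le> M" "\<And>y. y \<in> cop_apply t ` Y \<Longrightarrow> \<exists>x\<in>Y. t \<cdot> x = y \<and> norm x \<le> M * norm y"
    using bounded_preimages_in_subspace[OF assms] by blast
  have "\<forall>n. \<exists>x. x \<in> Y \<and> t \<cdot> x = y n \<and> norm x \<le> M * norm (y n)"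
    using M(2) y(1) by blast
  then obtain x where x: "\<And>n. x n \<in> Y" "\<And>n. t \<cdot> x n = y n" "\<And>n. norm (x n) \<le> M * norm (y n)"
    by metis
  have "bounded (range y)" using y(2) by (rule convergent_imp_bounded)
  then obtain N where "\<And>n. norm (y n) \<le> N" by (auto simp: bounded_iff)
  then have "norm (x n) \<le> M * N" for n
    using x(3)[of n] M(1) by (meson mult_left_mono order_trans)
  then have "bounded (range x)" by (auto intro: boundedI)
  moreover have "(\<lambda>n. t \<cdot> x n) \<longlonglongrightarrow> l" using y(2) by (simp add: x(2))
  ultimately obtain s z where s: "strict_mono (s :: nat \<Rightarrow> nat)" "(\<lambda>n. x (s n)) \<longlonglongrightarrow> z" "t \<cdot> z = l"
    using proper_on_boundedD[OF proper] by metis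
  have "z \<in> Y" by (rule closed_sequentially[OF Y(1) _ s(2)]) (rule x(1))
  with s(3) show "l \<in> cop_apply t ` Y" by blast
qed

section \<open>Ranges of powers\<close>

lemma subspace_range_cop: "subspace (range (cop_apply a))"
  by (intro linear_subspace_image bounded_linear.linear bounded_linear_cop_apply subspace_UNIV)

lemma range_power_Suc: "range (cop_apply (t ^ Suc n)) = cop_apply t ` range (cop_apply (t ^ n))"
  by (auto simp: image_iff)

lemma range_power_decreasing:
  assumes "m \<le> n"
  shows "range (cop_apply (t ^ n)) \<subseteq> range (cop_apply (t ^ m))"
proof -
  have "t ^ n \<cdot> x = t ^ m \<cdot> t ^ (n - m) \<cdot> x" for x
    using assms by (simp add: cop_apply_simps(6)[symmetric] power_add[symmetric] del: cop_apply_simps(6))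
  then show ?thesis by auto
qed

lemma closed_range_power:
  assumes "proper_on_bounded t"
  shows "closed (range (cop_apply (t ^ n)))"
proof (induction n)
  case 0
  have "range (cop_apply (1 :: 'a cop)) = UNIV" by (auto simp: image_iff)
  then show ?case by simp
next
  case (Suc n)
  show ?case
    unfolding range_power_Suc by (intro closed_image_of_subspace assms Suc subspace_range_cop)
qed

text \<open>A preimage in each single range is immediate; one preimage lying in all of them is the
  limit of norm-bounded choices, which is why decreasing sequences of spaces were treated.\<close>

lemma surjective_on_Inter_range_power:
  assumes proper: "proper_on_bounded t" and y: "y \<in> (\<Inter>n. range (cop_apply (t ^ n)))"
  shows "\<exists>x\<in>(\<Inter>n. range (cop_apply (t ^ n))). t \<cdot> x = y"
proof -
  define R where "R n = range (cop_apply (t ^ n))" for n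
  have "\<exists>x\<in>R n. t \<cdot> x = y" for n
  proof -
    have "y \<in> range (cop_apply (t ^ Suc n))" using y by blast
    then show ?thesis unfolding range_power_Suc R_def by blast
  qed
  then obtain x where x: "\<And>n. x n \<in> R n" "\<And>n. t \<cdot> x n = y" by metis
  have "\<exists>x' M. \<forall>n. x' n \<in> R n \<and> t \<cdot> x' n = t \<cdot> x n \<and> norm (x' n) \<le> M"
    using x unfolding R_def
    by (intro bounded_preimages_in_decreasing_subspaces[OF proper, where B = "norm y"]
        closed_range_power[OF proper] subspace_range_cop range_power_decreasing) simp_all
  then obtain x' M where x': "\<And>n. x' n \<in> R n" "\<And>n. t \<cdot> x' n = y" "\<And>n. norm (x' n) \<le> M"
    unfolding x(2) by metis
  have "bounded (range x')" using x'(3) by (auto intro: boundedI)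
  moreover have "(\<lambda>n. t \<cdot> x' n) \<longlonglongrightarrow> y" by (simp add: x'(2))
  ultimately obtain s z where s: "strict_mono (s :: nat \<Rightarrow> nat)" "(\<lambda>n. x' (s n)) \<longlonglongrightarrow> z" "t \<cdot> z = y"
    using proper_on_boundedD[OF proper] by metis
  have "z \<in> R m" for m
  proof (rule Lim_in_closed_set[OF _ _ _ s(2)])
    show "closed (R m)" by (simp add: R_def closed_range_power[OF proper])
    show "\<forall>\<^sub>F n in sequentially. x' (s n) \<in> R m"
      unfolding eventually_sequentially
    proof (intro exI allI impI)
      fix n assume "m \<le> n"
      also have "n \<le> s n" using s(1) by (rule seq_suble)
      finally show "x' (s n) \<in> R m" using range_power_decreasing x'(1) by (fastforce simp: R_def)
    qed
  qed simp
  with s(3) show ?thesis by (auto simp: R_def)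
qed

text \<open>On the space \<open>Y = \<Inter>\<^sub>n ran t\<^sup>n\<close> the operator \<open>t\<close> is onto with bounded preimages, so a kernel vector \<open>v\<^sub>0\<close>
  in it continues to \<open>\<Sum> h\<^sup>n v\<^sub>n\<close> with \<open>t v\<^sub>n\<^sub>+\<^sub>1 = - v\<^sub>n\<close>, which is a kernel vector of \<open>t + h\<close>.\<close>

lemma kernel_Inter_range_power_trivial:
  fixes t :: "'a::complex_banach cop"
  assumes proper: "proper_on_bounded t"
    and inv: "\<And>e. e > 0 \<Longrightarrow> \<exists>h u. cmod h < e \<and> is_inverse (t + h *\<^sub>C 1) u"
    and v0: "v0 \<in> (\<Inter>n. range (cop_apply (t ^ n)))" "t \<cdot> v0 = 0"
  shows "v0 = 0"
proof -
  define Y where "Y = (\<Inter>n. range (cop_apply (t ^ n)))"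
  have Y: "closed Y" "subspace Y"
    unfolding Y_def
    by (auto intro!: closed_INT closed_range_power[OF proper] subspace_Inter subspace_range_cop)
  have image: "y \<in> cop_apply t ` Y" if "y \<in> Y" for y
    using surjective_on_Inter_range_power[OF proper] that unfolding Y_def by blast
  obtain M where M: "0 \<le> M" "\<And>y. y \<in> cop_apply t ` Y \<Longrightarrow> \<exists>x\<in>Y. t \<cdot> x = y \<and> norm x \<le> M * norm y"
    using bounded_preimages_in_subspace[OF proper Y] by blast
  define g where "g y = (SOME x. x \<in> Y \<and> t \<cdot> x = y \<and> norm x \<le> M * norm y)" for y
  have "g y \<in> Y \<and> t \<cdot> g y = y \<and> norm (g y) \<le> M * norm y" if "y \<in> Y" for y
    unfolding g_def by (rule someI_ex) (use M(2)[OF image[OF that]] in blast)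
  then have g: "\<And>y. y \<in> Y \<Longrightarrow> g y \<in> Y" "\<And>y. y \<in> Y \<Longrightarrow> t \<cdot> g y = y"
    "\<And>y. y \<in> Y \<Longrightarrow> norm (g y) \<le> M * norm y"
    by blast+
  define v where "v n = ((\<lambda>y. - g y) ^^ n) v0" for n
  have v_Suc: "v (Suc n) = - g (v n)" for n by (simp add: v_def)
  have vY: "v n \<in> Y" for n
  proof (induction n)
    case (Suc n)
    then show ?case using g(1) Y(2) by (simp add: v_Suc subspace_neg)
  qed (use v0 in \<open>simp add: v_def Y_def\<close>)
  have v_norm: "norm (v n) \<le> M ^ n * norm v0" for n
  proof (induction n)
    case (Suc n)
    have "norm (v (Suc n)) \<le> M * norm (v n)" using g(3)[OF vY] by (simp add: v_Suc)
    also have "\<dots> \<le> M * (M ^ n * norm v0)" by (rule mult_left_mono[OF Suc M(1)])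
    finally show ?case by simp
  qed (simp add: v_def)
  \<comment> \<open>The 4 makes \<open>cmod h * M\<close> at most 1/4, so that the terms after the
    first add up to at most half of \<open>norm v0\<close>; the \<open>+ 1\<close> covers
    \<open>M = 0\<close>.\<close>
  obtain h u where h: "cmod h < inverse (4 * (M + 1))" "is_inverse (t + h *\<^sub>C 1) u"
    using inv[of "inverse (4 * (M + 1))"] M(1) by auto
  have "cmod h * M \<le> cmod h * (M + 1)" by (intro mult_left_mono) auto
  also have "\<dots> \<le> 1 / 4" using h(1) M(1) by (simp add: field_simps)
  finally have c: "cmod h * M \<le> 1 / 4" .
  have step: "norm (h ^ n *\<^sub>C v n) \<le> (1 / 4) ^ n * norm v0" for n
  proof -
    have "norm (h ^ n *\<^sub>C v n) \<le> cmod h ^ n * (M ^ n * norm v0)"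
      by (simp add: norm_scaleC norm_power mult_left_mono v_norm)
    also have "\<dots> = (cmod h * M) ^ n * norm v0" by (simp add: power_mult_distrib)
    also have "\<dots> \<le> (1 / 4) ^ n * norm v0"
      using c M(1) by (intro mult_right_mono power_mono) auto
    finally show ?thesis .
  qed
  define S where "S n = (\<Sum>k<Suc n. h ^ k *\<^sub>C v k)" for n
  have S_Suc: "S (Suc n) = S n + h ^ Suc n *\<^sub>C v (Suc n)" for n by (simp add: S_def)
  have S0: "S 0 = v0" by (simp add: S_def v_def scaleC_one)
  \<comment> \<open>Telescoping leaves only the last term. Applying \<open>u\<close> recovers
    \<open>S n\<close>, which therefore tends to 0, although it stays within half of
    \<open>norm v0\<close> from \<open>v0\<close>.\<close>
  have tS: "(t + h *\<^sub>C 1) \<cdot> S n = h *\<^sub>C h ^ n *\<^sub>C v n" for n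
  proof (induction n)
    case 0
    show ?case using v0(2) by (simp add: S0 v_def scaleC_one)
  next
    case (Suc n)
    have "(t + h *\<^sub>C 1) \<cdot> h ^ Suc n *\<^sub>C v (Suc n) = - (h *\<^sub>C h ^ n *\<^sub>C v n) + h *\<^sub>C h ^ Suc n *\<^sub>C v (Suc n)"
      using g(2)[OF vY[of n]] by (simp add: v_Suc scaleC_scaleC scaleC_add_right mult_ac)
    then show ?case unfolding S_Suc cop_apply_simps(9) Suc by simp
  qed
  have "(\<lambda>n. h ^ n *\<^sub>C v n) \<longlonglongrightarrow> 0"
  proof (rule Lim_null_comparison)
    show "\<forall>\<^sub>F n in sequentially. norm (h ^ n *\<^sub>C v n) \<le> (1 / 4) ^ n * norm v0" by (simp add: step)
    show "(\<lambda>n. (1 / 4) ^ n * norm v0) \<longlonglongrightarrow> 0"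
      by (intro tendsto_mult_left_zero LIMSEQ_power_zero) simp
  qed
  then have "(\<lambda>n. u \<cdot> h *\<^sub>C h ^ n *\<^sub>C v n) \<longlonglongrightarrow> u \<cdot> h *\<^sub>C 0"
    by (intro tendsto_intros)
  moreover have "u \<cdot> h *\<^sub>C h ^ n *\<^sub>C v n = S n" for n
    unfolding tS[symmetric] cop_apply_simps(6)[symmetric] using h(2) by (simp add: is_inverse_def)
  ultimately have "S \<longlonglongrightarrow> 0" by simp
  then have "(\<lambda>n. norm (S n - v0)) \<longlonglongrightarrow> norm (0 - v0)"
    by (intro tendsto_intros)
  moreover have "norm (S n - v0) \<le> (1 - (1 / 2) ^ n) * (norm v0 / 2)" for n
  proof (induction n)
    case (Suc n)
    have "(1 / 4 :: real) ^ Suc n = (1 / 2) ^ Suc n * (1 / 2) ^ Suc n"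
      by (simp add: power_mult_distrib[symmetric])
    also have "\<dots> \<le> (1 / 2) ^ Suc n * (1 / 2)"
      by (intro mult_left_mono) (simp_all add: power_le_one)
    finally have "(1 / 4) ^ Suc n * norm v0 \<le> (1 / 2) ^ Suc n * (1 / 2) * norm v0"
      by (rule mult_right_mono) simp
    moreover have "norm (S (Suc n) - v0) \<le> norm (S n - v0) + norm (h ^ Suc n *\<^sub>C v (Suc n))"
      using norm_triangle_ineq[of "S n - v0" "h ^ Suc n *\<^sub>C v (Suc n)"] by (simp add: S_Suc algebra_simps)
    ultimately show ?case using Suc step[of "Suc n"] by (simp add: algebra_simps)
  qed (simp add: S0)
  then have "norm (S n - v0) \<le> norm v0 / 2" for n
    by (rule order_trans) (simp add: mult_left_le_one_le power_le_one algebra_simps)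
  ultimately have "norm (0 - v0) \<le> norm v0 / 2"
    by (intro LIMSEQ_le_const2) auto
  then show ?thesis by simp
qed

text \<open>Unit kernel vectors in every range would have a convergent subsequence, and its limit
  would be a unit kernel vector in all ranges, which the intersection lemma excludes.\<close>

lemma kernel_range_power_trivial:
  fixes t :: "'a::complex_banach cop"
  assumes proper: "proper_on_bounded t"
    and inv: "\<And>e. e > 0 \<Longrightarrow> \<exists>h u. cmod h < e \<and> is_inverse (t + h *\<^sub>C 1) u"
  shows "\<exists>p. \<forall>x\<in>range (cop_apply (t ^ p)). t \<cdot> x = 0 \<longrightarrow> x = 0"
proof (rule ccontr)
  assume "\<not> ?thesis"
  then have "\<forall>p. \<exists>x\<in>range (cop_apply (t ^ p)). t \<cdot> x = 0 \<and> x \<noteq> 0" by blast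
  then obtain x where x: "\<And>p. x p \<in> range (cop_apply (t ^ p))" "\<And>p. t \<cdot> x p = 0" "\<And>p. x p \<noteq> 0"
    by metis
  define y where "y p = inverse (norm (x p)) *\<^sub>R x p" for p
  have y: "y p \<in> range (cop_apply (t ^ p))" "t \<cdot> y p = 0" "norm (y p) = 1" for p
    using x[of p] by (auto simp: y_def intro!: subspace_scale[OF subspace_range_cop])
  have "bounded (range y)" by (rule boundedI[of _ 1]) (use y(3) in auto)
  moreover have "(\<lambda>p. t \<cdot> y p) \<longlonglongrightarrow> 0" by (simp add: y(2))
  ultimately obtain s z where s: "strict_mono (s :: nat \<Rightarrow> nat)" "(\<lambda>n. y (s n)) \<longlonglongrightarrow> z" "t \<cdot> z = 0"
    using proper_on_boundedD[OF proper] by metis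
  have "z \<in> range (cop_apply (t ^ m))" for m
  proof (rule Lim_in_closed_set[OF closed_range_power[OF proper] _ _ s(2)])
    show "\<forall>\<^sub>F n in sequentially. y (s n) \<in> range (cop_apply (t ^ m))"
      unfolding eventually_sequentially
    proof (intro exI allI impI)
      fix n assume "m \<le> n"
      also have "n \<le> s n" using s(1) by (rule seq_suble)
      finally show "y (s n) \<in> range (cop_apply (t ^ m))" using range_power_decreasing y(1) by fast
    qed
  qed simp
  then have "z = 0" using kernel_Inter_range_power_trivial[OF proper inv] s(3) by blast
  moreover have "norm z = 1" using tendsto_norm[OF s(2)] by (simp add: y(3) LIMSEQ_const_iff)
  ultimately show False by simp
qed

text \<open>Solve the perturbed equations (t + h_n) z_n = y with h_n tending to 0. The inverses
  commute with \<open>t\<close>, so \<open>z n\<close> stays in the range of \<open>t ^ p\<close>;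
  the lower bound there keeps it bounded, and properness yields a solution for h = 0.\<close>

lemma surjective_on_range_power:
  fixes t :: "'a::complex_banach cop"
  assumes proper: "proper_on_bounded t"
    and inv: "\<And>e. e > 0 \<Longrightarrow> \<exists>h u. cmod h < e \<and> is_inverse (t + h *\<^sub>C 1) u"
    and M: "0 \<le> M" "\<And>z. z \<in> range (cop_apply (t ^ p)) \<Longrightarrow> norm z \<le> M * norm (t \<cdot> z)"
    and y: "y \<in> range (cop_apply (t ^ p))"
  shows "\<exists>z\<in>range (cop_apply (t ^ p)). t \<cdot> z = y"
proof -
  \<comment> \<open>The first factor makes M |h_n| at most 1/2, so that \<open>norm (z n)\<close>
    can be absorbed; the second sends h_n to 0.\<close>
  define e where "e n = inverse (2 * (M + 1)) * inverse (real (Suc n))" for n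
  have "e n > 0" for n using M(1) by (simp add: e_def)
  then have "\<forall>n. \<exists>h u. cmod h < e n \<and> is_inverse (t + h *\<^sub>C 1) u" using inv by blast
  then obtain h u where h: "\<And>n. cmod (h n) < e n" "\<And>n. is_inverse (t + h n *\<^sub>C 1) (u n)" by metis
  have e0: "e \<longlonglongrightarrow> 0"
    unfolding e_def by (rule tendsto_mult_right_zero[OF LIMSEQ_inverse_real_of_nat])
  then have h0: "h \<longlonglongrightarrow> 0"
  proof (rule Lim_null_comparison[rotated])
    show "\<forall>\<^sub>F n in sequentially. cmod (h n) \<le> e n"
      by (rule always_eventually) (use less_imp_le[OF h(1)] in blast)
  qed
  define z where "z n = u n \<cdot> y" for n
  have tz: "t \<cdot> z n = y - h n *\<^sub>C z n" for n
  proof -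
    have "((t + h n *\<^sub>C 1) * u n) \<cdot> y = y" using h(2)[of n] by (simp add: is_inverse_def)
    then show ?thesis by (simp add: z_def algebra_simps)
  qed
  have zR: "z n \<in> range (cop_apply (t ^ p))" for n
  proof -
    have "t ^ p * (t + h n *\<^sub>C 1) = (t + h n *\<^sub>C 1) * t ^ p"
      by (simp add: algebra_simps power_commutes)
    then have "t ^ p * u n = u n * t ^ p" by (rule is_inverse_commute[OF h(2)])
    then have comm: "t ^ p \<cdot> u n \<cdot> x = u n \<cdot> t ^ p \<cdot> x" for x by (metis cop_apply_simps(6))
    obtain x where "y = t ^ p \<cdot> x" using y by blast
    then have "z n = t ^ p \<cdot> u n \<cdot> x" by (simp add: z_def comm)
    then show ?thesis by blast
  qed
  have z_norm: "norm (z n) \<le> 2 * M * norm y" for n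
  proof -
    have "inverse (real (Suc n)) \<le> 1" by (simp add: inverse_le_1_iff)
    then have "e n \<le> inverse (2 * (M + 1))"
      unfolding e_def using M(1) by (simp add: mult_left_le)
    then have "cmod (h n) \<le> inverse (2 * (M + 1))" using h(1)[of n] by linarith
    then have "cmod (h n) * (M + 1) \<le> 1 / 2" using M(1) by (simp add: field_simps)
    then have hM: "M * cmod (h n) \<le> 1 / 2" by (simp add: algebra_simps) (use norm_ge_zero[of "h n"] in linarith)
    have "norm (z n) \<le> M * norm (y - h n *\<^sub>C z n)" using M(2)[OF zR[of n]] by (simp add: tz)
    also have "\<dots> \<le> M * (norm y + cmod (h n) * norm (z n))"
      using M(1) by (intro mult_left_mono) (metis norm_scaleC norm_triangle_ineq4)
    also have "\<dots> = M * norm y + M * cmod (h n) * norm (z n)" by (simp add: algebra_simps)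
    also have "\<dots> \<le> M * norm y + 1 / 2 * norm (z n)"
      by (intro add_left_mono mult_right_mono hM) simp
    finally show ?thesis by simp
  qed
  then have bz: "bounded (range z)" by (auto intro: boundedI)
  have "(\<lambda>n. h n *\<^sub>C z n) \<longlonglongrightarrow> 0"
  proof (rule Lim_null_comparison)
    show "\<forall>\<^sub>F n in sequentially. norm (h n *\<^sub>C z n) \<le> cmod (h n) * (2 * M * norm y)"
      by (simp add: norm_scaleC mult_left_mono z_norm)
    show "(\<lambda>n. cmod (h n) * (2 * M * norm y)) \<longlonglongrightarrow> 0"
      by (intro tendsto_mult_left_zero tendsto_norm_zero h0)
  qed
  then have "(\<lambda>n. t \<cdot> z n) \<longlonglongrightarrow> y"
    unfolding tz using tendsto_diff[OF tendsto_const, of _ 0 _ y] by simp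
  then obtain s z' where s: "strict_mono (s :: nat \<Rightarrow> nat)" "(\<lambda>n. z (s n)) \<longlonglongrightarrow> z'" "t \<cdot> z' = y"
    using proper_on_boundedD[OF proper bz] by metis
  have "z' \<in> range (cop_apply (t ^ p))"
    by (rule closed_sequentially[OF closed_range_power[OF proper] _ s(2)]) (rule zR)
  with s(3) show ?thesis by blast
qed

text \<open>On \<open>Z\<close>, the range of \<open>t ^ p\<close> with p from the kernel lemma,
  \<open>t\<close> is bijective with bounded inverse. So \<open>s\<close> is \<open>t ^ p\<close>
  followed by the inverse of \<open>t ^ Suc p\<close> on \<open>Z\<close>, that is, the inverse of t
  on \<open>Z\<close> and zero on the kernel of \<open>t ^ p\<close>. Uniqueness of the solution
  gives linearity and the commutation property.\<close>

lemma drazin_inverse: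
  fixes t :: "'a::complex_banach cop"
  assumes proper: "proper_on_bounded t"
    and inv: "\<And>e. e > 0 \<Longrightarrow> \<exists>h u. cmod h < e \<and> is_inverse (t + h *\<^sub>C 1) u"
  shows "\<exists>s p. s * t * s = s \<and> t ^ Suc p * s = t ^ p \<and> (\<forall>b. b * t = t * b \<longrightarrow> b * s = s * b)"
proof -
  obtain p where p: "\<And>x. x \<in> range (cop_apply (t ^ p)) \<Longrightarrow> t \<cdot> x = 0 \<Longrightarrow> x = 0"
    using kernel_range_power_trivial[OF assms] by blast
  define Z where "Z = range (cop_apply (t ^ p))"
  have Z: "closed Z" "subspace Z"
    by (simp_all add: Z_def closed_range_power[OF proper] subspace_range_cop)
  have Z_scaleC: "c *\<^sub>C z \<in> Z" if "z \<in> Z" for c z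
    using that by (auto simp: Z_def cop_apply_simps(13)[symmetric] simp del: cop_apply_simps)
  have Z_commute: "b \<cdot> z \<in> Z" if "b * t = t * b" "z \<in> Z" for b z
  proof -
    have "b * t ^ p = t ^ p * b" using power_commuting_commutes[of t b p] that(1) by simp
    then have "b \<cdot> t ^ p \<cdot> x = t ^ p \<cdot> b \<cdot> x" for x by (metis cop_apply_simps(6))
    then show ?thesis using that(2) by (auto simp: Z_def)
  qed
  obtain M where M: "0 \<le> M" "\<And>y. y \<in> cop_apply t ` Z \<Longrightarrow> \<exists>x\<in>Z. t \<cdot> x = y \<and> norm x \<le> M * norm y"
    using bounded_preimages_in_subspace[OF proper Z] by blast
  have below: "norm z \<le> M * norm (t \<cdot> z)" if z: "z \<in> Z" for z
  proof -
    obtain x where x: "x \<in> Z" "t \<cdot> x = t \<cdot> z" "norm x \<le> M * norm (t \<cdot> z)"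
      using M(2)[OF imageI[OF z]] by blast
    have "z - x = 0"
      by (rule p) (use x z Z(2) in \<open>auto simp: Z_def[symmetric] subspace_diff\<close>)
    with x(3) show ?thesis by simp
  qed
  have onto: "\<exists>z\<in>Z. t \<cdot> z = y" if "y \<in> Z" for y
    using surjective_on_range_power[OF proper inv M(1) below[unfolded Z_def]] that
    unfolding Z_def by blast
  have below_power: "norm z \<le> M ^ n * norm (t ^ n \<cdot> z)" if "z \<in> Z" for z n
    using that
  proof (induction n arbitrary: z)
    case (Suc n)
    have "t \<cdot> z \<in> Z" by (rule Z_commute[OF refl Suc.prems])
    from Suc.IH[OF this] have "norm (t \<cdot> z) \<le> M ^ n * norm (t ^ Suc n \<cdot> z)"
      by (simp only: power_Suc2 cop_apply_simps(6))
    with below[OF Suc.prems] M(1) show ?case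
      by (metis mult.assoc mult_left_mono order_trans power_Suc)
  qed simp
  have onto_power: "\<exists>z\<in>Z. t ^ n \<cdot> z = y" if "y \<in> Z" for y n
    using that
  proof (induction n arbitrary: y)
    case (Suc n)
    obtain z where "z \<in> Z" "t \<cdot> z = y" using onto[OF Suc.prems] by blast
    moreover from Suc.IH[OF this(1)] obtain w where "w \<in> Z" "t ^ n \<cdot> w = z" by blast
    ultimately show ?case by (auto intro!: bexI[of _ w])
  qed auto
  define q where "q = Suc p"
  have inj: "z = w" if "z \<in> Z" "w \<in> Z" "t ^ q \<cdot> z = t ^ q \<cdot> w" for z w
    using below_power[of "z - w" q] that Z(2) by (simp add: subspace_diff)
  define S where "S x = (SOME z. z \<in> Z \<and> t ^ q \<cdot> z = t ^ p \<cdot> x)" for x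
  have S: "S x \<in> Z \<and> t ^ q \<cdot> S x = t ^ p \<cdot> x" for x
    unfolding S_def
    by (rule someI_ex) (use onto_power[of "t ^ p \<cdot> x" q] in \<open>auto simp: Z_def\<close>)
  have S_eq: "S x = z" if "z \<in> Z" "t ^ q \<cdot> z = t ^ p \<cdot> x" for x z
    by (rule inj) (use S that in auto)
  have "bounded_clinear S"
    unfolding bounded_clinear_def
  proof (intro conjI allI)
    show "bounded_linear S"
    proof (rule bounded_linear_intro)
      fix x y and r :: real
      show "S (x + y) = S x + S y" by (rule S_eq) (use S Z(2) in \<open>auto simp: subspace_add\<close>)
      show "S (r *\<^sub>R x) = r *\<^sub>R S x" by (rule S_eq) (use S Z(2) in \<open>auto simp: subspace_scale\<close>)
      have "norm (S x) \<le> M ^ q * norm (t ^ p \<cdot> x)" using below_power[of "S x" q] S by metis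
      also have "\<dots> \<le> M ^ q * (norm (t ^ p) * norm x)"
        using M(1) by (intro mult_left_mono norm_cop_apply) simp
      finally show "norm (S x) \<le> norm x * (M ^ q * norm (t ^ p))" by (simp add: mult_ac)
    qed
    show "S (c *\<^sub>C x) = c *\<^sub>C S x" for c x by (rule S_eq) (use S Z_scaleC in auto)
  qed
  then obtain s where s: "\<And>x. s \<cdot> x = S x" using cop_of_apply by metis
  have comm: "b * s = s * b" if b: "b * t = t * b" for b
  proof (rule cop_eqI)
    fix x
    have bt: "b \<cdot> t ^ n \<cdot> x = t ^ n \<cdot> b \<cdot> x" for n x
      using power_commuting_commutes[of t b n] b by (metis cop_apply_simps(6))
    have "S (b \<cdot> x) = b \<cdot> S x"
      by (rule S_eq) (use S Z_commute[OF b] in \<open>auto simp: bt[symmetric]\<close>)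
    then show "(b * s) \<cdot> x = (s * b) \<cdot> x" by (simp add: s)
  qed
  have "s * t * s = s"
  proof (rule cop_eqI)
    fix x
    have "S (t \<cdot> S x) = S x"
    proof (rule S_eq)
      show "t ^ q \<cdot> S x = t ^ p \<cdot> t \<cdot> S x" by (simp only: q_def power_Suc2 cop_apply_simps(6))
    qed (use S in blast)
    then show "(s * t * s) \<cdot> x = s \<cdot> x" by (simp add: s)
  qed
  moreover have "t ^ Suc p * s = t ^ p"
    using S by (intro cop_eqI) (simp add: s q_def)
  ultimately show ?thesis using comm by blast
qed

section \<open>The peripheral spectrum\<close>

text \<open>The commutation axiom of the Drazin inverse is strengthened to the whole commutant of
  \<open>t\<close>; for \<open>t = z *\<^sub>C 1 - a\<close> this makes \<open>1 - t * s\<close>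
  commute with \<open>a\<close> and with the projections at other points. That element is the
  spectral projection, with image the kernel of \<open>t ^ p\<close>.\<close>

definition drazin :: "'a::complex_banach cop \<Rightarrow> nat \<Rightarrow> 'a cop \<Rightarrow> bool" where
  "drazin t p s \<longleftrightarrow> s * t * s = s \<and> t ^ Suc p * s = t ^ p \<and> (\<forall>b. b * t = t * b \<longrightarrow> b * s = s * b)"

lemma drazin_commute: "drazin t p s \<Longrightarrow> b * t = t * b \<Longrightarrow> b * s = s * b"
  by (simp add: drazin_def)

lemma drazin_projection:
  assumes "drazin t p s"
  shows "t * s = s * t" "(1 - t * s) * (1 - t * s) = 1 - t * s" "(1 - t * s) * s = 0"
    "t ^ p * (1 - t * s) = 0" "b * t = t * b \<Longrightarrow> b * (1 - t * s) = (1 - t * s) * b"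
proof -
  show ts: "t * s = s * t" using drazin_commute[OF assms, of t] by simp
  have sts: "t * s * s = s" using assms ts by (simp add: drazin_def)
  show "(1 - t * s) * s = 0" by (simp add: left_diff_distrib sts)
  have "t * s * (t * s) = t * (s * t * s)" by (simp only: mult.assoc)
  also have "\<dots> = t * s" using assms by (simp add: drazin_def)
  finally show "(1 - t * s) * (1 - t * s) = 1 - t * s"
    by (simp add: left_diff_distrib right_diff_distrib)
  have "t ^ p * (t * s) = t ^ Suc p * s" by (simp only: power_Suc2 mult.assoc)
  then show "t ^ p * (1 - t * s) = 0"
    using assms by (simp add: drazin_def right_diff_distrib)
  assume b: "b * t = t * b"
  have "b * (t * s) = t * (b * s)" by (simp only: mult.assoc[symmetric] b)
  also have "\<dots> = t * s * b" by (simp only: drazin_commute[OF assms b] mult.assoc)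
  finally show "b * (1 - t * s) = (1 - t * s) * b"
    by (simp add: left_diff_distrib right_diff_distrib)
qed

lemma commute_mult: "c * a = a * c \<Longrightarrow> c * b = b * c \<Longrightarrow> c * (a * b) = a * b * (c :: 'b::semigroup_mult)"
  by (metis mult.assoc)

lemma commute_sum: "(\<And>i. i \<in> I \<Longrightarrow> c * f i = f i * c) \<Longrightarrow> c * sum f I = sum f I * (c :: 'b::semiring_0)"
  by (simp add: sum_distrib_left sum_distrib_right)

text \<open>The Laurent expansion at a pole. Off the projection \<open>1 - t * s\<close> the inverse
  is s (1 + h s)^(-1); on its image \<open>t\<close> is nilpotent, so the geometric series for (t +
  h)^(-1) stops after \<open>p\<close> terms.\<close>

lemma drazin_resolvent:
  assumes d: "drazin t p s" and h: "h \<noteq> 0" and v: "is_inverse (1 + h *\<^sub>C s) v"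
  shows "is_inverse (t + h *\<^sub>C 1)
    (s * v + inverse h *\<^sub>C ((\<Sum>j<p. (- (inverse h *\<^sub>C t)) ^ j) * (1 - t * s)))"
proof -
  define P where "P = 1 - t * s"
  define G where "G = (\<Sum>j<p. (- (inverse h *\<^sub>C t)) ^ j)"
  have ts: "t * s = s * t" and Ps: "P * s = 0" and tP: "t ^ p * P = 0" "t * P = P * t"
    using drazin_projection[OF d] unfolding P_def by blast+
  have "t * (1 + h *\<^sub>C s) = (1 + h *\<^sub>C s) * t" by (simp add: distrib_left distrib_right ts)
  then have tv: "t * v = v * t" by (rule is_inverse_commute[OF v])
  have "P = P * ((1 + h *\<^sub>C s) * v)" using v by (simp add: is_inverse_def)
  also have "\<dots> = (P + h *\<^sub>C (P * s)) * v" by (simp only: mult.assoc[symmetric] distrib_left mult_1_right cop_times_scaleC)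
  finally have Pv: "P * v = P" by (simp add: Ps)
  have "(t + h *\<^sub>C 1) * (s * v) = (t * s + h *\<^sub>C s) * v"
    by (simp add: distrib_left distrib_right mult.assoc)
  also have "\<dots> = ((1 + h *\<^sub>C s) - P) * v" by (simp add: P_def add.commute)
  also have "\<dots> = 1 - P" using v Pv by (simp add: left_diff_distrib is_inverse_def)
  finally have 1: "(t + h *\<^sub>C 1) * (s * v) = 1 - P" .
  have "(t + h *\<^sub>C 1) * (inverse h *\<^sub>C (G * P)) = (1 - - (inverse h *\<^sub>C t)) * G * P"
    using h by (simp add: distrib_left distrib_right scaleC_add_right scaleC_scaleC scaleC_one mult.assoc add.commute)
  also have "\<dots> = (1 - (- (inverse h *\<^sub>C t)) ^ p) * P"
    unfolding G_def one_minus_mult_geometric ..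
  also have "(- (inverse h *\<^sub>C t)) ^ p = (- inverse h) ^ p *\<^sub>C t ^ p"
    unfolding complex_vector.scale_minus_left[symmetric] scaleC_power ..
  finally have 2: "(t + h *\<^sub>C 1) * (inverse h *\<^sub>C (G * P)) = P"
    by (simp add: left_diff_distrib tP)
  define X where "X = s * v + inverse h *\<^sub>C (G * P)"
  have X1: "(t + h *\<^sub>C 1) * X = 1" unfolding X_def distrib_left 1 2 by simp
  have "t * G = G * t"
    unfolding G_def by (intro commute_sum power_commuting_commutes[symmetric]) simp
  then have "t * (G * P) = G * P * t" by (intro commute_mult tP)
  then have "t * X = X * t"
    unfolding X_def using commute_mult[OF ts tv] by (simp add: distrib_left distrib_right)
  then have "X * (t + h *\<^sub>C 1) = (t + h *\<^sub>C 1) * X" by (simp add: distrib_left distrib_right)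
  with X1 show ?thesis unfolding is_inverse_def X_def G_def P_def by simp
qed

lemma drazin_isolated:
  assumes "drazin t p s"
  shows "\<exists>e>0. \<forall>h. h \<noteq> 0 \<and> cmod h < e \<longrightarrow> (\<exists>u. is_inverse (t + h *\<^sub>C 1) u)"
\<comment> \<open>The \<open>+ 1\<close> covers \<open>s = 0\<close>, where
  \<open>inverse 0 = 0\<close> would be no radius.\<close>
proof (rule exI[of _ "inverse (norm s + 1)"], intro conjI allI impI)
  show "inverse (norm s + 1) > 0" by (simp add: add_nonneg_pos)
  fix h assume h: "h \<noteq> 0 \<and> cmod h < inverse (norm s + 1)"
  moreover have "norm s + 1 > 0" by (simp add: add_nonneg_pos)
  ultimately have "cmod h * (norm s + 1) < 1"
    by (simp add: inverse_eq_divide pos_less_divide_eq)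
  moreover have "cmod h * norm s \<le> cmod h * (norm s + 1)" by (intro mult_left_mono) auto
  ultimately have "cmod h * norm s < 1" by linarith
  then have "norm (- (h *\<^sub>C s)) < 1" by (simp add: norm_scaleC)
  then obtain v where "is_inverse (1 - - (h *\<^sub>C s)) v" using neumann_series by blast
  then have "is_inverse (1 + h *\<^sub>C s) v" by simp
  with drazin_resolvent[OF assms] h show "\<exists>u. is_inverse (t + h *\<^sub>C 1) u" by blast
qed

text \<open>Induction on \<open>m\<close> reduces to an eigenvector for z, on which
  \<open>(w *\<^sub>C 1 - a) ^ n\<close> is multiplication by the nonzero number (w - z)^n.\<close>

lemma generalized_eigenspaces_disjoint:
  assumes "z \<noteq> w" "(z *\<^sub>C 1 - a) ^ m \<cdot> x = 0" "(w *\<^sub>C 1 - a) ^ n \<cdot> x = 0"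
  shows "x = (0 :: 'a::complex_banach)"
  using assms(2,3)
proof (induction m arbitrary: x)
  case (Suc m)
  let ?y = "(z *\<^sub>C 1 - a) \<cdot> x"
  have comm: "(w *\<^sub>C 1 - a) ^ n * (z *\<^sub>C 1 - a) = (z *\<^sub>C 1 - a) * (w *\<^sub>C 1 - a) ^ n"
    by (rule power_commuting_commutes) (simp add: algebra_simps)
  have "(w *\<^sub>C 1 - a) ^ n \<cdot> ?y = (z *\<^sub>C 1 - a) \<cdot> (w *\<^sub>C 1 - a) ^ n \<cdot> x"
    by (simp only: cop_apply_simps(6)[symmetric] comm)
  then have "(w *\<^sub>C 1 - a) ^ n \<cdot> ?y = 0" by (simp only: Suc.prems cop_apply_simps)
  moreover have "(z *\<^sub>C 1 - a) ^ m \<cdot> ?y = 0"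
    using Suc.prems(1) by (simp only: power_Suc2 cop_apply_simps(6))
  ultimately have "?y = 0" by (rule Suc.IH[rotated])
  then have ax: "a \<cdot> x = z *\<^sub>C x" by simp
  have "(w *\<^sub>C 1 - a) ^ k \<cdot> x = (w - z) ^ k *\<^sub>C x" for k
    by (induction k) (simp_all add: scaleC_one ax scaleC_scaleC scaleC_diff_left left_diff_distrib mult.commute)
  with Suc.prems(2) assms(1) show ?case by simp
qed simp

text \<open>Without an eigenvector every power of t = z - a is injective; since \<open>t ^ p\<close>
  annihilates \<open>1 - t * s\<close>, that projection vanishes and \<open>s\<close> is a genuine
  inverse.\<close>

lemma drazin_eigenvector:
  assumes d: "drazin (z *\<^sub>C 1 - a) p s" and z: "z \<in> spectrum (cop_apply a)"
  shows "\<exists>v. v \<noteq> 0 \<and> a \<cdot> v = z *\<^sub>C v"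
proof (rule ccontr)
  let ?t = "z *\<^sub>C 1 - a"
  assume no: "\<not> ?thesis"
  have inj: "?t ^ n \<cdot> x = 0 \<Longrightarrow> x = 0" for n x
  proof (induction n)
    case (Suc n)
    have "?t \<cdot> ?t ^ n \<cdot> x = 0" using Suc.prems by (simp only: power_Suc cop_apply_simps(6))
    then have "a \<cdot> ?t ^ n \<cdot> x = z *\<^sub>C ?t ^ n \<cdot> x"
      unfolding cop_apply_simps(2)[of _ _ "?t ^ n \<cdot> x"] by simp
    then have "?t ^ n \<cdot> x = 0" using no by blast
    then show ?case by (rule Suc.IH)
  qed simp
  have "1 - ?t * s = 0"
  proof (rule cop_eqI)
    fix x
    have "?t ^ p \<cdot> (1 - ?t * s) \<cdot> x = 0"
      unfolding cop_apply_simps(6)[symmetric] drazin_projection(4)[OF d] by simp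
    then show "(1 - ?t * s) \<cdot> x = 0 \<cdot> x" by (simp only: inj cop_apply_simps)
  qed
  then have "is_inverse ?t s" using drazin_projection(1)[OF d] by (simp add: is_inverse_def)
  with z show False using not_in_spectrum_cop by blast
qed

text \<open>Moving z radially outwards leaves the disk that contains the spectrum, which provides
  invertible operators arbitrarily close to \<open>z *\<^sub>C 1 - a\<close>.\<close>

lemma peripheral_drazin:
  fixes a :: "'a::complex_banach cop"
  defines "r \<equiv> spectral_radius (cop_apply a)"
  assumes "0 < r" "cmod z = r" "proper_on_bounded (z *\<^sub>C 1 - a)"
  shows "\<exists>s p. drazin (z *\<^sub>C 1 - a) p s"
  unfolding drazin_def
proof (rule drazin_inverse[OF assms(4)])
  fix e :: real assume e: "e > 0"
  define d where "d = e / (2 * r)"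
  have d: "d > 0" "d * r < e" using e assms(2) by (simp_all add: d_def)
  define h where "h = complex_of_real d * z"
  have "z + h = complex_of_real (1 + d) * z" by (simp add: h_def algebra_simps)
  then have "cmod (z + h) = (1 + d) * r" using d(1) assms(3) by (simp add: norm_mult del: of_real_add)
  also have "\<dots> > r" using d assms(2) by (simp add: algebra_simps)
  finally have "z + h \<notin> spectrum (cop_apply a)"
    using spectral_radius_ge[of "z + h" a] by (auto simp: r_def)
  then obtain u where u: "is_inverse ((z + h) *\<^sub>C 1 - a) u" by (auto simp: not_in_spectrum_cop)
  have "(z + h) *\<^sub>C 1 - a = z *\<^sub>C 1 - a + h *\<^sub>C 1" by (simp add: scaleC_add_left)
  with u have "is_inverse (z *\<^sub>C 1 - a + h *\<^sub>C 1) u" by (simp only:)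
  moreover have "cmod h < e" using d assms(3) by (simp add: h_def norm_mult)
  ultimately show "\<exists>h u. cmod h < e \<and> is_inverse (z *\<^sub>C 1 - a + h *\<^sub>C 1) u" by blast
qed

text \<open>With Q = 1 - E, the decay follows once \<open>a * Q\<close> has no spectrum of modulus
  at least r, because \<open>(a * Q) ^ n * Q = a ^ n * Q\<close>.\<close>

lemma peripheral_decomposition:
  fixes a :: "'a::complex_banach cop"
  defines "r \<equiv> spectral_radius (cop_apply a)"
  defines "L \<equiv> {z \<in> spectrum (cop_apply a). cmod z = r}"
  assumes r: "0 < r" and proper: "\<And>z. z \<in> L \<Longrightarrow> proper_on_bounded (z *\<^sub>C 1 - a)"
  obtains p s P where
    "finite L"
    "\<And>z. z \<in> L \<Longrightarrow> drazin (z *\<^sub>C 1 - a) (p z) (s z)"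
    "\<And>z. P z = 1 - (z *\<^sub>C 1 - a) * s z"
    "\<And>z w. z \<in> L \<Longrightarrow> w \<in> L \<Longrightarrow> z \<noteq> w \<Longrightarrow> P z * P w = 0"
    "\<And>x. (\<lambda>n. inverse r ^ n *\<^sub>R a ^ n \<cdot> (1 - sum P L) \<cdot> x) \<longlonglongrightarrow> 0"
proof -
  have "\<forall>z\<in>L. \<exists>s p. drazin (z *\<^sub>C 1 - a) p s"
    using peripheral_drazin[of a] r proper unfolding L_def r_def by blast
  then obtain s p where d: "\<And>z. z \<in> L \<Longrightarrow> drazin (z *\<^sub>C 1 - a) (p z) (s z)" by metis
  have "compact (spectrum (cop_apply a) \<inter> sphere 0 r)"
    by (intro compact_Int_closed compact_spectrum) simp
  moreover have "spectrum (cop_apply a) \<inter> sphere 0 r = L" by (auto simp: L_def)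
  ultimately have cL: "compact L" by simp
  have "\<not> z islimpt L" if z: "z \<in> L" for z
  proof
    assume lim: "z islimpt L"
    obtain e where e: "e > 0"
      "\<And>h. h \<noteq> 0 \<Longrightarrow> cmod h < e \<Longrightarrow> \<exists>u. is_inverse (z *\<^sub>C 1 - a + h *\<^sub>C 1) u"
      using drazin_isolated[OF d[OF z]] by blast
    obtain w where w: "w \<in> L" "w \<noteq> z" "dist w z < e"
      using lim e(1) unfolding islimpt_approachable by blast
    then obtain u where "is_inverse (z *\<^sub>C 1 - a + (w - z) *\<^sub>C 1) u"
      using e(2)[of "w - z"] by (auto simp: dist_norm)
    then have "is_inverse (w *\<^sub>C 1 - a) u" by (simp add: scaleC_diff_left)
    then have "w \<notin> spectrum (cop_apply a)" using not_in_spectrum_cop by blast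
    with w(1) show False by (simp add: L_def)
  qed
  then have fin: "finite L" using finite_not_islimpt_in_compact[OF cL, of L] by simp
  define P where "P z = 1 - (z *\<^sub>C 1 - a) * s z" for z
  have aP: "b * P z = P z * b" if "z \<in> L" "b * a = a * b" for b z
    unfolding P_def by (rule drazin_projection(5)[OF d[OF that(1)]]) (simp add: algebra_simps that(2))
  have PP: "P z * P z = P z" if "z \<in> L" for z
    using drazin_projection(2)[OF d[OF that]] by (simp add: P_def)
  have P0: "P z * P w = 0" if "z \<in> L" "w \<in> L" "z \<noteq> w" for z w
  proof (rule cop_eqI)
    fix x
    have *: "(z *\<^sub>C 1 - a) ^ p z \<cdot> P z \<cdot> y = 0" if "z \<in> L" for z y
      unfolding cop_apply_simps(6)[symmetric] P_def drazin_projection(4)[OF d[OF that]] by simp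
    have "P z * P w = P w * P z"
      by (intro aP that(2)) (rule aP[OF that(1) refl, symmetric])
    then have "P z \<cdot> P w \<cdot> x = P w \<cdot> P z \<cdot> x" by (metis cop_apply_simps(6))
    then have "P z \<cdot> P w \<cdot> x = 0"
      using generalized_eigenspaces_disjoint[OF that(3)] *[OF that(1)] *[OF that(2)] by metis
    then show "(P z * P w) \<cdot> x = 0 \<cdot> x" by simp
  qed
  define E Q where "E = sum P L" and "Q = 1 - E"
  have PE: "P z * E = P z" if z: "z \<in> L" for z
  proof -
    have "P z * E = (\<Sum>w\<in>L. if w = z then P z else 0)"
      unfolding E_def sum_distrib_left by (intro sum.cong) (auto simp: PP P0 z)
    then show ?thesis using z fin by simp
  qed
  have EE: "E * E = E"
  proof -
    have "E * E = (\<Sum>z\<in>L. P z * E)" by (simp add: E_def sum_distrib_right)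
    also have "\<dots> = (\<Sum>z\<in>L. P z)" by (intro sum.cong refl PE)
    also have "\<dots> = E" by (simp add: E_def)
    finally show ?thesis .
  qed
  have QE: "Q * E = 0" "Q * Q = Q" by (simp_all add: Q_def left_diff_distrib right_diff_distrib EE)
  have commE: "b * E = E * b" if "b * a = a * b" for b
    unfolding E_def by (rule commute_sum) (rule aP[OF _ that])
  then have commQ: "b * Q = Q * b" if "b * a = a * b" for b
    using that by (simp add: Q_def left_diff_distrib right_diff_distrib)
  have inv: "\<exists>u. is_inverse (z *\<^sub>C 1 - a * Q) u" if z: "r \<le> cmod z" for z
  proof -
    have z0: "z \<noteq> 0" using z r by auto
    \<comment> \<open>\<open>R\<close> inverts z - a on the image of Q. At a point of
      \<open>L\<close> the Drazin inverse does so, because \<open>P z * Q = 0\<close>; elsewhere the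
      resolvent does.\<close>
    have "\<exists>R. R * a = a * R \<and> (z *\<^sub>C 1 - a) * R * Q = Q"
    proof (cases "z \<in> L")
      case True
      have "(z *\<^sub>C 1 - a) * s z * Q = (1 - P z) * Q" by (simp add: P_def)
      also have "\<dots> = Q - (P z - P z * E)" by (simp add: Q_def left_diff_distrib right_diff_distrib)
      also have "\<dots> = Q" by (simp add: PE[OF True])
      finally have 1: "(z *\<^sub>C 1 - a) * s z * Q = Q" .
      have "a * s z = s z * a"
        by (rule drazin_commute[OF d[OF True]]) (simp add: algebra_simps)
      with 1 show ?thesis by metis
    next
      case False
      then have "z \<notin> spectrum (cop_apply a)"
        using z spectral_radius_ge[of z a] by (auto simp: L_def r_def)
      then obtain u where u: "is_inverse (z *\<^sub>C 1 - a) u" by (auto simp: not_in_spectrum_cop)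
      have "a * u = u * a" by (rule is_inverse_commute[OF u]) (simp add: algebra_simps)
      with u show ?thesis by (intro exI[of _ u]) (simp add: is_inverse_def)
    qed
    then obtain R where R: "R * a = a * R" "(z *\<^sub>C 1 - a) * R * Q = Q" by blast
    \<comment> \<open>\<open>a * Q\<close> is zero on the image of \<open>E\<close>, so there the
      inverse is division by z.\<close>
    define X where "X = R * Q + inverse z *\<^sub>C E"
    have aQR: "a * Q * (R * Q) = a * R * Q"
    proof -
      have "a * Q * (R * Q) = a * (Q * R) * Q" by (simp only: mult.assoc)
      also have "Q * R = R * Q" using commQ[OF R(1)] by simp
      finally show ?thesis using QE(2) by (simp add: mult.assoc)
    qed
    have aQE: "a * Q * E = 0" by (simp add: mult.assoc QE)
    have "(z *\<^sub>C 1 - a * Q) * X = z *\<^sub>C (R * Q) + E - a * R * Q"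
      using z0 by (simp add: X_def distrib_left left_diff_distrib aQR aQE scaleC_scaleC scaleC_one)
    also have "\<dots> = (z *\<^sub>C 1 - a) * R * Q + E" by (simp add: left_diff_distrib)
    also have "\<dots> = 1" unfolding R(2) by (simp add: Q_def)
    finally have X: "(z *\<^sub>C 1 - a * Q) * X = 1" .
    have "a * (R * Q) = R * Q * a" by (intro commute_mult commQ R(1)[symmetric] refl)
    moreover have "a * E = E * a" by (rule commE) simp
    ultimately have aX: "a * X = X * a" by (simp add: X_def distrib_left distrib_right)
    have "X * (a * Q) = a * Q * X" by (intro commute_mult commQ aX[symmetric])
    then have "X * (z *\<^sub>C 1 - a * Q) = (z *\<^sub>C 1 - a * Q) * X"
      by (simp add: left_diff_distrib right_diff_distrib)
    with X show ?thesis by (auto simp: is_inverse_def)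
  qed
  have pow: "(a * Q) ^ n * Q = a ^ n * Q" for n
  proof (induction n)
    case (Suc n)
    have "(a * Q) ^ Suc n * Q = a * Q * (a ^ n * Q)" using Suc by (simp add: mult.assoc)
    also have "\<dots> = a * (Q * a ^ n) * Q" by (simp only: mult.assoc)
    also have "Q * a ^ n = a ^ n * Q" by (rule commQ[symmetric]) (simp add: power_commutes)
    finally show ?case using QE(2) by (simp add: mult.assoc)
  qed simp
  have lim: "(\<lambda>n. inverse r ^ n *\<^sub>R (a * Q) ^ n) \<longlonglongrightarrow> 0"
    by (rule scaled_power_tendsto_zero[OF r inv])
  have "(\<lambda>n. inverse r ^ n *\<^sub>R a ^ n \<cdot> (1 - sum P L) \<cdot> x) \<longlonglongrightarrow> 0" for x
  proof -
    have "(\<lambda>n. (inverse r ^ n *\<^sub>R (a * Q) ^ n) \<cdot> Q \<cdot> x) \<longlonglongrightarrow> 0 \<cdot> Q \<cdot> x"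
      by (intro tendsto_intros lim)
    moreover have "(a * Q) ^ n \<cdot> Q \<cdot> x = a ^ n \<cdot> Q \<cdot> x" for n
      by (simp only: cop_apply_simps(6)[symmetric] pow)
    ultimately show ?thesis by (simp only: Q_def E_def cop_apply_simps(4,8))
  qed
  with fin d P0 show ?thesis using that[of p s P] by (simp add: P_def)
qed

section \<open>Growth and recurrence\<close>

lemma binomial_over_power_tendsto:
  "(\<lambda>n. real (n choose j) / real n ^ j) \<longlonglongrightarrow> 1 / fact j"
proof (induction j)
  case (Suc j)
  have "(\<lambda>n. real (n choose j) / real n ^ j * (1 - real j / real n) / real (Suc j))
      \<longlonglongrightarrow> 1 / fact j * (1 - 0) / real (Suc j)"
    by (intro tendsto_intros Suc lim_const_over_n) simp
  moreover have "\<forall>\<^sub>F n in sequentially. real (n choose j) / real n ^ j * (1 - real j / real n) / real (Suc j)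
      = real (n choose Suc j) / real n ^ Suc j"
    using eventually_ge_at_top[of "Suc j"]
  proof eventually_elim
    case (elim n)
    have "Suc j * (n choose Suc j) = (n - j) * (n choose j)"
      by (simp only: binomial_absorption binomial_absorb_comp)
    then have "real (Suc j) * real (n choose Suc j) = (real n - real j) * real (n choose j)"
      using elim by (metis of_nat_diff of_nat_mult Suc_leD)
    then have "real (n choose Suc j) = (real n - real j) * real (n choose j) / real (Suc j)"
      by (simp add: field_simps del: of_nat_Suc)
    moreover have "1 - real j / real n = (real n - real j) / real n"
      using elim by (simp add: field_simps)
    ultimately show ?case by (simp add: mult_ac)
  qed
  ultimately show ?case by (simp add: Lim_transform_eventually mult.commute)
qed simp

lemma binomial_over_larger_power_tendsto:
  assumes "j \<le> d"
  shows "(\<lambda>n. real (n choose j) / real n ^ d) \<longlonglongrightarrow> (if j = d then 1 / fact d else 0)"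
proof (cases "j = d")
  case False
  have "(\<lambda>n. real (n choose j) / real n ^ j * inverse (real n) ^ (d - j)) \<longlonglongrightarrow> 1 / fact j * 0 ^ (d - j)"
    by (intro tendsto_intros binomial_over_power_tendsto lim_inverse_n)
  moreover have "real (n choose j) / real n ^ j * inverse (real n) ^ (d - j) = real (n choose j) / real n ^ d" for n
    using assms by (simp add: power_inverse power_add[symmetric] divide_inverse mult.assoc
        flip: inverse_mult_distrib)
  ultimately show ?thesis using False assms by (simp add: power_0_left)
qed (simp add: binomial_over_power_tendsto)

text \<open>The binomial theorem for a = z (1 + c), whose sum stops at d because c^(d+1) kills v;
  the number of terms does not depend on n, so the growth can be read off.\<close>

lemma power_on_generalized_eigenvector:
  fixes a :: "'a::complex_banach cop"
  assumes "z \<noteq> 0" and nil: "(z *\<^sub>C 1 - a) ^ Suc d \<cdot> v = 0"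
  shows "a ^ n \<cdot> v = z ^ n *\<^sub>C (\<Sum>j\<le>d. real (n choose j) *\<^sub>R (inverse z *\<^sub>C a - 1) ^ j \<cdot> v)"
proof -
  define c where "c = inverse z *\<^sub>C a - 1"
  have "c = (- inverse z) *\<^sub>C (z *\<^sub>C 1 - a)"
    using assms(1) by (simp add: c_def scaleC_diff_right scaleC_scaleC scaleC_one)
  then have "c ^ Suc d \<cdot> v = (- inverse z) ^ Suc d *\<^sub>C (z *\<^sub>C 1 - a) ^ Suc d \<cdot> v"
    by (simp only: scaleC_power cop_apply_simps(7))
  then have c_nil: "c ^ Suc d \<cdot> v = 0" by (simp only: nil complex_vector.scale_zero_right)
  have a: "a = z *\<^sub>C (1 + c)"
    using assms(1) by (simp add: c_def scaleC_scaleC scaleC_one)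
  \<comment> \<open>One vanishing term is carried along, so that the shift by c in Pascal's rule
    stays inside the range of summation.\<close>
  have "a ^ n \<cdot> v = z ^ n *\<^sub>C (\<Sum>j\<le>Suc d. real (n choose j) *\<^sub>R c ^ j \<cdot> v)"
  proof (induction n)
    case 0
    have "(\<Sum>j\<le>Suc d. real (0 choose j) *\<^sub>R c ^ j \<cdot> v) = (\<Sum>j\<le>Suc d. if j = 0 then v else 0)"
      by (intro sum.cong) auto
    then show ?case by (simp add: scaleC_one)
  next
    case (Suc n)
    define b where "b k j = real (k choose j) *\<^sub>R c ^ j \<cdot> v" for k j
    have b0: "b k 0 = v" for k by (simp add: b_def)
    have last: "b k (Suc d) = 0" for k by (simp only: b_def c_nil scaleR_zero_right)
    have cb: "c \<cdot> b n j = real (n choose j) *\<^sub>R c ^ Suc j \<cdot> v" for j by (simp add: b_def)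
    have pascal: "b (Suc n) (Suc j) = b n (Suc j) + c \<cdot> b n j" for j
      unfolding cb unfolding b_def by (simp only: binomial_Suc_Suc of_nat_add scaleR_add_left add.commute)
    have "a ^ Suc n \<cdot> v = a \<cdot> z ^ n *\<^sub>C (\<Sum>j\<le>Suc d. b n j)"
      unfolding b_def Suc[symmetric] by simp
    also have "\<dots> = z ^ Suc n *\<^sub>C ((\<Sum>j\<le>Suc d. b n j) + c \<cdot> (\<Sum>j\<le>Suc d. b n j))"
      unfolding a by (simp only: cop_apply_simps scaleC_scaleC power_Suc mult.commute)
    also have "c \<cdot> (\<Sum>j\<le>Suc d. b n j) = (\<Sum>j\<le>d. c \<cdot> b n j)"
      by (simp add: last cop_apply_sum_right)
    also have "(\<Sum>j\<le>Suc d. b n j) + \<dots> = v + (\<Sum>j\<le>d. b (Suc n) (Suc j))"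
      unfolding sum.atMost_Suc_shift pascal b0 sum.distrib by (simp only: add.assoc)
    also have "\<dots> = (\<Sum>j\<le>Suc d. b (Suc n) j)" unfolding sum.atMost_Suc_shift b0 ..
    finally show ?case by (simp only: b_def)
  qed
  then show ?thesis using c_nil by (simp add: c_def del: power_Suc)
qed

text \<open>After division by n^d only the top binomial term survives. The phase (z/r)^n need not
  converge, hence a difference tending to 0 instead of a limit.\<close>

lemma growth_on_generalized_eigenvector:
  fixes a :: "'a::complex_banach cop"
  assumes z: "cmod z = r" "0 < r" and nil: "(z *\<^sub>C 1 - a) ^ Suc d \<cdot> v = 0"
  shows "(\<lambda>n. (inverse r ^ n / real n ^ d) *\<^sub>R a ^ n \<cdot> v
    - (z / r) ^ n *\<^sub>C ((- inverse z) ^ d / fact d) *\<^sub>C (z *\<^sub>C 1 - a) ^ d \<cdot> v) \<longlonglongrightarrow> 0"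
proof -
  have z0: "z \<noteq> 0" using z by auto
  define c where "c = inverse z *\<^sub>C a - 1"
  have cd: "c = (- inverse z) *\<^sub>C (z *\<^sub>C 1 - a)"
    using z0 by (simp add: c_def scaleC_diff_right scaleC_scaleC scaleC_one)
  define w where "w = (1 / fact d) *\<^sub>R c ^ d \<cdot> v"
  define D where "D n = (\<Sum>j\<le>d. (real (n choose j) / real n ^ d) *\<^sub>R c ^ j \<cdot> v) - w" for n
  have "(\<lambda>n. \<Sum>j\<le>d. (real (n choose j) / real n ^ d) *\<^sub>R c ^ j \<cdot> v)
      \<longlonglongrightarrow> (\<Sum>j\<le>d. (if j = d then 1 / fact d else 0) *\<^sub>R c ^ j \<cdot> v)"
    by (intro tendsto_intros binomial_over_larger_power_tendsto) simp
  also have "(\<Sum>j\<le>d. (if j = d then 1 / fact d else 0) *\<^sub>R c ^ j \<cdot> v) = (\<Sum>j\<le>d. if j = d then w else 0)"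
    by (intro sum.cong) (auto simp: w_def)
  finally have D0: "D \<longlonglongrightarrow> 0" unfolding D_def by (intro LIM_zero) simp
  have "(inverse r ^ n / real n ^ d) *\<^sub>R a ^ n \<cdot> v - (z / r) ^ n *\<^sub>C w = (z / r) ^ n *\<^sub>C D n" for n
  proof -
    have "(inverse r ^ n / real n ^ d) *\<^sub>R a ^ n \<cdot> v
        = (inverse r ^ n) *\<^sub>R z ^ n *\<^sub>C (\<Sum>j\<le>d. (real (n choose j) / real n ^ d) *\<^sub>R c ^ j \<cdot> v)"
      unfolding power_on_generalized_eigenvector[OF z0 nil] c_def[symmetric]
      by (simp add: scaleR_scaleC scaleR_sum_right divide_inverse mult_ac)
    also have "\<dots> = (z / r) ^ n *\<^sub>C (\<Sum>j\<le>d. (real (n choose j) / real n ^ d) *\<^sub>R c ^ j \<cdot> v)"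
      by (simp add: scaleC_of_real[symmetric] scaleC_scaleC power_divide divide_inverse power_inverse power_mult_distrib mult.commute)
    finally show ?thesis by (simp add: D_def scaleC_diff_right)
  qed
  moreover have "(\<lambda>n. (z / r) ^ n *\<^sub>C D n) \<longlonglongrightarrow> 0"
    using D0 z by (intro Lim_null_comparison[OF _ tendsto_norm_zero[OF D0]])
      (simp add: norm_scaleC norm_power norm_divide)
  moreover have "w = ((- inverse z) ^ d / fact d) *\<^sub>C (z *\<^sub>C 1 - a) ^ d \<cdot> v"
    unfolding w_def cd scaleC_power
    by (simp add: scaleC_of_real[symmetric] scaleC_scaleC)
  ultimately show ?thesis by simp
qed

lemma norm_cis_minus_one_le: "cmod (cis x - 1) \<le> \<bar>x\<bar>"
proof -
  have "cmod (cis x - 1) = 2 * \<bar>sin (x / 2)\<bar>"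
    using dist_exp_i_1[of x] by (simp add: cis_conv_exp)
  also have "\<dots> \<le> \<bar>x\<bar>" using abs_sin_x_le_abs_x[of "x / 2"] by simp
  finally show ?thesis .
qed

text \<open>Dirichlet's simultaneous approximation bounds q but does not make it large; the exponent
  q (k + 1) exceeds k and costs a factor k + 1 in accuracy.\<close>

lemma simultaneous_recurrence:
  assumes "finite L" and L: "\<And>z. z \<in> L \<Longrightarrow> cmod z = 1"
  obtains m :: "nat \<Rightarrow> nat" where "\<And>k. k < m k" "\<And>z. z \<in> L \<Longrightarrow> (\<lambda>k. z ^ m k) \<longlonglongrightarrow> 1"
proof -
  have "\<exists>m. k < m \<and> (\<forall>z\<in>L. cmod (z ^ m - 1) \<le> inverse (real (Suc k)))" for k :: nat
  proof -
    obtain f where f: "bij_betw f {0..<card L} L"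
      using ex_bij_betw_nat_finite[OF assms(1)] by blast
    define \<theta> where "\<theta> i = Arg (f i) / (2 * pi)" for i
    \<comment> \<open>7 exceeds 2 pi; one factor \<open>Suc k\<close> pays for the enlarged
      exponent, the other remains as accuracy.\<close>
    define N where "N = 7 * Suc k * Suc k"
    have "N > 0" by (simp add: N_def)
    then obtain q p where q: "0 < q" "q \<le> int (N ^ card L)"
      "\<And>i. i < card L \<Longrightarrow> \<bar>of_int q * \<theta> i - of_int (p i)\<bar> < 1 / N"
      by (rule Dirichlet_approx_simult[where n = "card L" and \<theta> = \<theta>]) blast
    have le: "cmod (z ^ nat q - 1) \<le> inverse (real (Suc k * Suc k))" if z: "z \<in> L" for z
    proof -
      obtain i where i: "i < card L" "f i = z" using f z by (force simp: bij_betw_def)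
      have "z \<noteq> 0" using L[OF z] by auto
      then have "z = cis (2 * pi * \<theta> i)"
        using L[OF z] i(2) cis_Arg[of z] by (simp add: \<theta>_def sgn_div_norm)
      then have "z ^ nat q = cis (2 * pi * (real (nat q) * \<theta> i))"
        by (simp add: Complex.DeMoivre mult_ac)
      also have "2 * pi * (real (nat q) * \<theta> i) = 2 * pi * (of_int q * \<theta> i - of_int (p i)) + 2 * pi * of_int (p i)"
        using q(1) by (simp add: algebra_simps)
      also have "cis \<dots> = cis (2 * pi * (of_int q * \<theta> i - of_int (p i)))"
        by (simp add: cis_mult[symmetric] cis_multiple_2pi)
      finally have "cmod (z ^ nat q - 1) \<le> 2 * pi * \<bar>of_int q * \<theta> i - of_int (p i)\<bar>"
        using norm_cis_minus_one_le[of "2 * pi * (of_int q * \<theta> i - of_int (p i))"] by (simp add: abs_mult)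
      also have "\<dots> \<le> 2 * pi * (1 / N)" using q(3)[OF i(1)] by (intro mult_left_mono) auto
      also have "\<dots> \<le> 7 * (1 / N)" using pi_less_4 pi_approx by (intro mult_right_mono) auto
      also have "real N = 7 * real (Suc k * Suc k)"
        by (simp only: N_def of_nat_mult of_nat_numeral mult.assoc)
      also have "7 * (1 / (7 * x)) = inverse x" for x :: real by (simp add: inverse_eq_divide)
      finally show ?thesis .
    qed
    have "cmod (z ^ (nat q * Suc k) - 1) \<le> inverse (real (Suc k))" if z: "z \<in> L" for z
    proof -
      have "cmod ((z ^ nat q) ^ Suc k - 1 ^ Suc k) \<le> real (Suc k) * cmod (z ^ nat q - 1)"
        by (rule norm_power_diff) (simp_all add: norm_power L[OF z])
      also have "\<dots> \<le> real (Suc k) * inverse (real (Suc k * Suc k))"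
        by (intro mult_left_mono le[OF z]) simp
      also have "\<dots> = inverse (real (Suc k))"
        by (simp add: field_simps del: of_nat_Suc mult_Suc mult_Suc_right)
      finally show ?thesis by (simp only: power_mult power_one)
    qed
    moreover have "k < nat q * Suc k" using q(1)
      by (metis Suc_le_eq mult_le_mono1 nat_mult_1 zero_less_nat_eq One_nat_def)
    ultimately show ?thesis by blast
  qed
  then obtain m where m: "\<And>k. k < m k" "\<And>k z. z \<in> L \<Longrightarrow> cmod (z ^ m k - 1) \<le> inverse (real (Suc k))"
    by metis
  have "(\<lambda>k. z ^ m k) \<longlonglongrightarrow> 1" if z: "z \<in> L" for z
  proof (rule LIM_zero_cancel, rule Lim_null_comparison)
    show "\<forall>\<^sub>F k in sequentially. cmod (z ^ m k - 1) \<le> inverse (real (Suc k))"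
      by (rule always_eventually) (use m(2)[OF z] in blast)
  qed (rule LIMSEQ_inverse_real_of_nat)
  with m(1) that show ?thesis by blast
qed

section \<open>Invariant complex cones\<close>

lemma C_cone_scaleC: "C_cone C \<Longrightarrow> x \<in> C \<Longrightarrow> c *\<^sub>C x \<in> C"
  unfolding C_cone_def by blast

lemma C_cone_zero: "C_cone C \<Longrightarrow> 0 \<in> C"
  unfolding C_cone_def by (metis complex_vector.scale_zero_left rangeI subsetD)

text \<open>A full line x + c y forces y into \<open>C\<close>, as the limit of x/n + y, and then
  the whole plane, since a x + b y = a (x + (b/a) y) for nonzero a.\<close>

lemma C_cone_no_affine_line:
  fixes x y :: "'a::complex_banach"
  assumes C: "C_cone C" and y: "y \<noteq> 0" and indep: "\<And>c. x \<noteq> c *\<^sub>C y"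
  shows "\<exists>c. x + c *\<^sub>C y \<notin> C"
proof (rule ccontr)
  assume "\<not> ?thesis"
  then have line: "x + c *\<^sub>C y \<in> C" for c by blast
  have closed: "closed C" using C by (simp add: C_cone_def)
  have yC: "y \<in> C"
  proof (rule closed_sequentially[OF closed])
    have "inverse (complex_of_nat (Suc n)) *\<^sub>C (x + complex_of_nat (Suc n) *\<^sub>C y) = inverse (real (Suc n)) *\<^sub>R x + y" for n
      by (simp add: scaleC_add_right scaleC_scaleC scaleC_one scaleC_of_real[symmetric] del: of_nat_Suc)
    then show "inverse (real (Suc n)) *\<^sub>R x + y \<in> C" for n
      by (metis C_cone_scaleC[OF C line])
    have "(\<lambda>n. inverse (real (Suc n)) *\<^sub>R x + y) \<longlonglongrightarrow> 0 *\<^sub>R x + y"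
      by (intro tendsto_intros LIMSEQ_inverse_real_of_nat)
    then show "(\<lambda>n. inverse (real (Suc n)) *\<^sub>R x + y) \<longlonglongrightarrow> y" by simp
  qed
  have "x \<noteq> y" using indep[of 1] by (simp add: scaleC_one)
  moreover have "complex_vector.independent {x, y}"
    using indep y
    by (auto simp: complex_vector.independent_insert complex_vector.span_singleton)
  ultimately have "\<not> complex_vector.span {x, y} \<subseteq> C" using C by (auto simp: C_cone_def)
  moreover have "v \<in> C" if "v \<in> complex_vector.span {x, y}" for v
  proof -
    have "\<exists>a. v - a *\<^sub>C x \<in> complex_vector.span {y}"
      using that by (simp only: complex_vector.span_breakdown_eq)
    then obtain a b where "v - a *\<^sub>C x = b *\<^sub>C y"
      unfolding complex_vector.span_singleton by blast
    then have v: "v = a *\<^sub>C x + b *\<^sub>C y" by (simp add: algebra_simps)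
    show ?thesis
    proof (cases "a = 0")
      case True
      then show ?thesis using C_cone_scaleC[OF C yC] by (simp add: v)
    next
      case False
      then have "v = a *\<^sub>C (x + (b / a) *\<^sub>C y)"
        by (simp add: v scaleC_add_right scaleC_scaleC)
      then show ?thesis using C_cone_scaleC[OF C line] by metis
    qed
  qed
  ultimately show False by blast
qed

lemma cone_power_invariant:
  assumes "C_cone C" "cop_apply a ` (C - {0}) \<subseteq> interior C" "x \<in> C"
  shows "a ^ n \<cdot> x \<in> C"
proof (induction n)
  case (Suc n)
  show ?case
  proof (cases "a ^ n \<cdot> x = 0")
    case True
    then show ?thesis using C_cone_zero[OF assms(1)] by simp
  next
    case False
    with Suc assms(2) have "a \<cdot> a ^ n \<cdot> x \<in> interior C" by blast
    then show ?thesis using interior_subset by (metis cop_apply_simps(6) power_Suc subsetD)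
  qed
qed (simp add: assms(3))

text \<open>The natural preimage of the sum is w, the sum of the z^(-1) v_z, and the point is to
  find it in \<open>C\<close>: it is the limit of r^(-m) a^(m-1) applied to the sum, m running
  through common return times of all z/r.\<close>

lemma cone_eigensum_interior:
  fixes a :: "'a::complex_banach cop"
  assumes C: "C_cone C" and aC: "cop_apply a ` (C - {0}) \<subseteq> interior C"
    and L: "finite L" "\<And>z. z \<in> L \<Longrightarrow> cmod z = r" "0 < r"
    and v: "\<And>z. z \<in> L \<Longrightarrow> a \<cdot> v z = z *\<^sub>C v z"
    and q: "sum v L \<in> C" "sum v L \<noteq> 0"
  shows "sum v L \<in> interior C"
proof -
  define w where "w = (\<Sum>z\<in>L. inverse z *\<^sub>C v z)"
  have nz: "z \<noteq> 0" if "z \<in> L" for z using L(2)[OF that] L(3) by auto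
  have aw: "a \<cdot> w = sum v L"
    unfolding w_def cop_apply_sum_right
    by (intro sum.cong refl) (simp add: v nz scaleC_scaleC scaleC_one)
  define M where "M = (\<lambda>z. z / complex_of_real r) ` L"
  have "finite M" "\<And>y. y \<in> M \<Longrightarrow> cmod y = 1"
    using L by (auto simp: M_def norm_divide)
  then obtain m :: "nat \<Rightarrow> nat" where m: "\<And>k. k < m k" "\<And>y. y \<in> M \<Longrightarrow> (\<lambda>k. y ^ m k) \<longlonglongrightarrow> 1"
    using simultaneous_recurrence by blast
  have av: "a ^ n \<cdot> v z = z ^ n *\<^sub>C v z" if "z \<in> L" for n z
    by (induction n) (simp_all add: scaleC_one v that scaleC_scaleC mult.commute)
  \<comment> \<open>\<open>m k - 1\<close> is true subtraction since \<open>k < m k\<close>; the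
    missing application of \<open>a\<close> becomes the factor z^(-1).\<close>
  define y where "y k = inverse (complex_of_real r) ^ m k *\<^sub>C a ^ (m k - 1) \<cdot> sum v L" for k
  have "y k = (\<Sum>z\<in>L. (z / complex_of_real r) ^ m k *\<^sub>C inverse z *\<^sub>C v z)" for k
    unfolding y_def cop_apply_sum_right complex_vector.scale_sum_right
  proof (intro sum.cong refl)
    fix z assume z: "z \<in> L"
    have "z ^ m k = z ^ (m k - 1) * z"
      using m(1)[of k] by (metis gr_implies_not0 neq0_conv power_minus_mult)
    then have "z ^ (m k - 1) = z ^ m k * inverse z" using nz[OF z] by simp
    then show "inverse (complex_of_real r) ^ m k *\<^sub>C a ^ (m k - 1) \<cdot> v z
        = (z / complex_of_real r) ^ m k *\<^sub>C inverse z *\<^sub>C v z"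
      by (simp add: av[OF z] scaleC_scaleC power_divide divide_inverse power_mult_distrib power_inverse mult_ac)
  qed
  moreover have "(\<lambda>k. \<Sum>z\<in>L. (z / complex_of_real r) ^ m k *\<^sub>C inverse z *\<^sub>C v z)
      \<longlonglongrightarrow> (\<Sum>z\<in>L. 1 *\<^sub>C inverse z *\<^sub>C v z)"
    by (intro tendsto_intros m(2)) (unfold M_def, rule imageI)
  ultimately have lim: "(\<lambda>k. y k) \<longlonglongrightarrow> w" by (simp only: w_def scaleC_one)
  have yC: "y k \<in> C" for k
    unfolding y_def by (intro C_cone_scaleC[OF C] cone_power_invariant[OF C aC] q)
  have "closed C" using C by (simp add: C_cone_def)
  then have "w \<in> C" by (rule closed_sequentially[OF _ yC lim])
  moreover have "w \<noteq> 0" using aw q(2) by auto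
  ultimately have "a \<cdot> w \<in> interior C" by (intro subsetD[OF aC] imageI) simp
  then show ?thesis by (simp only: aw)
qed

text \<open>Inside a line \<open>q + c v\<close> of sums of peripheral eigenvectors that avoids the origin, the cone is both
  closed and (by recurrence) open.\<close>

lemma cone_eigensum_unique:
  fixes a :: "'a::complex_banach cop"
  assumes C: "C_cone C" and aC: "cop_apply a ` (C - {0}) \<subseteq> interior C"
    and L: "finite L" "\<And>z. z \<in> L \<Longrightarrow> cmod z = r" "0 < r"
    and w: "\<And>z. z \<in> L \<Longrightarrow> a \<cdot> w z = z *\<^sub>C w z" "sum w L \<in> C" "sum w L \<noteq> 0"
    and v: "\<And>z. z \<in> L \<Longrightarrow> a \<cdot> v z = z *\<^sub>C v z"
  shows "\<exists>c. sum v L = c *\<^sub>C sum w L"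
proof (rule ccontr)
  assume no: "\<not> ?thesis"
  let ?q = "sum w L" and ?v = "sum v L"
  have v0: "?v \<noteq> 0" using no by (metis complex_vector.scale_zero_left)
  have indep: "?q \<noteq> c *\<^sub>C ?v" for c
  proof
    assume q: "?q = c *\<^sub>C ?v"
    then have "c \<noteq> 0" using w(3) by auto
    then have "?v = inverse c *\<^sub>C ?q" by (simp add: q scaleC_scaleC scaleC_one)
    with no show False by blast
  qed
  define S where "S = (\<lambda>c. ?q + c *\<^sub>C ?v) -` C"
  have cont: "continuous_on UNIV (\<lambda>c. ?q + c *\<^sub>C ?v)"
    by (intro continuous_intros)
  have "closed S"
    unfolding S_def using C cont by (intro closed_vimage) (simp_all add: C_cone_def)
  moreover have "S = (\<lambda>c. ?q + c *\<^sub>C ?v) -` interior C"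
  proof -
    have "?q + c *\<^sub>C ?v \<in> interior C" if "?q + c *\<^sub>C ?v \<in> C" for c
    proof -
      have eq: "?q + c *\<^sub>C ?v = (\<Sum>z\<in>L. w z + c *\<^sub>C v z)"
        by (simp add: sum.distrib complex_vector.scale_sum_right)
      have "?q + c *\<^sub>C ?v \<noteq> 0"
        using indep[of "- c"] by (simp add: add_eq_0_iff2)
      then show ?thesis
        using that unfolding eq
        by (intro cone_eigensum_interior[OF C aC L])
          (simp_all add: w(1) v scaleC_add_right scaleC_scaleC mult.commute)
    qed
    then show ?thesis using interior_subset by (auto simp: S_def)
  qed
  then have "open S" using cont by (simp add: open_vimage)
  moreover have "0 \<in> S" using w(2) by (simp add: S_def)
  ultimately have "S = UNIV"
    using connected_UNIV[where 'a=complex] unfolding connected_clopen[of UNIV]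
    by (metis closedin_closed_eq closed_UNIV empty_iff open_openin openin_open_eq subset_UNIV subtopology_UNIV closed_closedin)
  then show False
    using C_cone_no_affine_line[OF C v0 indep] by (auto simp: S_def)
qed

text \<open>With u = (z - a) v, the vector u is the image of z^(-1) u and so interior to the cone,
  which puts u + v/c into \<open>C\<close> for large c; and \<open>a\<close> sends v + c u to z
  times v + (c - 1/z) u.\<close>

lemma cone_eigenvector_no_jordan_block:
  fixes a :: "'a::complex_banach cop"
  assumes C: "C_cone C" and aC: "cop_apply a ` (C - {0}) \<subseteq> interior C" and z: "z \<noteq> 0"
    and kernel: "\<And>x. a \<cdot> x = z *\<^sub>C x \<Longrightarrow> x \<in> C"
    and v: "(z *\<^sub>C 1 - a) \<cdot> (z *\<^sub>C 1 - a) \<cdot> v = 0"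
  shows "(z *\<^sub>C 1 - a) \<cdot> v = 0"
proof (rule ccontr)
  define u where "u = (z *\<^sub>C 1 - a) \<cdot> v"
  assume "(z *\<^sub>C 1 - a) \<cdot> v \<noteq> 0"
  then have u0: "u \<noteq> 0" by (simp add: u_def)
  have au: "a \<cdot> u = z *\<^sub>C u" using v by (simp add: u_def)
  have av: "a \<cdot> v = z *\<^sub>C v - u" by (simp add: u_def)
  have uC: "u \<in> C" by (rule kernel[OF au])
  have "inverse z *\<^sub>C u \<in> C - {0}" using C_cone_scaleC[OF C uC] u0 z by simp
  moreover have "a \<cdot> inverse z *\<^sub>C u = u" using z by (simp add: au scaleC_scaleC scaleC_one)
  ultimately have "u \<in> interior C" using aC by (metis image_eqI subsetD)
  then obtain e where e: "e > 0" "ball u e \<subseteq> C" by (meson mem_interior)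
  \<comment> \<open>Chosen so that \<open>norm v < K * e\<close>; then v/c is shorter than e as soon
    as |c| is at least \<open>K\<close>.\<close>
  define K where "K = norm v / e + 1"
  have far: "v + c *\<^sub>C u \<in> C" if c: "cmod c \<ge> K" for c
  proof -
    have K0: "K > 0" using e(1) by (simp add: K_def add_nonneg_pos)
    then have c0: "cmod c > 0" using c by linarith
    have "norm v < K * e" using e(1) by (simp add: K_def field_simps)
    also have "\<dots> \<le> cmod c * e" using c e(1) by (intro mult_right_mono) auto
    finally have "norm (inverse c *\<^sub>C v) < e"
      using c0 by (simp add: norm_scaleC norm_inverse norm_divide field_simps)
    then have "u + inverse c *\<^sub>C v \<in> C" by (intro subsetD[OF e(2)]) (simp add: dist_norm)
    from C_cone_scaleC[OF C this, of c] show ?thesis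
      using c0 by (simp add: scaleC_add_right scaleC_scaleC scaleC_one add.commute)
  qed
  have indep: "v \<noteq> c *\<^sub>C u" for c
  proof
    assume v: "v = c *\<^sub>C u"
    then have "a \<cdot> v = z *\<^sub>C v" by (simp add: au scaleC_scaleC mult.commute)
    then show False using u0 by (simp add: u_def)
  qed
  have shift: "v + (c - inverse z) *\<^sub>C u \<in> C" if c: "v + c *\<^sub>C u \<in> C" for c
  proof -
    have "v + c *\<^sub>C u \<noteq> 0" using indep[of "- c"] by (simp add: add_eq_0_iff2)
    with c aC have "a \<cdot> (v + c *\<^sub>C u) \<in> interior C" by blast
    then have "a \<cdot> (v + c *\<^sub>C u) \<in> C" using interior_subset by blast
    then have "inverse z *\<^sub>C a \<cdot> (v + c *\<^sub>C u) \<in> C" by (rule C_cone_scaleC[OF C])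
    moreover have "inverse z *\<^sub>C a \<cdot> (v + c *\<^sub>C u) = v + (c - inverse z) *\<^sub>C u"
      using z by (simp add: av au scaleC_add_right scaleC_diff_right scaleC_diff_left scaleC_scaleC scaleC_one)
    ultimately show ?thesis by simp
  qed
  have shifts: "v + (c - of_nat n * inverse z) *\<^sub>C u \<in> C" if "v + c *\<^sub>C u \<in> C" for c n
  proof (induction n)
    case (Suc n)
    from shift[OF this] show ?case by (simp add: algebra_simps)
  qed (simp add: that)
  have "v + c *\<^sub>C u \<in> C" for c
  proof -
    \<comment> \<open>For this n the number c + n/z has modulus at least \<open>K\<close>, and n
      shifts lead back to c.\<close>
    obtain n :: nat where n: "(K + cmod c) * cmod z \<le> real n" using real_arch_simple by blast
    have "K + cmod c \<le> real n * inverse (cmod z)"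
      using n z by (simp add: field_simps)
    also have "\<dots> = cmod (of_nat n * inverse z)" by (simp add: norm_mult norm_inverse)
    also have "\<dots> \<le> cmod (c + of_nat n * inverse z) + cmod c"
      using norm_triangle_ineq4[of "c + of_nat n * inverse z" c] by simp
    finally have "v + (c + of_nat n * inverse z) *\<^sub>C u \<in> C" by (intro far) simp
    from shifts[OF this, of n] show ?thesis by simp
  qed
  with C_cone_no_affine_line[OF C u0 indep] show False by blast
qed

section \<open>The spectral gap\<close>

text \<open>One exponent d serves all of \<open>L\<close>: the greatest j for which some (z - a)^j
  P_z x is nonzero. Components of smaller height contribute zero to the limit.\<close>

lemma cone_contains_eigensum:
  fixes a :: "'a::complex_banach cop"
  assumes C: "C_cone C" and aC: "cop_apply a ` (C - {0}) \<subseteq> interior C"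
    and L: "finite L" "\<And>z. z \<in> L \<Longrightarrow> cmod z = r" "0 < r"
    and drazin: "\<And>z. z \<in> L \<Longrightarrow> drazin (z *\<^sub>C 1 - a) (p z) (s z)"
    and P: "\<And>z. P z = 1 - (z *\<^sub>C 1 - a) * s z"
      "\<And>z w. z \<in> L \<Longrightarrow> w \<in> L \<Longrightarrow> z \<noteq> w \<Longrightarrow> P z * P w = 0"
    and decay: "\<And>x. (\<lambda>n. inverse r ^ n *\<^sub>R a ^ n \<cdot> (1 - sum P L) \<cdot> x) \<longlonglongrightarrow> 0"
    and x: "x \<in> C" "sum P L \<cdot> x \<noteq> 0"
  shows "\<exists>w. (\<forall>z\<in>L. a \<cdot> w z = z *\<^sub>C w z) \<and> sum w L \<in> C \<and> sum w L \<noteq> 0"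
proof -
  define t where "t z = z *\<^sub>C 1 - a" for z
  have Pcomm: "P z * t y ^ n = t y ^ n * P z" if "z \<in> L" for y z n
  proof -
    have "t y * (z *\<^sub>C 1 - a) = (z *\<^sub>C 1 - a) * t y"
      by (simp add: t_def algebra_simps)
    from drazin_projection(5)[OF drazin[OF that] this] have "t y * P z = P z * t y"
      by (simp add: P(1))
    then show ?thesis using power_commuting_commutes[of "t y" "P z" n] by simp
  qed
  define D where "D = {j. \<exists>z\<in>L. t z ^ j \<cdot> P z \<cdot> x \<noteq> 0}"
  have "D \<subseteq> (\<Union>z\<in>L. {..<p z})"
  proof
    fix j assume "j \<in> D"
    then obtain z where z: "z \<in> L" "t z ^ j \<cdot> P z \<cdot> x \<noteq> 0" by (auto simp: D_def)
    have "j < p z"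
    proof (rule ccontr)
      assume "\<not> j < p z"
      then have "t z ^ j * P z = t z ^ (j - p z) * (t z ^ p z * P z)"
        by (simp add: mult.assoc[symmetric] power_add[symmetric])
      also have "\<dots> = 0"
        using drazin_projection(4)[OF drazin[OF z(1)]] by (simp add: P(1) t_def)
      finally have "(t z ^ j * P z) \<cdot> x = 0" by simp
      with z(2) show False by (simp only: cop_apply_simps)
    qed
    with z(1) show "j \<in> (\<Union>z\<in>L. {..<p z})" by blast
  qed
  then have finD: "finite D" by (rule finite_subset) (use L(1) in auto)
  have "\<exists>z\<in>L. P z \<cdot> x \<noteq> 0"
    using x(2) by (auto simp: cop_apply_sum_left intro: sum.neutral)
  then have "0 \<in> D" by (auto simp: D_def)
  define d where "d = Max D"
  have "d \<in> D" unfolding d_def using finD \<open>0 \<in> D\<close> by (intro Max_in) auto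
  then obtain y where y: "y \<in> L" "t y ^ d \<cdot> P y \<cdot> x \<noteq> 0" by (auto simp: D_def)
  have "Suc d \<notin> D" using Max_ge[OF finD, of "Suc d"] by (auto simp: d_def)
  then have nil: "t z ^ Suc d \<cdot> P z \<cdot> x = 0" if "z \<in> L" for z using that by (auto simp: D_def)
  define w where "w z = ((- inverse z) ^ d / fact d) *\<^sub>C t z ^ d \<cdot> P z \<cdot> x" for z
  have nz: "z \<noteq> 0" if "z \<in> L" for z using L(2)[OF that] L(3) by auto
  have aw: "a \<cdot> w z = z *\<^sub>C w z" if "z \<in> L" for z
  proof -
    have "t z \<cdot> w z = ((- inverse z) ^ d / fact d) *\<^sub>C t z ^ Suc d \<cdot> P z \<cdot> x"
      by (simp only: w_def cop_apply_simps power_Suc)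
    then have "t z \<cdot> w z = 0" by (simp only: nil[OF that] complex_vector.scale_zero_right)
    then show ?thesis by (simp add: t_def)
  qed
  \<comment> \<open>\<open>P y\<close> extracts the summand \<open>w y\<close>, because distinct
    projections annihilate one another; so the sum cannot cancel.\<close>
  have w_ne: "sum w L \<noteq> 0"
  proof
    assume 0: "sum w L = 0"
    have Pw: "P y \<cdot> w z = (if z = y then w y else 0)" if z: "z \<in> L" for z
    proof -
      have "P y \<cdot> w z = ((- inverse z) ^ d / fact d) *\<^sub>C (P y * t z ^ d) \<cdot> P z \<cdot> x"
        by (simp add: w_def)
      also have "\<dots> = ((- inverse z) ^ d / fact d) *\<^sub>C t z ^ d \<cdot> (P y * P z) \<cdot> x"
        by (simp only: Pcomm[OF y(1)] cop_apply_simps(6))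
      also have "\<dots> = (if z = y then w y else 0)"
        using P(2)[OF y(1) z] drazin_projection(2)[OF drazin[OF y(1)]]
        by (auto simp: w_def P(1)[of y, symmetric] simp del: cop_apply_simps(6))
      finally show ?thesis .
    qed
    have "P y \<cdot> sum w L = w y"
      using L(1) y(1) by (simp add: cop_apply_sum_right Pw)
    then have "w y = 0" using 0 by simp
    then show False using y(2) nz[OF y(1)] by (simp add: w_def)
  qed
  define u where "u n = (inverse r ^ n / real n ^ d) *\<^sub>R a ^ n \<cdot> x" for n
  have uC: "u n \<in> C" for n
    unfolding u_def scaleC_of_real[symmetric]
    by (intro C_cone_scaleC[OF C] cone_power_invariant[OF C aC] x)
  define f where "f z n = (inverse r ^ n / real n ^ d) *\<^sub>R a ^ n \<cdot> P z \<cdot> x - (z / complex_of_real r) ^ n *\<^sub>C w z" for z n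
  have f0: "f z \<longlonglongrightarrow> 0" if z: "z \<in> L" for z
    using growth_on_generalized_eigenvector[OF L(2)[OF z] L(3), of a d "P z \<cdot> x"] nil[OF z]
    unfolding f_def w_def t_def by blast
  define g where "g n = (inverse r ^ n / real n ^ d) *\<^sub>R a ^ n \<cdot> (1 - sum P L) \<cdot> x" for n
  have g0: "g \<longlonglongrightarrow> 0"
  proof (rule Lim_null_comparison)
    show "\<forall>\<^sub>F n in sequentially. norm (g n) \<le> norm (inverse r ^ n *\<^sub>R a ^ n \<cdot> (1 - sum P L) \<cdot> x)"
    proof (intro always_eventually allI)
      fix n
      have "g n = (1 / real n ^ d) *\<^sub>R (inverse r ^ n *\<^sub>R a ^ n \<cdot> (1 - sum P L) \<cdot> x)"
        by (simp only: g_def scaleR_scaleR times_divide_eq_left mult_1_left)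
      \<comment> \<open>At n = 0 the divisor is 1 for d = 0 and 0 otherwise, and division by 0 gives
        0.\<close>
      moreover have "\<bar>1 / real n ^ d\<bar> \<le> 1"
      proof (cases "n = 0")
        case False
        then have "1 \<le> real n ^ d" by (intro one_le_power) simp
        then show ?thesis using False by (simp add: divide_le_eq_1)
      qed (cases d; simp)
      ultimately show "norm (g n) \<le> norm (inverse r ^ n *\<^sub>R a ^ n \<cdot> (1 - sum P L) \<cdot> x)"
        by (metis mult_left_le_one_le norm_scaleR norm_ge_zero abs_ge_zero)
    qed
    show "(\<lambda>n. norm (inverse r ^ n *\<^sub>R a ^ n \<cdot> (1 - sum P L) \<cdot> x)) \<longlonglongrightarrow> 0"
      by (rule tendsto_norm_zero[OF decay])
  qed
  have split: "u n = g n + (\<Sum>z\<in>L. f z n) + (\<Sum>z\<in>L. (z / complex_of_real r) ^ n *\<^sub>C w z)" for n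
  proof -
    have "x = (1 - sum P L) \<cdot> x + (\<Sum>z\<in>L. P z \<cdot> x)" by (simp add: cop_apply_sum_left)
    then have "a ^ n \<cdot> x = a ^ n \<cdot> (1 - sum P L) \<cdot> x + (\<Sum>z\<in>L. a ^ n \<cdot> P z \<cdot> x)"
      by (metis cop_apply_simps(9) cop_apply_sum_right)
    then have "u n = g n + (\<Sum>z\<in>L. (inverse r ^ n / real n ^ d) *\<^sub>R a ^ n \<cdot> P z \<cdot> x)"
      by (simp only: u_def g_def scaleR_add_right scaleR_sum_right)
    then show ?thesis by (simp add: f_def sum_subtractf)
  qed
  define M where "M = (\<lambda>z. z / complex_of_real r) ` L"
  have "finite M" "\<And>y. y \<in> M \<Longrightarrow> cmod y = 1"
    using L by (auto simp: M_def norm_divide)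
  then obtain m :: "nat \<Rightarrow> nat" where m: "\<And>k. k < m k" "\<And>y. y \<in> M \<Longrightarrow> (\<lambda>k. y ^ m k) \<longlonglongrightarrow> 1"
    using simultaneous_recurrence by blast
  have m_lim: "filterlim m sequentially sequentially"
    by (rule filterlim_at_top_mono[OF filterlim_ident]) (simp add: m(1) less_imp_le)
  have "(\<lambda>k. g (m k) + (\<Sum>z\<in>L. f z (m k)) + (\<Sum>z\<in>L. (z / complex_of_real r) ^ m k *\<^sub>C w z))
      \<longlonglongrightarrow> 0 + (\<Sum>z\<in>L. 0) + (\<Sum>z\<in>L. 1 *\<^sub>C w z)"
    by (intro tendsto_add tendsto_sum tendsto_scaleC tendsto_const m(2)
        filterlim_compose[OF g0 m_lim] filterlim_compose[OF f0 m_lim]) (auto simp: M_def)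
  then have lim: "(\<lambda>k. u (m k)) \<longlonglongrightarrow> sum w L"
    by (simp only: split[symmetric] scaleC_one sum.neutral_const add_0)
  have "closed C" using C by (simp add: C_cone_def)
  then have "sum w L \<in> C" by (rule closed_sequentially[OF _ uC lim])
  with aw w_ne show ?thesis by blast
qed

section \<open>The Riesz projection at a simple pole\<close>

lemma integral_cis_multiple:
  fixes n :: nat
  assumes "n > 0"
  shows "((\<lambda>\<theta>. cis (real n * \<theta>)) has_integral 0) {0..2 * pi}"
proof -
  have "((\<lambda>\<theta>. cis (real n * \<theta>) / (\<i> * of_nat n)) has_vector_derivative cis (real n * \<theta>)) (at \<theta> within {0..2 * pi})" for \<theta>
    unfolding has_vector_derivative_def using assms
    by (auto intro!: derivative_eq_intros simp: scaleR_conv_of_real field_simps)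
  then have "((\<lambda>\<theta>. cis (real n * \<theta>)) has_integral
      (cis (real n * (2 * pi)) / (\<i> * of_nat n) - cis (real n * 0) / (\<i> * of_nat n))) {0..2 * pi}"
    by (intro fundamental_theorem_of_calculus) auto
  moreover have "cis (real n * (2 * pi)) = 1"
    using cis_multiple_2pi[of "real n"] by (simp add: mult.commute)
  ultimately show ?thesis by simp
qed

text \<open>At a simple pole h times the resolvent at x is P x plus \<open>F\<close>, where
  \<open>F\<close> is h times a power series in h. Its integral vanishes: the partial sums
  \<open>T\<close> contain only positive powers of \<open>cis\<close>, and the remainder on the
  circle is of order 2^(-n).\<close>

lemma riesz_projection_simple:
  fixes a :: "'a::complex_banach cop"
  assumes d: "drazin (z *\<^sub>C 1 - a) p s"
    and tP: "(z *\<^sub>C 1 - a) * (1 - (z *\<^sub>C 1 - a) * s) = 0"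
    and e: "0 < e" "e * norm s \<le> 1 / 2"
  shows "riesz_projection (cop_apply a) z e x = (1 - (z *\<^sub>C 1 - a) * s) \<cdot> x"
proof -
  define t where "t = z *\<^sub>C 1 - a"
  define P where "P = 1 - t * s"
  have "drazin t p s" "t * (1 - t * s) = 0" using d tP by (simp_all only: t_def)
  \<comment> \<open>This lowers the exponent to 1, so that the principal part in
    \<open>drazin_resolvent\<close> is the single term P/h.\<close>
  moreover from this have "t ^ Suc 1 * s = t ^ 1" by (simp add: right_diff_distrib mult.assoc)
  ultimately have d1: "drazin t 1 s" unfolding drazin_def by blast
  have "\<exists>v. is_inverse (1 - h *\<^sub>C (- s)) v" if "cmod h = e" for h
  proof (rule neumann_series)
    show "norm (h *\<^sub>C (- s)) < 1" using e that by (simp add: norm_scaleC)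
  qed
  then obtain U where U: "\<And>h. cmod h = e \<Longrightarrow> is_inverse (1 - h *\<^sub>C (- s)) (U h)" by metis
  have contU: "continuous_on (sphere 0 e) U"
    by (rule continuous_on_inverse_family) (rule U, simp)
  define h where "h \<theta> = complex_of_real e * cis \<theta>" for \<theta>
  have h: "cmod (h \<theta>) = e" for \<theta> using e(1) by (simp add: h_def norm_mult)
  have res: "resolvent (cop_apply a) (z + h \<theta>) = cop_apply (s * U (h \<theta>) + inverse (h \<theta>) *\<^sub>C P)" for \<theta>
  proof (rule resolvent_cop)
    have "h \<theta> \<noteq> 0" using h[of \<theta>] e(1) by auto
    from drazin_resolvent[OF d1 this, of "U (h \<theta>)"] U[OF h[of \<theta>]]
    have "is_inverse (t + h \<theta> *\<^sub>C 1) (s * U (h \<theta>) + inverse (h \<theta>) *\<^sub>C P)"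
      by (simp add: P_def)
    moreover have "(z + h \<theta>) *\<^sub>C 1 - a = t + h \<theta> *\<^sub>C 1" by (simp add: t_def scaleC_add_left)
    ultimately show "is_inverse ((z + h \<theta>) *\<^sub>C 1 - a) (s * U (h \<theta>) + inverse (h \<theta>) *\<^sub>C P)" by simp
  qed
  define F where "F \<theta> = h \<theta> *\<^sub>C s \<cdot> U (h \<theta>) \<cdot> x" for \<theta>
  have integrand: "(of_real e * cis \<theta>) *\<^sub>C resolvent (cop_apply a) (z + of_real e * cis \<theta>) x = F \<theta> + P \<cdot> x" for \<theta>
  proof -
    have "h \<theta> \<noteq> 0" using h[of \<theta>] e(1) by auto
    then have "h \<theta> *\<^sub>C resolvent (cop_apply a) (z + h \<theta>) x = F \<theta> + P \<cdot> x"
      by (simp add: res F_def scaleC_add_right scaleC_scaleC scaleC_one)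
    then show ?thesis by (simp add: h_def)
  qed
  have conth: "continuous_on UNIV h"
    unfolding h_def cis_conv_exp by (intro continuous_intros)
  have "continuous_on {0..2 * pi} F"
    unfolding F_def
    by (intro continuous_on_scaleC continuous_on_cop_apply continuous_on_const
        continuous_on_compose2[OF contU] continuous_on_subset[OF conth]) (auto simp: h)
  then have F_int: "F integrable_on {0..2 * pi}" by (rule integrable_continuous_real)
  \<comment> \<open>The factor \<open>2 * norm 1\<close> bounds \<open>U\<close> on the circle: v =
    1 + y v with y of norm at most 1/2.\<close>
  define K where "K = e * norm s * (2 * norm (1 :: 'a cop) * norm x)"
  have bound: "norm (integral {0..2 * pi} F) \<le> (1 / 2) ^ n * K * (2 * pi)" for n
  proof -
    define T where "T \<theta> = (\<Sum>k<n. (h \<theta> * (- h \<theta>) ^ k) *\<^sub>C s ^ Suc k \<cdot> x)" for \<theta>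
    have "(T has_integral (\<Sum>k<n. 0)) {0..2 * pi}"
      unfolding T_def
    proof (intro has_integral_sum)
      fix k
      let ?y = "s ^ Suc k \<cdot> x" and ?c = "complex_of_real e * (- complex_of_real e) ^ k"
      have lin: "bounded_linear (\<lambda>c. (?c * c) *\<^sub>C ?y)"
        by (intro bounded_linear_compose[OF bounded_linear_scaleC_left bounded_linear_mult_right])
      have "((\<lambda>c. (?c * c) *\<^sub>C ?y) \<circ> (\<lambda>\<theta>. cis (real (Suc k) * \<theta>)) has_integral (?c * 0) *\<^sub>C ?y) {0..2 * pi}"
        by (rule has_integral_linear[OF integral_cis_multiple lin]) simp
      moreover have "?c * cis (real (Suc k) * \<theta>) = h \<theta> * (- h \<theta>) ^ k" for \<theta>
      proof -
        have "cis (real (Suc k) * \<theta>) = cis \<theta> ^ Suc k" by (simp only: Complex.DeMoivre)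
        then show ?thesis by (simp add: h_def power_minus[of "complex_of_real e"]
              power_minus[of "complex_of_real e * cis \<theta>"] power_mult_distrib)
      qed
      ultimately show "((\<lambda>\<theta>. (h \<theta> * (- h \<theta>) ^ k) *\<^sub>C ?y) has_integral 0) {0..2 * pi}"
        by (simp add: o_def)
    qed simp
    then have "((\<lambda>\<theta>. F \<theta> - T \<theta>) has_integral integral {0..2 * pi} F - 0) {0..2 * pi}"
      by (intro has_integral_diff integrable_integral F_int) simp
    moreover have "norm (F \<theta> - T \<theta>) \<le> (1 / 2) ^ n * K" for \<theta>
    proof -
      define y where "y = h \<theta> *\<^sub>C (- s)"
      define v where "v = U (h \<theta>)"
      have v: "(1 - y) * v = 1" using U[OF h[of \<theta>]] by (simp add: is_inverse_def y_def v_def)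
      have y: "norm y \<le> 1 / 2" using e(2) by (simp add: y_def norm_scaleC h)
      have "(\<Sum>k<n. y ^ k) = (\<Sum>k<n. y ^ k) * ((1 - y) * v)" by (simp add: v)
      also have "\<dots> = (1 - y ^ n) * v" by (simp only: mult.assoc[symmetric] one_minus_mult_geometric)
      finally have v_sum: "v = (\<Sum>k<n. y ^ k) + y ^ n * v" by (simp add: left_diff_distrib)
      have "T \<theta> = h \<theta> *\<^sub>C s \<cdot> (\<Sum>k<n. y ^ k) \<cdot> x"
      proof -
        have "y ^ k = (- h \<theta>) ^ k *\<^sub>C s ^ k" for k
        proof -
          have "y = (- h \<theta>) *\<^sub>C s" by (simp add: y_def)
          then show ?thesis by (simp only: scaleC_power)
        qed
        then show ?thesis
          by (simp add: T_def cop_apply_sum_left cop_apply_sum_right complex_vector.scale_sum_right scaleC_scaleC)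
      qed
      moreover have "F \<theta> = h \<theta> *\<^sub>C s \<cdot> ((\<Sum>k<n. y ^ k) + y ^ n * v) \<cdot> x"
        unfolding v_sum[symmetric] by (simp add: F_def v_def)
      ultimately have diff: "F \<theta> - T \<theta> = h \<theta> *\<^sub>C s \<cdot> y ^ n \<cdot> v \<cdot> x"
        by (simp add: scaleC_add_right)
      have "v = 1 + y * v" using v by (simp add: left_diff_distrib diff_eq_eq)
      then have "norm v \<le> norm (1 :: 'a cop) + norm y * norm v"
        by (metis add_left_mono norm_mult_ineq norm_triangle_ineq order_trans)
      also have "norm y * norm v \<le> 1 / 2 * norm v" using y by (intro mult_right_mono) auto
      finally have v_norm: "norm v \<le> 2 * norm (1 :: 'a cop)" by simp
      have pow: "norm (y ^ n \<cdot> u) \<le> (1 / 2) ^ n * norm u" for u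
      proof (induction n)
        case (Suc n)
        have "norm (y ^ Suc n \<cdot> u) \<le> norm y * norm (y ^ n \<cdot> u)" by (simp add: norm_cop_apply)
        also have "\<dots> \<le> 1 / 2 * ((1 / 2) ^ n * norm u)" using y Suc by (intro mult_mono) auto
        finally show ?case by simp
      qed simp
      have "norm (v \<cdot> x) \<le> 2 * norm (1 :: 'a cop) * norm x"
        using norm_cop_apply[of v x] mult_right_mono[OF v_norm, of "norm x"] by simp
      then have "norm (y ^ n \<cdot> v \<cdot> x) \<le> (1 / 2) ^ n * (2 * norm (1 :: 'a cop) * norm x)"
        using pow[of "v \<cdot> x"] by (meson mult_left_mono order_trans zero_le_divide_1_iff zero_le_numeral zero_le_power)
      then have "norm s * norm (y ^ n \<cdot> v \<cdot> x) \<le> norm s * ((1 / 2) ^ n * (2 * norm (1 :: 'a cop) * norm x))"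
        by (intro mult_left_mono) auto
      then have "norm (s \<cdot> y ^ n \<cdot> v \<cdot> x) \<le> norm s * ((1 / 2) ^ n * (2 * norm (1 :: 'a cop) * norm x))"
        using norm_cop_apply order_trans by blast
      then have "e * norm (s \<cdot> y ^ n \<cdot> v \<cdot> x) \<le> e * (norm s * ((1 / 2) ^ n * (2 * norm (1 :: 'a cop) * norm x)))"
        using e(1) by (intro mult_left_mono) auto
      then show ?thesis unfolding diff by (simp add: norm_scaleC h K_def mult_ac)
    qed
    moreover have "0 \<le> (1 / 2) ^ n * K" using e(1) by (simp add: K_def)
    ultimately have "norm (integral {0..2 * pi} F - 0) \<le> (1 / 2) ^ n * K * measure lborel {0..2 * pi}"
      by (intro has_integral_bound_real) auto
    then show ?thesis by simp
  qed
  have "(\<lambda>n. (1 / 2) ^ n * K * (2 * pi)) \<longlonglongrightarrow> 0"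
    by (intro tendsto_mult_left_zero LIMSEQ_power_zero) simp
  then have "norm (integral {0..2 * pi} F) \<le> 0"
    by (rule LIMSEQ_le_const) (use bound in blast)
  then have F0: "integral {0..2 * pi} F = 0" by simp
  have "integral {0..2 * pi} (\<lambda>\<theta>. F \<theta> + P \<cdot> x) = (2 * pi) *\<^sub>R P \<cdot> x"
    by (subst integral_add[OF F_int]) (simp_all add: F0 integrable_const_ivl)
  then show ?thesis
    unfolding riesz_projection_def integrand by (simp add: P_def t_def)
qed

section \<open>The two alternatives, uniqueness of the peripheral eigenvalue, the gap\<close>

lemma fredholm_of_inverse:
  fixes t :: "'a::complex_banach cop"
  assumes "is_inverse t u"
  shows "fredholm (cop_apply t)"
proof -
  have "u \<cdot> t \<cdot> x = x" "t \<cdot> u \<cdot> x = x" for x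
    using assms by (simp_all add: is_inverse_def flip: cop_apply_simps(6))
  then have range: "range (cop_apply t) = UNIV" and kernel: "{x. t \<cdot> x = 0} = {0}"
    by (metis surj_def, metis (mono_tags, lifting) Collect_cong cop_apply_simps(12) singleton_conv)
  show ?thesis
    unfolding fredholm_def range kernel
    by (auto simp: bounded_clinear_cop_apply complex_vector.span_UNIV intro: exI[of _ "{}"])
qed

lemma essential_spectral_radius_bounds:
  fixes a :: "'a::complex_banach cop"
  shows "0 \<le> essential_spectral_radius (cop_apply a)"
    "z \<in> essential_spectrum (cop_apply a) \<Longrightarrow> cmod z \<le> essential_spectral_radius (cop_apply a)"
proof -
  have op: "(\<lambda>x. z *\<^sub>C x - a \<cdot> x) = cop_apply (z *\<^sub>C 1 - a)" for z by (rule ext) simp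
  have "z \<in> spectrum (cop_apply a)" if "z \<in> essential_spectrum (cop_apply a)" for z
    using that fredholm_of_inverse not_in_spectrum_cop unfolding essential_spectrum_def op by blast
  then have "bdd_above (insert 0 (cmod ` essential_spectrum (cop_apply a)))"
    by (auto intro!: bdd_aboveI2 spectrum_norm_le)
  then show "0 \<le> essential_spectral_radius (cop_apply a)"
    "z \<in> essential_spectrum (cop_apply a) \<Longrightarrow> cmod z \<le> essential_spectral_radius (cop_apply a)"
    unfolding essential_spectral_radius_def by (auto intro: cSup_upper)
qed

text \<open>The two alternatives meet here. In the quasi-compact case the radius is positive because
  the essential spectral radius, with its inserted 0, is never negative.\<close>

lemma peripheral_proper_on_bounded:
  fixes a :: "'a::complex_banach cop"
  assumes "quasi_compact (cop_apply a) \<or>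
      compact_op (cop_apply a) \<and> 0 < spectral_radius (cop_apply a)"
  shows "0 < spectral_radius (cop_apply a)"
    "cmod z = spectral_radius (cop_apply a) \<Longrightarrow> proper_on_bounded (z *\<^sub>C 1 - a)"
proof -
  have op: "(\<lambda>x. z *\<^sub>C x - a \<cdot> x) = cop_apply (z *\<^sub>C 1 - a)" for z by (rule ext) simp
  show pos: "0 < spectral_radius (cop_apply a)"
    using assms essential_spectral_radius_bounds(1)[of a] by (auto simp: quasi_compact_def)
  assume z: "cmod z = spectral_radius (cop_apply a)"
  from assms show "proper_on_bounded (z *\<^sub>C 1 - a)"
  proof
    assume "quasi_compact (cop_apply a)"
    then have "essential_spectral_radius (cop_apply a) < cmod z" by (simp add: quasi_compact_def z)
    then have "z \<notin> essential_spectrum (cop_apply a)"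
      using essential_spectral_radius_bounds(2)[of z a] by auto
    then have "fredholm (cop_apply (z *\<^sub>C 1 - a))"
      by (simp only: essential_spectrum_def mem_Collect_eq op not_not)
    then show ?thesis by (rule fredholm_imp_proper_on_bounded)
  next
    assume "compact_op (cop_apply a) \<and> 0 < spectral_radius (cop_apply a)"
    then show ?thesis using z pos by (intro compact_op_imp_proper_on_bounded) auto
  qed
qed

text \<open>\<open>W\<close> turns out to be an eigenvector for every point of \<open>L\<close>, so
  \<open>L\<close> is a singleton. The kernel is then spanned by \<open>W\<close> and lies in the
  cone, as the exclusion of Jordan blocks requires.\<close>

lemma peripheral_eigenvalue_unique_simple:
  fixes a :: "'a::complex_banach cop"
  assumes C: "C_cone C" and aC: "cop_apply a ` (C - {0}) \<subseteq> interior C"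
    and pos: "0 < spectral_radius (cop_apply a)"
    and proper: "\<And>z. cmod z = spectral_radius (cop_apply a) \<Longrightarrow> proper_on_bounded (z *\<^sub>C 1 - a)"
  obtains z p s w where "{z \<in> spectrum (cop_apply a). cmod z = spectral_radius (cop_apply a)} = {z}"
    "drazin (z *\<^sub>C 1 - a) p s" "(z *\<^sub>C 1 - a) * (1 - (z *\<^sub>C 1 - a) * s) = 0"
    "w \<noteq> 0" "\<And>x. a \<cdot> x = z *\<^sub>C x \<longleftrightarrow> (\<exists>c. x = c *\<^sub>C w)"
proof -
  define r where "r = spectral_radius (cop_apply a)"
  define L where "L = {z \<in> spectrum (cop_apply a). cmod z = r}"
  have r: "0 < r" "\<And>z. z \<in> L \<Longrightarrow> cmod z = r" using pos by (auto simp: r_def L_def)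
  have proper_L: "\<And>z. z \<in> L \<Longrightarrow> proper_on_bounded (z *\<^sub>C 1 - a)"
    using proper[folded r_def] r(2) by blast
  obtain p s P where L: "finite L"
    and d: "\<And>z. z \<in> L \<Longrightarrow> drazin (z *\<^sub>C 1 - a) (p z) (s z)"
    and P: "\<And>z. P z = 1 - (z *\<^sub>C 1 - a) * s z"
      "\<And>z w. z \<in> L \<Longrightarrow> w \<in> L \<Longrightarrow> z \<noteq> w \<Longrightarrow> P z * P w = 0"
    and decay: "\<And>x. (\<lambda>n. inverse r ^ n *\<^sub>R a ^ n \<cdot> (1 - sum P L) \<cdot> x) \<longlonglongrightarrow> 0"
    by (rule peripheral_decomposition[of a, folded r_def, folded L_def, OF r(1) proper_L])
      (assumption, (rule that; assumption))
  have P_eig: "P z \<cdot> v = v" if "z \<in> L" "a \<cdot> v = z *\<^sub>C v" for z v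
  proof -
    have "(z *\<^sub>C 1 - a) * s z = s z * (z *\<^sub>C 1 - a)" by (rule drazin_projection(1)[OF d[OF that(1)]])
    then show ?thesis using that(2) by (simp add: P(1) del: cop_times_scaleC)
  qed
  obtain x0 where x0: "x0 \<in> C" "x0 \<noteq> 0"
    using C unfolding C_cone_def by (metis rangeI scaleC_one subsetD)
  have "L \<noteq> {}"
    using spectral_radius_attained[OF spectrum_nonempty[OF x0(2)], of a] by (auto simp: L_def r_def)
  then obtain z0 where z0: "z0 \<in> L" by blast
  obtain v0 where v0: "v0 \<noteq> 0" "a \<cdot> v0 = z0 *\<^sub>C v0"
    using drazin_eigenvector[OF d[OF z0]] z0 by (auto simp: L_def)
  have "sum P L \<cdot> v0 = v0"
  proof -
    have "P z \<cdot> v0 = (if z = z0 then v0 else 0)" if "z \<in> L" for z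
    proof (cases "z = z0")
      case False
      then have "(P z * P z0) \<cdot> v0 = 0" using P(2)[OF that z0] by simp
      then show ?thesis using False P_eig[OF z0 v0(2)] by simp
    qed (use P_eig[OF z0 v0(2)] in simp)
    then show ?thesis using L z0 by (simp add: cop_apply_sum_left)
  qed
  moreover have "a \<cdot> x0 \<in> interior C" using x0 by (intro subsetD[OF aC] imageI) simp
  then obtain e where e: "e > 0" "ball (a \<cdot> x0) e \<subseteq> C" by (meson mem_interior)
  \<comment> \<open>If E kills the interior point a x0, a small multiple of \<open>v0\<close>, which
    E fixes, is added to it.\<close>
  ultimately obtain x where x: "x \<in> C" "sum P L \<cdot> x \<noteq> 0"
  proof (cases "sum P L \<cdot> a \<cdot> x0 = 0")
    case True
    define c where "c = e / (2 * norm v0)"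
    have "c \<noteq> 0" "norm (c *\<^sub>R v0) < e" using e(1) v0(1) by (simp_all add: c_def)
    then have "a \<cdot> x0 + c *\<^sub>R v0 \<in> C" by (intro subsetD[OF e(2)]) (simp add: dist_norm)
    moreover have "sum P L \<cdot> (a \<cdot> x0 + c *\<^sub>R v0) \<noteq> 0"
      using True \<open>sum P L \<cdot> v0 = v0\<close> \<open>c \<noteq> 0\<close> v0(1) by simp
    ultimately show ?thesis using that by blast
  next
    case False
    then show ?thesis using that[of "a \<cdot> x0"] e(1) subsetD[OF e(2), of "a \<cdot> x0"] by simp
  qed
  obtain w where w: "\<And>z. z \<in> L \<Longrightarrow> a \<cdot> w z = z *\<^sub>C w z" "sum w L \<in> C" "sum w L \<noteq> 0"
    using cone_contains_eigensum[OF C aC L r(2) r(1) d P decay x] by metis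
  define W where "W = sum w L"
  have span: "\<exists>c. v = c *\<^sub>C W" if z: "z \<in> L" and v: "a \<cdot> v = z *\<^sub>C v" for z v
  proof -
    \<comment> \<open>A single eigenvector is entered as a family over \<open>L\<close> that
      vanishes at the other points.\<close>
    have "\<exists>c. (\<Sum>y\<in>L. if y = z then v else 0) = c *\<^sub>C sum w L"
      by (rule cone_eigensum_unique[OF C aC L r(2) r(1) w]) (auto simp: v)
    then show ?thesis using L z by (simp add: W_def)
  qed
  have W_eig: "a \<cdot> W = z *\<^sub>C W" if z: "z \<in> L" for z
  proof -
    obtain v where v: "v \<noteq> 0" "a \<cdot> v = z *\<^sub>C v"
      using drazin_eigenvector[OF d[OF z]] z by (auto simp: L_def)
    then obtain c where c: "v = c *\<^sub>C W" using span[OF z] by blast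
    then have "W = inverse c *\<^sub>C v" using v(1) by (auto simp: scaleC_scaleC scaleC_one)
    then show ?thesis using v(2) by (simp add: scaleC_scaleC mult.commute)
  qed
  have "L = {z0}"
  proof -
    have "z = z0" if "z \<in> L" for z
    proof -
      have "(z - z0) *\<^sub>C W = 0" using W_eig[OF that] W_eig[OF z0] by (auto simp: scaleC_diff_left)
      then show ?thesis using w(3) by (simp add: W_def)
    qed
    with z0 show ?thesis by blast
  qed
  moreover have kernel: "a \<cdot> x = z0 *\<^sub>C x \<longleftrightarrow> (\<exists>c. x = c *\<^sub>C W)" for x
    using span[OF z0] W_eig[OF z0] by (auto simp: scaleC_scaleC mult.commute)
  moreover have "(z0 *\<^sub>C 1 - a) * (1 - (z0 *\<^sub>C 1 - a) * s z0) = 0"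
  proof -
    let ?t = "z0 *\<^sub>C 1 - a"
    have nz: "z0 \<noteq> 0" using r(2)[OF z0] r(1) by auto
    have "x \<in> C" if "a \<cdot> x = z0 *\<^sub>C x" for x
      using that w(2) C_cone_scaleC[OF C] by (auto simp: kernel W_def)
    then have square: "?t \<cdot> x = 0" if "?t \<cdot> ?t \<cdot> x = 0" for x
      by (rule cone_eigenvector_no_jordan_block[OF C aC nz _ that])
    have nil: "?t \<cdot> x = 0" if "?t ^ n \<cdot> x = 0" for n x
      using that
    proof (induction n arbitrary: x)
      case (Suc n)
      then have "?t ^ n \<cdot> ?t \<cdot> x = 0" by (simp only: power_Suc2 cop_apply_simps(6))
      then show ?case by (rule square[OF Suc.IH])
    qed simp
    have "?t ^ p z0 \<cdot> (1 - ?t * s z0) \<cdot> x = 0" for x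
      unfolding cop_apply_simps(6)[symmetric] drazin_projection(4)[OF d[OF z0]] by simp
    then have "?t \<cdot> (1 - ?t * s z0) \<cdot> x = 0" for x by (rule nil)
    then show ?thesis by (intro cop_eqI) (simp only: cop_apply_simps(4,6))
  qed
  ultimately show ?thesis
    using that[of z0 "p z0" "s z0" W] d[OF z0] w(3) by (simp add: L_def r_def W_def)
qed

theorem theorem8p5:
  fixes C :: "'a::complex_banach set" and A :: "'a \<Rightarrow> 'a"
  assumes "C_cone C"
    and "bounded_clinear A"
    and "quasi_compact A \<or> (compact_op A \<and> spectral_radius A > 0)"
    and "A ` (C - {0}) \<subseteq> interior C"
  shows "spectral_gap A"
proof -
  define a where "a = cop_of A"
  have A: "A = cop_apply a" by (simp add: a_def cop_apply_cop_of assms(2))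
  define r where "r = spectral_radius A"
  note proper = peripheral_proper_on_bounded[OF assms(3)[unfolded A]]
  obtain z p s w
    where peripheral: "{z \<in> spectrum (cop_apply a). cmod z = spectral_radius (cop_apply a)} = {z}"
    and d: "drazin (z *\<^sub>C 1 - a) p s" and tP: "(z *\<^sub>C 1 - a) * (1 - (z *\<^sub>C 1 - a) * s) = 0"
    and w: "w \<noteq> 0" "\<And>x. a \<cdot> x = z *\<^sub>C x \<longleftrightarrow> (\<exists>c. x = c *\<^sub>C w)"
    by (rule peripheral_eigenvalue_unique_simple[OF assms(1) assms(4)[unfolded A] proper])
      (assumption, (rule that; assumption))
  have z: "{z \<in> spectrum A. cmod z = r} = {z}" using peripheral by (simp only: A r_def)
  then have zA: "z \<in> spectrum A" "cmod z = r" by auto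
  obtain e0 where e0: "e0 > 0"
    "\<And>h. h \<noteq> 0 \<Longrightarrow> cmod h < e0 \<Longrightarrow> \<exists>u. is_inverse (z *\<^sub>C 1 - a + h *\<^sub>C 1) u"
    using drazin_isolated[OF d] by blast
  have isolated: "y = z" if y: "y \<in> spectrum A" "dist z y < e0" for y
  proof (rule ccontr)
    assume "y \<noteq> z"
    then obtain u where "is_inverse (z *\<^sub>C 1 - a + (y - z) *\<^sub>C 1) u"
      using e0(2)[of "y - z"] y(2) by (auto simp: dist_norm norm_minus_commute)
    then have "is_inverse (y *\<^sub>C 1 - a) u" by (simp add: scaleC_diff_left)
    then show False using y(1) not_in_spectrum_cop unfolding A by blast
  qed
  \<comment> \<open>Half of \<open>e0\<close> keeps the closed disk within the isolation radius; the
    second bound gives \<open>e * norm s\<close> at most 1/2, again with \<open>+ 1\<close> for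
    \<open>s = 0\<close>.\<close>
  define e where "e = min (e0 / 2) (inverse (2 * (norm s + 1)))"
  have s1: "0 < norm s + 1" by (simp add: add_nonneg_pos)
  then have e: "0 < e" "e < e0" using e0(1) by (simp_all add: e_def)
  have "e * norm s \<le> inverse (2 * (norm s + 1)) * (norm s + 1)"
    using s1 by (intro mult_mono) (simp_all add: e_def)
  also have "\<dots> = 1 / 2" using s1 by (simp add: field_simps)
  finally have es: "e * norm s \<le> 1 / 2" .
  have "range (riesz_projection A z e) = complex_vector.span {w}"
  proof -
    let ?t = "z *\<^sub>C 1 - a"
    have "riesz_projection A z e x = (1 - ?t * s) \<cdot> x" for x
      unfolding A by (rule riesz_projection_simple[OF d tP e(1) es])
    moreover have "range (cop_apply (1 - ?t * s)) = {x. a \<cdot> x = z *\<^sub>C x}"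
    proof (intro set_eqI iffI)
      fix x assume "x \<in> range (cop_apply (1 - ?t * s))"
      then obtain y where "x = (1 - ?t * s) \<cdot> y" by blast
      then have "?t \<cdot> x = (?t * (1 - ?t * s)) \<cdot> y" by (simp only: cop_apply_simps(6))
      then have "?t \<cdot> x = 0" by (simp only: tP cop_apply_simps(4))
      then show "x \<in> {x. a \<cdot> x = z *\<^sub>C x}" by simp
    next
      fix x assume "x \<in> {x. a \<cdot> x = z *\<^sub>C x}"
      then have "?t \<cdot> x = 0" by simp
      then have "(1 - ?t * s) \<cdot> x = x"
        unfolding drazin_projection(1)[OF d] cop_apply_simps(2)[of 1] cop_apply_simps(6) by simp
      then show "x \<in> range (cop_apply (1 - ?t * s))" by (metis rangeI)
    qed
    ultimately have "range (riesz_projection A z e) = {x. a \<cdot> x = z *\<^sub>C x}" by simp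
    then show ?thesis by (auto simp: w(2) complex_vector.span_singleton)
  qed
  moreover have "complex_vector.independent {w}" using w(1) by simp
  ultimately have "complex_vector.dim (range (riesz_projection A z e)) = 1"
    by (simp add: complex_vector.dim_eq_card_independent)
  moreover have "eigenvalue A z"
    unfolding eigenvalue_def A using w(1) w(2)[of w] by (metis scaleC_one)
  moreover have "spectrum A \<inter> cball z e = {z}"
    using isolated zA(1) e by (auto simp: dist_norm)
  ultimately have simple: "simple_isolated_eigenvalue A z"
    unfolding simple_isolated_eigenvalue_def using e(1) by blast
  have "\<exists>q. 0 \<le> q \<and> q < r \<and> spectrum A - {z} \<subseteq> cball 0 q"
  proof (cases "spectrum A - {z} = {}")
    case True
    then have "spectrum A - {z} \<subseteq> cball 0 0" by blast
    then show ?thesis using proper(1) unfolding r_def A by blast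
  next
    case False
    \<comment> \<open>Removing an open ball instead of the point shows that the rest is compact, so
      its largest modulus is attained and serves as the radius.\<close>
    have eq: "spectrum A - {z} = spectrum A - ball z e0" using isolated e0(1) by auto
    have "compact (spectrum A - {z})"
      unfolding eq unfolding A by (intro compact_diff compact_spectrum open_ball)
    then obtain y where y: "y \<in> spectrum A - {z}" "\<And>x. x \<in> spectrum A - {z} \<Longrightarrow> cmod x \<le> cmod y"
      using continuous_attains_sup[OF _ False, of cmod] by (auto intro: continuous_intros)
    have "cmod y \<le> r" using y(1) spectral_radius_ge[of y a] by (simp add: r_def A)
    moreover have "cmod y \<noteq> r" using y(1) z by blast
    moreover have "spectrum A - {z} \<subseteq> cball 0 (cmod y)"
      using y(2) by (intro subsetI) (simp only: mem_cball_0)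
    ultimately show ?thesis by (intro exI[of _ "cmod y"]) simp
  qed
  with simple zA(2) show ?thesis unfolding spectral_gap_def r_def by blast
qed

end
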